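(* Let $\gamma_R=0.1216$ and $\gamma_B=6.048$. For $\gamma\ge0$, let $\mathbb{P}_R$ be the distribution that is deterministically equal to $1$ (all red intervals initially have length $1$), and let $\mathbb{P}_B$ be the uniform distribution on $[0,1+\gamma]$ (initial lengths of blue intervals). If $0\le\gamma\le\gamma_R$, then red wins almost surely, and if $\gamma\ge\gamma_B$, then blue wins almost surely.
   Context: Colourings. A colouring of $\mathbb{R}$ into intervals is given by a doubly infinite sequence of boundary-points $(p_i)_{i\in\mathbb{Z}}$ with $p_i<p_j$ when $i<j$ and $\mathbb{R}=\bigcup_{i\in\mathbb{Z}}(p_i,p_{i+1}]$, where each $(p_{2i-1},p_{2i}]$ is coloured red and each $(p_{2i},p_{2i+1}]$ is coloured blue. Recolourings. A recolouring picks a monochromatic interval (between two consecutive current boundary-points) whose two neighbouring intervals (of the opposite colour) are both strictly longer, and changes its colour, so that these three consecutive intervals subsequently form a single monochromatic interval (its two endpoints cease to be boundary-points). A sequence of recolourings (finite, or infinite and indexed by $1,2,3,\dots$), performed successively starting from an initial colouring $\Delta$, is complete if whenever at some stage there is a monochromatic interval $I$ both of whose neighbours are longer, $I$ is recoloured at that or some later step. Random colouring. Let $(\mathcal{R}_i)_{i\in\mathbb{Z}}$ and $(\mathcal{B}_i)_{i\in\mathbb{Z}}$ be i.i.d. sequences, independent of each other, with distributions $\mathbb{P}_R$ and $\mathbb{P}_B$ respectively. $\Delta(\mathbb{P}_R,\mathbb{P}_B)$ is the colouring of the line into consecutive intervals $\dots,R_{-1},B_{-1},R_0,B_0,R_1,B_1,\dots$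 (left to right), where $R_i$ is red of length $\mathcal{R}_i$, $B_i$ is blue of length $\mathcal{B}_i$, and the origin is the boundary-point between $R_0$ and $B_0$. Winning. A colour (red or blue) wins almost surely (for the pair $\mathbb{P}_R,\mathbb{P}_B$) if, almost surely, under any complete sequence of recolourings applied to $\Delta(\mathbb{P}_R,\mathbb{P}_B)$, every point of $\mathbb{R}$ changes colour only finitely many times and is finally of that colour. *)

theory Defs
  imports "HOL-Probability.Probability"
begin

section \<open>Colourings\<close>

datatype colour = Red | Blue

fun opposite :: "colour \<Rightarrow> colour" where
  "opposite Red = Blue"
| "opposite Blue = Red"

definition valid_boundaries :: "(int \<Rightarrow> real) \<Rightarrow> bool" where
  "valid_boundaries p \<longleftrightarrow> (\<forall>i j. i < j \<longrightarrow> p i < p j) \<and> (\<Union>i. {p i<..p (i + 1)}) = UNIV"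

text \<open>
  A colouring is kept as its set of current boundary-points together with the colour of every
  point of the line.  Recolouring can remove boundary-points, so an indexing of them by the
  integers is used only for the initial colouring.
\<close>

type_synonym colouring = "real set \<times> (real \<Rightarrow> colour)"

abbreviation boundary_points :: "colouring \<Rightarrow> real set" where
  "boundary_points \<equiv> fst"

abbreviation colour_at :: "colouring \<Rightarrow> real \<Rightarrow> colour" where
  "colour_at \<equiv> snd"

text \<open>For valid \<open>p\<close> the points not in any red interval are those in the blue ones.\<close>

definition colouring_of :: "(int \<Rightarrow> real) \<Rightarrow> colouring" where
  "colouring_of p =
     (range p, \<lambda>x. if \<exists>i. x \<in> {p (2 * i - 1)<..p (2 * i)} then Red else Blue)"

lemma colour_at_colouring_of_blue:
  assumes "valid_boundaries p" and "x \<in> {p (2 * i)<..p (2 * i + 1)}"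
  shows "colour_at (colouring_of p) x = Blue"
proof -
  have mono: "p k \<le> p l" if "k \<le> l" for k l
    using assms(1) that unfolding valid_boundaries_def by (cases "k = l") (auto simp: less_le)
  have "\<not> (\<exists>j. x \<in> {p (2 * j - 1)<..p (2 * j)})"
  proof
    assume "\<exists>j. x \<in> {p (2 * j - 1)<..p (2 * j)}"
    then obtain j where j: "p (2 * j - 1) < x" "x \<le> p (2 * j)" by auto
    show False
    proof (cases "j \<le> i")
      case True
      then show ?thesis using mono[of "2 * j" "2 * i"] j assms(2) by auto
    next
      case False
      then show ?thesis using mono[of "2 * i + 1" "2 * j - 1"] j assms(2) by auto
    qed
  qed
  then show ?thesis by (simp add: colouring_of_def)
qed


section \<open>Recolourings\<close>

text \<open>A pair \<open>(a, b)\<close> stands for the interval \<open>{a<..b}\<close>.\<close>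

definition mono_interval :: "colouring \<Rightarrow> real \<times> real \<Rightarrow> bool" where
  "mono_interval C = (\<lambda>(a, b). a \<in> boundary_points C \<and> b \<in> boundary_points C \<and> a < b \<and>
     boundary_points C \<inter> {a<..<b} = {})"

definition recolourable :: "colouring \<Rightarrow> real \<times> real \<Rightarrow> bool" where
  "recolourable C = (\<lambda>(a, b). mono_interval C (a, b) \<and>
     (\<exists>w z. mono_interval C (w, a) \<and> mono_interval C (b, z) \<and> a - w > b - a \<and> z - b > b - a))"

definition recolour :: "colouring \<Rightarrow> real \<times> real \<Rightarrow> colouring" where
  "recolour C = (\<lambda>(a, b). (boundary_points C - {a, b},
     \<lambda>x. if x \<in> {a<..b} then opposite (colour_at C x) else colour_at C x))"

text \<open>
  A sequence of recolourings has a length \<open>N\<close>, possibly infinite; its steps are the \<open>n\<close> with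
  \<open>enat n < N\<close>, step \<open>n\<close> (counted from \<open>0\<close>) recolours the interval \<open>I n\<close>, and \<open>stage C I n\<close>
  is the colouring just before that step.  Thus the stages that occur are those with
  \<open>enat n \<le> N\<close>, and values \<open>I n\<close> with \<open>enat n \<ge> N\<close> are irrelevant.
\<close>

primrec stage :: "colouring \<Rightarrow> (nat \<Rightarrow> real \<times> real) \<Rightarrow> nat \<Rightarrow> colouring" where
  "stage C I 0 = C"
| "stage C I (Suc n) = recolour (stage C I n) (I n)"

definition recolouring_seq :: "colouring \<Rightarrow> enat \<Rightarrow> (nat \<Rightarrow> real \<times> real) \<Rightarrow> bool" where
  "recolouring_seq C N I \<longleftrightarrow> (\<forall>n. enat n < N \<longrightarrow> recolourable (stage C I n) (I n))"

definition complete_seq :: "colouring \<Rightarrow> enat \<Rightarrow> (nat \<Rightarrow> real \<times> real) \<Rightarrow> bool" where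
  "complete_seq C N I \<longleftrightarrow> recolouring_seq C N I \<and>
     (\<forall>n J. enat n \<le> N \<and> recolourable (stage C I n) J \<longrightarrow>
        (\<exists>m\<ge>n. enat m < N \<and> I m = J))"

definition finally_everywhere ::
    "colour \<Rightarrow> colouring \<Rightarrow> enat \<Rightarrow> (nat \<Rightarrow> real \<times> real) \<Rightarrow> bool" where
  "finally_everywhere c C N I \<longleftrightarrow> (\<forall>x.
     finite {n. enat n < N \<and> colour_at (stage C I (Suc n)) x \<noteq> colour_at (stage C I n) x} \<and>
     (\<exists>k. enat k \<le> N \<and> (\<forall>n\<ge>k. enat n \<le> N \<longrightarrow> colour_at (stage C I n) x = c)))"


section \<open>Random colourings\<close>

text \<open>
  The boundary-points of the colouring into intervals of lengths
  \<open>\<dots>, r (-1), b (-1), r 0, b 0, r 1, b 1, \<dots>\<close> with the origin between \<open>r 0\<close> and \<open>b 0\<close>: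
  \<open>gap r b j\<close> is the length of the interval from boundary-point \<open>j\<close> to boundary-point \<open>j + 1\<close>.
\<close>

definition gap :: "(int \<Rightarrow> real) \<Rightarrow> (int \<Rightarrow> real) \<Rightarrow> int \<Rightarrow> real" where
  "gap r b j = (if even j then b (j div 2) else r ((j + 1) div 2))"

definition boundaries :: "(int \<Rightarrow> real) \<Rightarrow> (int \<Rightarrow> real) \<Rightarrow> int \<Rightarrow> real" where
  "boundaries r b i =
     (if 0 \<le> i then (\<Sum>j\<in>{0..<i}. gap r b j) else - (\<Sum>j\<in>{i..<0}. gap r b j))"

lemma boundaries_0: "boundaries r b 0 = 0"
  by (simp add: boundaries_def)

lemma boundaries_step: "boundaries r b (i + 1) - boundaries r b i = gap r b i"
proof (cases "0 \<le> i")
  case True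
  then have "{0..<i + 1} = insert i {0..<i}" by auto
  then show ?thesis using True by (simp add: boundaries_def)
next
  case False
  then have "{i..<0} = insert i {i + 1..<0}" by auto
  then show ?thesis using False by (auto simp: boundaries_def)
qed

lemma boundaries_blue: "boundaries r b (2 * i + 1) - boundaries r b (2 * i) = b i"
  using boundaries_step[of r b "2 * i"] by (simp add: gap_def)

lemma boundaries_red: "boundaries r b (2 * i) - boundaries r b (2 * i - 1) = r i"
  using boundaries_step[of r b "2 * i - 1"] by (simp add: gap_def)

definition length_space ::
    "real measure \<Rightarrow> real measure \<Rightarrow> ((int \<Rightarrow> real) \<times> (int \<Rightarrow> real)) measure" where
  "length_space PR PB = (\<Pi>\<^sub>M i\<in>UNIV. PR) \<Otimes>\<^sub>M (\<Pi>\<^sub>M i\<in>UNIV. PB)"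

text \<open>The first conjunct says that the given lengths do yield a colouring of the whole line.\<close>

definition colour_wins :: "colour \<Rightarrow> (int \<Rightarrow> real) \<Rightarrow> (int \<Rightarrow> real) \<Rightarrow> bool" where
  "colour_wins c r b \<longleftrightarrow> valid_boundaries (boundaries r b) \<and>
     (\<forall>N I. complete_seq (colouring_of (boundaries r b)) N I \<longrightarrow>
        finally_everywhere c (colouring_of (boundaries r b)) N I)"

text \<open>
  The lengths are realised on the canonical product space; lemma \<open>wins_almost_surely_iid\<close>
  transfers the conclusion to i.i.d. sequences on any probability space.
\<close>

definition wins_almost_surely :: "colour \<Rightarrow> real measure \<Rightarrow> real measure \<Rightarrow> bool" where
  "wins_almost_surely c PR PB \<longleftrightarrow> (AE \<omega> in length_space PR PB. colour_wins c (fst \<omega>) (snd \<omega>))"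

lemma (in prob_space) wins_almost_surely_iid:
  fixes R B :: "int \<Rightarrow> 'a \<Rightarrow> real"
  assumes R: "indep_vars (\<lambda>_. borel) R UNIV" "\<And>i. distr M borel (R i) = PR"
    and B: "indep_vars (\<lambda>_. borel) B UNIV" "\<And>i. distr M borel (B i) = PB"
    and RB: "indep_var (\<Pi>\<^sub>M i\<in>UNIV. borel) (\<lambda>\<omega> i. R i \<omega>) (\<Pi>\<^sub>M i\<in>UNIV. borel) (\<lambda>\<omega> i. B i \<omega>)"
    and wins: "wins_almost_surely c PR PB"
  shows "AE \<omega> in M. colour_wins c (\<lambda>i. R i \<omega>) (\<lambda>i. B i \<omega>)"
proof -
  have joint: "distr M (\<Pi>\<^sub>M i\<in>UNIV. borel) (\<lambda>\<omega> i. X i \<omega>) = (\<Pi>\<^sub>M i\<in>UNIV. P)"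
    if X: "indep_vars (\<lambda>_. borel) X UNIV" "\<And>i. distr M borel (X i) = P"
    for X :: "int \<Rightarrow> 'a \<Rightarrow> real" and P
  proof -
    have rv: "\<And>i. random_variable borel (X i)"
      using X(1) by (auto simp: indep_vars_def)
    show ?thesis
      using indep_vars_iff_distr_eq_PiM'[of UNIV X "\<lambda>_. borel"] rv X by (simp add: restrict_UNIV)
  qed
  let ?Y = "\<lambda>\<omega>. (\<lambda>i. R i \<omega>, \<lambda>i. B i \<omega>)"
  let ?S = "(\<Pi>\<^sub>M i\<in>UNIV. borel) \<Otimes>\<^sub>M (\<Pi>\<^sub>M i\<in>UNIV. borel) ::
    ((int \<Rightarrow> real) \<times> (int \<Rightarrow> real)) measure"
  have Y: "?Y \<in> measurable M ?S"
    using indep_var_rv1[OF RB] indep_var_rv2[OF RB] by measurable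
  have law: "distr M ?S ?Y = length_space PR PB"
    using RB joint[OF R] joint[OF B]
    by (simp add: indep_var_distribution_eq length_space_def)
  have "AE \<omega> in distr M ?S ?Y. colour_wins c (fst \<omega>) (snd \<omega>)"
    unfolding law using wins by (simp only: wins_almost_surely_def)
  from AE_distrD[OF Y this] show ?thesis by simp
qed

end

(*
  A losing interval can only grow by swallowing a winning interval that is shorter than both of the
  losing intervals next to it.  Every losing interval that can ever appear to the right of a given
  boundary-point is therefore, whatever the order of the recolourings, contained in an interval
  built by a binary tree of such joins, starting from maximal runs of blue lengths at most 1 (if red
  loses) or at least 1 (if blue loses).  Let H be the expected total length of the trees starting at
  a given place, let h be the contribution of the runs, and suppose that a tree is followed by at
  most q m gaps shorter than m on average.  A union bound over the two subtrees and the gap between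
  them, which are independent, then gives H <= h + 3 q H^2, so H is finite as soon as 12 q h <= 1.
  This holds for both ranges of the parameter.

  Since H is finite, with positive probability a long stretch of winning intervals separated only by
  immediately recolourable ones is never matched by a losing interval to its right; almost surely
  there are such seeds arbitrarily far to the left and, by reflection, arbitrarily far to the right
  of any point.  Between two seeds only finitely many boundary-points are left, and as there are
  almost surely no ties, the shortest interval between them could be recoloured as long as
  any of them remains.
*)

theory Submission
  imports Defs
begin

section \<open>Dynamics\<close>

text \<open>When \<gamma> > 0 there are losing intervals of every length somewhere on the line, so
  no seed resists all of them by its own length. What saves it is distance: a winning interval that
  contains a seed and touches a losing interval far away also contains everything in between, and
  every blue letter in between comes with a red unit. An opponent that starts \<open>u\<close>
  letters beyond a seed of length \<open>L\<close> must therefore have length at least about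
  \<open>L + u\<close>. The chance that this rising barrier is ever crossed is at most a sum over
  \<open>u\<close> of tails of the tree length; it tends to 0 as \<open>L\<close> grows once the
  first moment is finite, which is why a first moment is the quantity to control.

  Whether a barrier holds depends on all letters to its right, so different places are not
  independent. The core of a seed is placed to the left of its barrier, on letters that the barrier
  does not see.

  Both colours share one argument: \<open>c\<close> is the winner, \<open>A\<close> the set of
  letters that make up runs, and \<open>k\<close> the least length of a run that can take part in a
  join. Only the numbers \<open>q\<close> and \<open>h\<close> are found separately.\<close>

definition colour_from :: "int \<Rightarrow> colour" where
  "colour_from i = (if even i then Blue else Red)"

lemma colour_from_odd: "odd (j - i) \<Longrightarrow> colour_from j = opposite (colour_from i)"
  by (auto simp: colour_from_def)

lemma colour_from_even: "even (j - i) \<Longrightarrow> colour_from j = colour_from i"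
  by (auto simp: colour_from_def)

lemma opposite_opposite [simp]: "opposite (opposite c) = c"
  by (cases c) auto

lemma opposite_neq [simp]: "opposite c \<noteq> c" "c \<noteq> opposite c"
  by (cases c; simp)+

lemma neq_opposite: "c \<noteq> d \<longleftrightarrow> c = opposite d"
  by (cases c; cases d; simp)

text \<open>An order-free superset of the intervals that any sequence of recolourings can produce.
  The middle interval enters only through its length and its parity, so that gap and sides can later
  be estimated separately. Oddness of \<open>k - j\<close> gives both sides the same colour.\<close>

inductive formable :: "(int \<Rightarrow> real) \<Rightarrow> int \<Rightarrow> int \<Rightarrow> bool" for p where
  single: "formable p i (i + 1)"
| merge: "\<lbrakk>formable p i j; formable p k l; j < k; odd (k - j);
    p k - p j < p j - p i; p k - p j < p l - p k\<rbrakk> \<Longrightarrow> formable p i l"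

lemma formable_less: "formable p i j \<Longrightarrow> i < j"
  by (induction rule: formable.induct) auto

lemma formable_odd: "formable p i j \<Longrightarrow> odd (j - i)"
  by (induction rule: formable.induct) auto

section \<open>Consecutive elements of a set of boundary indices\<close>

definition adjacent :: "int set \<Rightarrow> int \<Rightarrow> int \<Rightarrow> bool" where
  "adjacent S i j \<longleftrightarrow> i \<in> S \<and> j \<in> S \<and> i < j \<and> S \<inter> {i<..<j} = {}"

lemma adjacent_le: "adjacent S i j \<Longrightarrow> a \<in> S \<Longrightarrow> a < j \<Longrightarrow> a \<le> i"
  unfolding adjacent_def by (metis disjoint_iff greaterThanLessThan_iff not_le)

lemma adjacent_ge: "adjacent S i j \<Longrightarrow> a \<in> S \<Longrightarrow> i < a \<Longrightarrow> j \<le> a"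
  unfolding adjacent_def by (metis disjoint_iff greaterThanLessThan_iff not_le)

lemma adjacent_unique_right: "adjacent S i j \<Longrightarrow> adjacent S i k \<Longrightarrow> j = k"
  using adjacent_ge[of S i j k] adjacent_ge[of S i k j] by (force simp: adjacent_def)

lemma adjacent_unique_left: "adjacent S i k \<Longrightarrow> adjacent S j k \<Longrightarrow> i = j"
  using adjacent_le[of S i k j] adjacent_le[of S j k i] by (force simp: adjacent_def)

text \<open>The combinatorial effect of one recolouring: its two end points vanish, three
  consecutive intervals become one, and all others persist.\<close>

lemma adjacent_remove:
  assumes "adjacent S i j" "adjacent S j k" "adjacent S k l"
    and ab: "adjacent (S - {j, k}) a b"
  shows "a = i \<and> b = l \<or> adjacent S a b"
proof (cases "adjacent S a b")
  case False
  have a: "a \<in> S" "b \<in> S" "a < b" "a \<noteq> j" "a \<noteq> k" "b \<noteq> j" "b \<noteq> k"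
    using ab by (auto simp: adjacent_def)
  have il: "i < j" "j < k" "k < l" "i \<in> S" "l \<in> S" "i \<in> S - {j,k}" "l \<in> S - {j,k}"
    using assms(1-3) by (auto simp: adjacent_def)
  obtain c where c: "c \<in> S" "a < c" "c < b"
    using False a unfolding adjacent_def by auto
  moreover have "c \<notin> S - {j, k}" using ab c by (auto simp: adjacent_def)
  ultimately have c: "c \<in> S" "a < c" "c < b" "c = j \<or> c = k" by auto
  have "a \<le> k" "a \<noteq> k" using c il by auto
  then have "a \<le> j" using adjacent_le[OF assms(2) a(1)] by auto
  then have "a \<le> i" using adjacent_le[OF assms(1) a(1)] a by auto
  have "b \<ge> k" using adjacent_ge[OF assms(2) a(2)] c il by auto
  then have "b \<ge> l" using adjacent_ge[OF assms(3) a(2)] a by auto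
  have "a \<ge> i" using adjacent_ge[OF ab il(6)] \<open>b \<ge> l\<close> il by force
  moreover have "b \<le> l" using adjacent_le[OF ab il(7)] \<open>a \<le> i\<close> il by force
  ultimately show ?thesis using \<open>a \<le> i\<close> \<open>b \<ge> l\<close> by auto
qed auto

lemma adjacent_around:
  assumes "a \<in> S" "a \<le> g" "b \<in> S" "g < b"
  obtains i j where "adjacent S i j" "i \<le> g" "g < j"
proof -
  let ?i = "Max (S \<inter> {a..g})" and ?j = "Min (S \<inter> {g + 1..b})"
  have i: "?i \<in> S \<inter> {a..g}" using assms by (intro Max_in) auto
  have j: "?j \<in> S \<inter> {g + 1..b}" using assms by (intro Min_in) auto
  have "adjacent S ?i ?j"
  proof -
    have "c \<notin> S" if c: "?i < c" "c < ?j" for c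
    proof
      assume S: "c \<in> S"
      show False
      proof (cases "c \<le> g")
        case True
        then have "c \<in> S \<inter> {a..g}" using S i c by auto
        from Max_ge[OF _ this] c show False by auto
      next
        case False
        then have "c \<in> S \<inter> {g + 1..b}" using S j c by auto
        from Min_le[OF _ this] c show False by auto
      qed
    qed
    then show ?thesis using i j by (auto simp: adjacent_def)
  qed
  with i j that show ?thesis by force
qed

lemma adjacent_next:
  assumes "a \<in> S" "b \<in> S" "a < b"
  obtains j where "adjacent S a j" "j \<le> b"
proof -
  obtain i j where ij: "adjacent S i j" "i \<le> a" "a < j"
    using adjacent_around[of a S a b] assms by auto
  then have "i = a" using adjacent_le[OF ij(1) assms(1)] by auto
  moreover have "j \<le> b" using adjacent_ge[OF ij(1) assms(2)] ij assms by auto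
  ultimately show ?thesis using ij that by auto
qed

lemma adjacent_prev:
  assumes "a \<in> S" "b \<in> S" "a < b"
  obtains i where "adjacent S i b" "a \<le> i"
proof -
  obtain i j where ij: "adjacent S i j" "i \<le> b - 1" "b - 1 < j"
    using adjacent_around[of a S "b - 1" b] assms by auto
  then have "j = b" using adjacent_ge[OF ij(1) assms(2)] by auto
  moreover have "a \<le> i" using adjacent_le[OF ij(1) assms(1)] ij assms by auto
  ultimately show ?thesis using ij that by auto
qed

section \<open>Boundary-points that survive a sequence of recolourings\<close>

locale evolution =
  fixes p :: "int \<Rightarrow> real" and N :: enat and I :: "nat \<Rightarrow> real \<times> real"
  assumes valid: "valid_boundaries p"
    and seq: "recolouring_seq (colouring_of p) N I"
begin

abbreviation col :: "nat \<Rightarrow> colouring" where "col n \<equiv> stage (colouring_of p) I n"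

definition remaining :: "nat \<Rightarrow> int set" where
  "remaining n = {i. p i \<in> boundary_points (col n)}"

lemma p_less: "p i < p j \<longleftrightarrow> i < j"
  using valid unfolding valid_boundaries_def by (metis less_asym linorder_neqE)

lemma p_inj: "p i = p j \<longleftrightarrow> i = j"
  using p_less by (metis less_irrefl linorder_neqE)

lemma p_le: "p i \<le> p j \<longleftrightarrow> i \<le> j"
  using p_less by (metis not_le)

lemma boundary_range: "boundary_points (col n) \<subseteq> range p"
proof (induction n)
  case (Suc n)
  then show ?case by (auto simp: recolour_def split: prod.splits)
qed (auto simp: colouring_of_def)

lemma mono_interval_iff: "mono_interval (col n) (p i, p j) \<longleftrightarrow> adjacent (remaining n) i j"
  using boundary_range[of n] by (fastforce simp: mono_interval_def adjacent_def remaining_def p_less)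

lemma mono_intervalE:
  assumes "mono_interval (col n) (a, b)"
  obtains i j where "a = p i" "b = p j" "adjacent (remaining n) i j"
proof -
  have "a \<in> range p" "b \<in> range p"
    using assms boundary_range[of n] by (auto simp: mono_interval_def)
  then obtain i j where "a = p i" "b = p j" by auto
  with assms that show ?thesis by (auto simp: mono_interval_iff)
qed

lemma recolourable_iff:
  "recolourable (col n) (p j, p k) \<longleftrightarrow> (\<exists>i l. adjacent (remaining n) i j \<and> adjacent (remaining n) j k \<and>
     adjacent (remaining n) k l \<and> p k - p j < p j - p i \<and> p k - p j < p l - p k)"
proof
  assume "recolourable (col n) (p j, p k)"
  then obtain w z where *: "mono_interval (col n) (p j, p k)" "mono_interval (col n) (w, p j)"
    "mono_interval (col n) (p k, z)" "p j - w > p k - p j" "z - p k > p k - p j"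
    by (auto simp: recolourable_def)
  from *(2) obtain i j' where "w = p i" "p j = p j'" "adjacent (remaining n) i j'"
    by (rule mono_intervalE)
  moreover from *(3) obtain k' l where "z = p l" "p k = p k'" "adjacent (remaining n) k' l"
    by (rule mono_intervalE)
  ultimately show "\<exists>i l. adjacent (remaining n) i j \<and> adjacent (remaining n) j k \<and>
     adjacent (remaining n) k l \<and> p k - p j < p j - p i \<and> p k - p j < p l - p k"
    using * by (auto simp: p_inj mono_interval_iff)
next
  assume "\<exists>i l. adjacent (remaining n) i j \<and> adjacent (remaining n) j k \<and>
     adjacent (remaining n) k l \<and> p k - p j < p j - p i \<and> p k - p j < p l - p k"
  then show "recolourable (col n) (p j, p k)"
    unfolding recolourable_def by (auto simp flip: mono_interval_iff)
qed

lemma remaining_0 [simp]: "remaining 0 = UNIV"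
  by (auto simp: remaining_def colouring_of_def)

lemma remaining_step:
  "I n = (p j, p k) \<Longrightarrow> remaining (Suc n) = remaining n - {j, k}"
  by (auto simp: remaining_def recolour_def p_inj)

lemma stepE:
  assumes "enat n < N"
  obtains i j k l where "adjacent (remaining n) i j" "adjacent (remaining n) j k"
    "adjacent (remaining n) k l" "p k - p j < p j - p i" "p k - p j < p l - p k"
    "I n = (p j, p k)" "remaining (Suc n) = remaining n - {j, k}"
proof -
  have r: "recolourable (col n) (I n)" using seq assms by (auto simp: recolouring_seq_def)
  obtain a b where ab: "I n = (a, b)" by (cases "I n")
  with r have "mono_interval (col n) (a, b)" by (auto simp: recolourable_def)
  then obtain j k where "a = p j" "b = p k" by (rule mono_intervalE)
  with r ab have "recolourable (col n) (p j, p k)" "I n = (p j, p k)" by auto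
  with that remaining_step show ?thesis unfolding recolourable_iff by blast
qed

text \<open>Each step deletes two points, so at a finite stage every index still has survivors on
  both sides and lies in some current interval.\<close>

lemma finite_removed: "finite (UNIV - remaining n)"
proof (induction n)
  case (Suc n)
  have "UNIV - remaining (Suc n) \<subseteq> (UNIV - remaining n) \<union> {i. p i = fst (I n)} \<union> {i. p i = snd (I n)}"
    by (auto simp: remaining_def recolour_def split: prod.splits)
  moreover have "finite {i. p i = x}" for x
    by (rule finite_subset[of _ "{THE i. p i = x}"]) (auto simp: p_inj)
  ultimately show ?case using Suc by (auto intro: finite_subset)
qed auto

lemma remaining_below: "\<exists>a\<le>g. a \<in> remaining n"
proof (rule ccontr)
  assume "\<not> ?thesis"
  then have "{..g} \<subseteq> UNIV - remaining n" by auto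
  then show False using finite_removed infinite_Iic finite_subset by metis
qed

lemma remaining_above: "\<exists>b>g. b \<in> remaining n"
proof (rule ccontr)
  assume "\<not> ?thesis"
  then have "{g<..} \<subseteq> UNIV - remaining n" by auto
  then show False using finite_removed infinite_Ioi finite_subset by metis
qed

lemma adjacent_exists:
  obtains i j where "adjacent (remaining n) i j" "i \<le> g" "g < j"
  using remaining_below[of g n] remaining_above[of g n] adjacent_around[of _ "remaining n" g] by metis

lemma colour_initial:
  assumes "p i < x" "x \<le> p (i + 1)"
  shows "colour_at (col 0) x = colour_from i"
proof (cases "even i")
  case True
  then obtain k where "i = 2 * k" by auto
  with colour_at_colouring_of_blue[OF valid, of x k] assms show ?thesis
    by (auto simp: colour_from_def)
next
  case False
  then obtain k where k: "i = 2 * k + 1" by (auto elim: oddE)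
  then have "i = 2 * (k + 1) - 1" "i + 1 = 2 * (k + 1)" by auto
  with assms have "\<exists>j. x \<in> {p (2 * j - 1)<..p (2 * j)}" by (metis greaterThanAtMost_iff)
  then show ?thesis using False by (auto simp: colour_from_def colouring_of_def)
qed

text \<open>Every current interval consists of an odd number of initial ones. Hence the middle of a
  merge has the colour opposite to that of its neighbours and takes their colour when flipped; all
  other intervals lie outside the flipped piece.\<close>

lemma adjacent_invariant:
  assumes "enat n \<le> N" "adjacent (remaining n) i j"
  shows "formable p i j \<and> (\<forall>x. p i < x \<and> x \<le> p j \<longrightarrow> colour_at (col n) x = colour_from i)"
  using assms
proof (induction n arbitrary: i j)
  case 0
  have "j = i + 1"
  proof (rule ccontr)
    assume "j \<noteq> i + 1"
    moreover have "i < j" using 0 by (auto simp: adjacent_def)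
    ultimately have "i + 1 \<in> {i<..<j}" by simp
    moreover have "{i<..<j} = {}" using 0 by (auto simp: adjacent_def)
    ultimately show False by blast
  qed
  then show ?case using formable.single colour_initial by auto
next
  case (Suc n)
  from Suc have n: "enat n < N" "enat n \<le> N" by (auto simp: Suc_ile_eq)
  from stepE[OF n(1)] obtain i' j' k' l' where
    *: "adjacent (remaining n) i' j'" "adjacent (remaining n) j' k'"
    "adjacent (remaining n) k' l'" "p k' - p j' < p j' - p i'" "p k' - p j' < p l' - p k'"
    "I n = (p j', p k')" "remaining (Suc n) = remaining n - {j', k'}" by metis
  note IH = Suc.IH[OF n(2)]
  have lt: "i' < j'" "j' < k'" "k' < l'" using * by (auto simp: adjacent_def)
  from adjacent_remove[OF *(1-3)] Suc.prems(2) *(7)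
  consider "i = i'" "j = l'" | "adjacent (remaining n) i j" by auto
  then show ?case
  proof cases
    case 1
    have odd: "odd (k' - j')" "odd (j' - i')" using IH *(1,2) formable_odd by blast+
    have f: "formable p i j"
      unfolding 1 by (rule formable.merge[of _ _ j' k']) (use IH * lt odd in auto)
    have c: "colour_from j' = opposite (colour_from i')" "colour_from k' = colour_from i'"
      using odd colour_from_odd colour_from_even[of k' i'] by auto
    have "colour_at (col (Suc n)) x = colour_from i" if x: "p i < x" "x \<le> p j" for x
    proof -
      consider "x \<le> p j'" | "p j' < x" "x \<le> p k'" | "p k' < x" by linarith
      then show ?thesis
      proof cases
        case a: 1
        then show ?thesis using IH[OF *(1)] x 1 *(6) by (auto simp: recolour_def)
      next
        case 2
        then show ?thesis using IH[OF *(2)] x 1 *(6) c by (auto simp: recolour_def)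
      next
        case 3
        then show ?thesis using IH[OF *(3)] x 1 *(6) c by (auto simp: recolour_def)
      qed
    qed
    with f show ?thesis by auto
  next
    case 2
    have ij: "i \<notin> {j', k'}" "j \<notin> {j', k'}"
      using Suc.prems(2) *(7) by (auto simp: adjacent_def)
    have "j \<le> j' \<or> k' \<le> i"
    proof (rule ccontr)
      assume "\<not> ?thesis"
      moreover have "i \<in> remaining n" "j' \<in> remaining n" using 2 * by (auto simp: adjacent_def)
      ultimately have "i < j'" "j' < j"
        using adjacent_le[OF *(2), of i] ij by auto
      then show False using 2 \<open>j' \<in> remaining n\<close> by (auto simp: adjacent_def)
    qed
    then have "p j \<le> p j' \<or> p k' \<le> p i" by (simp add: p_le)
    then show ?thesis using IH[OF 2] *(6) by (auto simp: recolour_def)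
  qed
qed

lemmas adjacent_formable = adjacent_invariant[THEN conjunct1]

lemma adjacent_colour:
  "\<lbrakk>enat n \<le> N; adjacent (remaining n) i j; p i < x; x \<le> p j\<rbrakk> \<Longrightarrow> colour_at (col n) x = colour_from i"
  using adjacent_invariant by blast

lemma adjacent_odd: "enat n \<le> N \<Longrightarrow> adjacent (remaining n) i j \<Longrightarrow> odd (j - i)"
  using adjacent_formable formable_odd by blast

lemma remaining_antimono: "m \<le> n \<Longrightarrow> remaining n \<subseteq> remaining m"
  by (rule lift_Suc_antimono_le[of remaining]) (auto simp: remaining_def recolour_def split: prod.splits)

end

section \<open>Seeds: cores and one-sided safety\<close>

definition core :: "(int \<Rightarrow> real) \<Rightarrow> colour \<Rightarrow> int \<Rightarrow> int \<Rightarrow> bool" where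
  "core p c s e \<longleftrightarrow> s < e \<and> colour_from s = c \<and> colour_from e = opposite c \<and>
     (\<forall>l. s < l \<and> l + 1 < e \<and> colour_from l = opposite c \<longrightarrow>
        p (l + 1) - p l < p l - p (l - 1) \<and> p (l + 1) - p l < p (l + 2) - p (l + 1))"

text \<open>The permitted length grows with the distance to the core. If the winning interval around
  the core extends to the boundary \<open>k\<close>, its length is at least
  \<open>p k - p s\<close>, so it is the longer of the two and cannot be recoloured there.\<close>

definition right_safe :: "(int \<Rightarrow> real) \<Rightarrow> colour \<Rightarrow> int \<Rightarrow> int \<Rightarrow> bool" where
  "right_safe p c s e \<longleftrightarrow> (\<forall>k l. e \<le> k \<and> colour_from k = opposite c \<and> formable p k l \<longrightarrow>
     p l - p k < p k - p s)"

definition left_safe :: "(int \<Rightarrow> real) \<Rightarrow> colour \<Rightarrow> int \<Rightarrow> int \<Rightarrow> bool" where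
  "left_safe p c s e \<longleftrightarrow> (\<forall>i k. k \<le> s \<and> colour_from i = opposite c \<and> formable p i k \<longrightarrow>
     p k - p i < p e - p k)"

context evolution
begin

text \<open>
  A core interval of the losing colour is shorter than anything that can ever touch it, so its two
  end points can only disappear together, by its own recolouring.  Afterwards the whole core lies in
  one interval, which is longer than its neighbour on the safe side.
\<close>

lemma core_invariant:
  assumes core: "core p c s e" and safe: "right_safe p c s e \<or> left_safe p c s e"
    and "enat n \<le> N"
  shows "(\<forall>l. s < l \<and> l + 1 < e \<and> colour_from l = opposite c \<longrightarrow>
            (l \<in> remaining n \<longleftrightarrow> l + 1 \<in> remaining n)) \<and>
         (\<forall>i j. adjacent (remaining n) i j \<and> i \<le> s \<and> e \<le> j \<longrightarrow> colour_from i = c)"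
  using assms(3)
proof (induction n)
  case 0
  have "colour_from i = c" if "adjacent UNIV i j" "i \<le> s" "e \<le> j" for i j
  proof -
    have "{i<..<j} = {}" using that by (auto simp: adjacent_def)
    then have "i + 1 \<notin> {i<..<j}" by blast
    then have "j \<le> i + 1" by auto
    then have "i = s" "j = e" using that core by (auto simp: core_def)
    then show ?thesis using core by (auto simp: core_def)
  qed
  then show ?case by auto
next
  case (Suc n)
  from Suc have n: "enat n < N" "enat n \<le> N" by (auto simp: Suc_ile_eq)
  from stepE[OF n(1)] obtain i j k l where
    *: "adjacent (remaining n) i j" "adjacent (remaining n) j k"
    "adjacent (remaining n) k l" "p k - p j < p j - p i" "p k - p j < p l - p k"
    "I n = (p j, p k)" "remaining (Suc n) = remaining n - {j, k}" by metis
  have pair: "a \<in> remaining n \<longleftrightarrow> a + 1 \<in> remaining n"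
    if "s < a" "a + 1 < e" "colour_from a = opposite c" for a using that Suc n by auto
  have cover: "colour_from a = c" if "adjacent (remaining n) a b" "a \<le> s" "e \<le> b" for a b
    using that Suc n by auto
  have lt: "i < j" "j < k" "k < l" using * by (auto simp: adjacent_def)
  have mem: "i \<in> remaining n" "j \<in> remaining n" "k \<in> remaining n" "l \<in> remaining n"
    using * by (auto simp: adjacent_def)
  have odd: "odd (j - i)" "odd (k - j)" "odd (l - k)" using adjacent_odd n * by auto
  have small: "p (a + 1) - p a < p a - p (a - 1)" "p (a + 1) - p a < p (a + 2) - p (a + 1)"
    if "s < a" "a + 1 < e" "colour_from a = opposite c" for a
    using core that by (auto simp: core_def)
  have ends: "colour_from s = c" "colour_from e = opposite c" "s < e"
    using core by (auto simp: core_def)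
  have colse: "colour_from (a + 1) = opposite (colour_from a)" "colour_from (a - 1) = opposite (colour_from a)" for a
    using colour_from_odd[of "a + 1" a] colour_from_odd[of "a - 1" a] by auto
  \<comment> \<open>Within the core only the core's own losing intervals can be recoloured. If
    \<open>j\<close> were the right end of such an interval, this interval would be the left
    neighbour, although it is shorter than the winning interval that follows it.\<close>
  have j_inside: "k = j + 1 \<and> colour_from j = opposite c" if "s < j" "j < e"
  proof -
    consider "colour_from j = opposite c" | "colour_from j = c" using neq_opposite by blast
    then show ?thesis
    proof cases
      case 1
      then have "j + 1 \<noteq> e" using colse(1)[of j] ends by (metis opposite_neq(1))
      then have "j + 1 \<in> remaining n" using pair[of j] 1 that mem by auto
      then have "k \<le> j + 1" using adjacent_ge[OF *(2)] by auto
      with 1 lt show ?thesis by auto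
    next
      case 2
      then have c: "colour_from (j - 1) = opposite c" using colse(2)[of j] by auto
      then have "j - 1 \<noteq> s" using ends by auto
      then have "s < j - 1" "j - 1 + 1 < e" using that by auto
      note a = this c
      have "j - 1 \<in> remaining n" using pair[OF a] mem by auto
      then have "i = j - 1" using adjacent_le[OF *(1)] lt by force
      moreover have "p (j + 1) \<le> p k" using lt by (simp add: p_le)
      ultimately have False using small(2)[OF a] *(4) by (auto simp: add.commute)
      then show ?thesis ..
    qed
  qed
  have k_inside: "k = j + 1 \<and> colour_from j = opposite c" if "s < k" "k < e"
  proof -
    consider "colour_from k = opposite c" | "colour_from k = c" using neq_opposite by blast
    then show ?thesis
    proof cases
      case 1
      then have "k + 1 \<noteq> e" using colse(1)[of k] ends by (metis opposite_neq(1))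
      then have a: "s < k" "k + 1 < e" using that by auto
      have "k + 1 \<in> remaining n" using pair[OF a 1] mem by auto
      then have "l = k + 1" using adjacent_ge[OF *(3)] lt by force
      moreover have "p j \<le> p (k - 1)" using lt by (simp add: p_le)
      ultimately have False using small(1)[OF a 1] *(5) by (auto simp: add.commute)
      then show ?thesis ..
    next
      case 2
      then have c: "colour_from (k - 1) = opposite c" using colse(2)[of k] by auto
      then have "k - 1 \<noteq> s" using ends by auto
      then have "s < k - 1" "k - 1 + 1 < e" using that by auto
      note a = this c
      have "k - 1 \<in> remaining n" using pair[OF a] mem by auto
      then have "j = k - 1" using adjacent_le[OF *(2)] lt by force
      then show ?thesis using c by auto
    qed
  qed
  \<comment> \<open>An interval that covers the core is winning and at least as long as the stretch
    measured by safety; its neighbour on the safe side is formable and losing, hence shorter, which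
    forbids the recolouring.\<close>
  have not_core: "\<not> (j \<le> s \<and> e \<le> k)"
  proof
    assume jk: "j \<le> s \<and> e \<le> k"
    then have cj: "colour_from j = c" using cover[OF *(2)] by auto
    have ck: "colour_from k = opposite c" using cj colour_from_odd[OF odd(2)] by auto
    have ci: "colour_from i = opposite c" using cj colour_from_odd[OF odd(1)] by auto
    have "p j \<le> p s" "p e \<le> p k" using jk by (auto simp: p_le)
    from safe show False
    proof
      assume "right_safe p c s e"
      then have "p l - p k < p k - p s"
        using jk ck adjacent_formable[OF n(2) *(3)] by (auto simp: right_safe_def)
      then show False using *(5) \<open>p j \<le> p s\<close> by linarith
    next
      assume "left_safe p c s e"
      then have "p j - p i < p e - p j"
        using jk ci adjacent_formable[OF n(2) *(1)] by (auto simp: left_safe_def)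
      then show False using *(4) \<open>p e \<le> p k\<close> by linarith
    qed
  qed
  have 1: "a \<in> remaining (Suc n) \<longleftrightarrow> a + 1 \<in> remaining (Suc n)"
    if a: "s < a" "a + 1 < e" "colour_from a = opposite c" for a
  proof -
    have "a = j \<longleftrightarrow> a + 1 = k"
      using j_inside k_inside a by auto
    moreover have "a \<noteq> k"
      using k_inside a colse(1)[of j] by auto
    moreover have "a + 1 \<noteq> j"
      using j_inside a colse(1)[of a] by auto
    ultimately show ?thesis using pair[OF a] *(7) by auto
  qed
  have 2: "colour_from a = c" if ab: "adjacent (remaining (Suc n)) a b" "a \<le> s" "e \<le> b" for a b
  proof -
    from adjacent_remove[OF *(1-3)] ab(1) *(7)
    consider "a = i" "b = l" | "adjacent (remaining n) a b" by auto
    then show ?thesis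
    proof cases
      case 1
      have ij: "colour_from j = opposite (colour_from i)" "colour_from k = colour_from i"
        using colour_from_odd[OF odd(1)] colour_from_even[of k i] odd by auto
      consider "e \<le> j" | "s < j" "j < e" | "s < k" "k < e" | "k \<le> s" | "j \<le> s" "e \<le> k" by linarith
      then show ?thesis
      proof cases
        case a: 1
        then show ?thesis using cover[OF *(1)] 1 ab by auto
      next
        case 2
        then show ?thesis using j_inside ij 1 by (metis opposite_opposite)
      next
        case 3
        then show ?thesis using k_inside ij 1 by (metis opposite_opposite)
      next
        case 4
        then show ?thesis using cover[OF *(3)] 1 ab ij by auto
      next
        case 5
        then show ?thesis using not_core by auto
      qed
    next
      case 2
      then show ?thesis using cover ab by auto
    qed
  qed
  show ?case using 1 2 by blast
qed

end

section \<open>Complete sequences: nothing survives between two seeds\<close>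

locale complete_evolution = evolution +
  assumes complete: "complete_seq (colouring_of p) N I"
begin

lemma eventually_recoloured:
  assumes "enat n \<le> N" "recolourable (col n) (p j, p k)"
  obtains m where "n \<le> m" "enat m < N" "j \<notin> remaining (Suc m)" "k \<notin> remaining (Suc m)"
proof -
  obtain m where m: "n \<le> m" "enat m < N" "I m = (p j, p k)"
    using complete assms unfolding complete_seq_def by blast
  from remaining_step[OF m(3)] m that show ?thesis by auto
qed

text \<open>The losing intervals of a core are recolourable at the start, so completeness removes
  each of them at some time. They are finitely many, and their two end points disappear together, so
  a single stage serves for all.\<close>

lemma core_merged:
  assumes core: "core p c s e" and safe: "right_safe p c s e \<or> left_safe p c s e"
  obtains k where "enat k \<le> N"
    "\<And>n. k \<le> n \<Longrightarrow> enat n \<le> N \<Longrightarrow> remaining n \<inter> {s<..<e} = {}"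
proof -
  let ?L = "{l. s < l \<and> l + 1 < e \<and> colour_from l = opposite c}"
  have ex: "\<exists>k. enat k \<le> N \<and> l \<notin> remaining k" if l: "l \<in> ?L" for l
  proof -
    have "recolourable (col 0) (p l, p (l + 1))"
      unfolding recolourable_iff
      using core l by (intro exI[of _ "l - 1"] exI[of _ "l + 2"])
        (auto simp: core_def adjacent_def)
    then obtain m where "enat m < N" "l \<notin> remaining (Suc m)"
      using eventually_recoloured[of 0 l "l + 1"] by (auto simp: zero_enat_def[symmetric])
    then show ?thesis by (intro exI[of _ "Suc m"]) (auto simp: Suc_ile_eq)
  qed
  then obtain K where K: "\<And>l. l \<in> ?L \<Longrightarrow> enat (K l) \<le> N \<and> l \<notin> remaining (K l)" by metis
  have fin: "finite ?L" by (rule finite_subset[of _ "{s<..<e}"]) auto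
  let ?k = "Max (insert 0 (K ` ?L))"
  have kN: "enat ?k \<le> N"
    using Max_in[of "insert 0 (K ` ?L)"] fin K by (auto simp: zero_enat_def[symmetric])
  moreover have "remaining n \<inter> {s<..<e} = {}" if n: "?k \<le> n" "enat n \<le> N" for n
  proof -
    have out: "l \<notin> remaining n" if "l \<in> ?L" for l
    proof -
      have "K l \<le> ?k" using fin that by (intro Max_ge) auto
      then have "remaining n \<subseteq> remaining (K l)" using n by (intro remaining_antimono) auto
      with K[OF that] show ?thesis by auto
    qed
    have ends: "colour_from s = c" "colour_from e = opposite c"
      using core by (auto simp: core_def)
    have "a \<notin> remaining n" if a: "s < a" "a < e" for a
    proof -
      have colse: "colour_from (a + 1) = opposite (colour_from a)"
        "colour_from (a - 1) = opposite (colour_from a)"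
        using colour_from_odd[of "a + 1" a] colour_from_odd[of "a - 1" a] by auto
      consider "colour_from a = opposite c" | "colour_from a = c" using neq_opposite by blast
      then show ?thesis
      proof cases
        case 1
        then have "a + 1 \<noteq> e" using ends colse by (metis opposite_neq(1))
        then show ?thesis using a 1 out by auto
      next
        case 2
        then have "a - 1 \<noteq> s" using ends colse by auto
        then have *: "a - 1 \<in> ?L" using a 2 colse by auto
        then have "a - 1 \<in> remaining n \<longleftrightarrow> a - 1 + 1 \<in> remaining n"
          using core_invariant[OF core safe n(2)] by blast
        then show ?thesis using out[OF *] by simp
      qed
    qed
    then show ?thesis by auto
  qed
  ultimately show ?thesis using that by blast
qed

lemma finally_between:
  assumes left: "core p c s e" "right_safe p c s e"
    and right: "core p c s' e'" "left_safe p c s' e'"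
    and ee: "e \<le> s'"
    and no_ties: "\<And>i j k. i < j \<Longrightarrow> j < k \<Longrightarrow> odd (j - i) \<Longrightarrow> odd (k - j) \<Longrightarrow> p j - p i \<noteq> p k - p j"
  obtains k where "enat k \<le> N"
    "\<And>n x. k \<le> n \<Longrightarrow> enat n \<le> N \<Longrightarrow> p e \<le> x \<Longrightarrow> x \<le> p s' \<Longrightarrow> colour_at (col n) x = c"
proof -
  obtain k1 where k1: "enat k1 \<le> N"
    "\<And>n. k1 \<le> n \<Longrightarrow> enat n \<le> N \<Longrightarrow> remaining n \<inter> {s<..<e} = {}"
    using core_merged left by blast
  obtain k2 where k2: "enat k2 \<le> N"
    "\<And>n. k2 \<le> n \<Longrightarrow> enat n \<le> N \<Longrightarrow> remaining n \<inter> {s'<..<e'} = {}"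
    using core_merged right by blast
  have se: "s < e" "s' < e'" using left right by (auto simp: core_def)
  let ?P = "\<lambda>n. max k1 k2 \<le> n \<and> enat n \<le> N"
  let ?f = "\<lambda>n. card (remaining n \<inter> {e..s'})"
  \<comment> \<open>Among the stages at which both cores have merged, one with the fewest
    boundary-points left between the seeds. Such a minimum exists for finite and for infinite
    \<open>N\<close>.\<close>
  define k where "k = (ARG_MIN ?f n. ?P n)"
  have "?P (max k1 k2)" using k1 k2 by (auto simp: max_def)
  then have k: "?P k" and kmin: "\<And>n. ?P n \<Longrightarrow> ?f k \<le> ?f n"
    unfolding k_def using arg_min_natI[of ?P] arg_min_nat_le[of ?P _ ?f] by blast+
  have cover: "\<exists>i j i' j'. adjacent (remaining n) i j \<and> i \<le> s \<and> e \<le> j \<and> colour_from i = c \<and>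
      adjacent (remaining n) i' j' \<and> i' \<le> s' \<and> e' \<le> j' \<and> colour_from i' = c"
    if n: "?P n" for n
  proof -
    obtain i j where ij: "adjacent (remaining n) i j" "i \<le> s" "s < j" by (rule adjacent_exists)
    have "e \<le> j" using k1(2)[of n] n ij by (force simp: adjacent_def)
    obtain i' j' where ij': "adjacent (remaining n) i' j'" "i' \<le> s'" "s' < j'" by (rule adjacent_exists)
    have "e' \<le> j'" using k2(2)[of n] n ij' by (force simp: adjacent_def)
    with \<open>e \<le> j\<close> ij ij' show ?thesis
      using core_invariant[OF left(1) disjI1[OF left(2)]] core_invariant[OF right(1) disjI2[OF right(2)]] n
      by blast
  qed
  have empty: "remaining k \<inter> {e..s'} = {}"
  proof (rule ccontr)
    assume ne: "\<not> ?thesis"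
    obtain i1 j1 i2 j2 where
      1: "adjacent (remaining k) i1 j1" "i1 \<le> s" "e \<le> j1" "colour_from i1 = c" and
      2: "adjacent (remaining k) i2 j2" "i2 \<le> s'" "e' \<le> j2" "colour_from i2 = c"
      using cover k by blast
    from ne obtain a where a: "a \<in> remaining k" "e \<le> a" "a \<le> s'" by auto
    have mem: "j1 \<in> remaining k" "i2 \<in> remaining k" "i1 < j1" "i2 < j2"
      "i1 \<in> remaining k" "j2 \<in> remaining k"
      using 1 2 by (auto simp: adjacent_def)
    have "j1 \<le> a" "a \<le> i2" using adjacent_ge[OF 1(1) a(1)] adjacent_le[OF 2(1) a(1)] a 1 2 se by auto
    have kN: "enat k \<le> N" using k by auto
    have cj: "colour_from j1 = opposite c"
      using colour_from_odd[OF adjacent_odd[OF kN 1(1)]] 1 by simp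
    then have "j1 \<noteq> i2" using 2 by auto
    then have "j1 < i2" using \<open>j1 \<le> a\<close> \<open>a \<le> i2\<close> by auto
    let ?D = "{(m, m'). adjacent (remaining k) m m' \<and> j1 \<le> m \<and> m' \<le> i2}"
    have "finite ?D" by (rule finite_subset[of _ "{j1..i2} \<times> {j1..i2}"]) (auto simp: adjacent_def)
    moreover obtain m where "adjacent (remaining k) j1 m" "m \<le> i2"
      using adjacent_next mem \<open>j1 < i2\<close> by metis
    then have "?D \<noteq> {}" by auto
    ultimately have "\<exists>d\<in>?D. \<forall>d'\<in>?D. p (snd d) - p (fst d) \<le> p (snd d') - p (fst d')"
      using arg_min_if_finite[of ?D "\<lambda>d. p (snd d) - p (fst d)"] by (metis (no_types, lifting) leI)
    then obtain m m' where mm: "adjacent (remaining k) m m'" "j1 \<le> m" "m' \<le> i2"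
      and least: "\<And>d d'. adjacent (remaining k) d d' \<Longrightarrow> j1 \<le> d \<Longrightarrow> d' \<le> i2 \<Longrightarrow> p m' - p m \<le> p d' - p d"
      by auto
    have mmem: "m \<in> remaining k" "m' \<in> remaining k" "m < m'" using mm by (auto simp: adjacent_def)
    obtain w where w: "adjacent (remaining k) w m" "i1 \<le> w"
      using adjacent_prev[OF mem(5) mmem(1)] mm mem by auto
    obtain z where z: "adjacent (remaining k) m' z" "z \<le> j2"
      using adjacent_next[OF mmem(2) mem(6)] mm mem by auto
    note odd = adjacent_odd[OF kN w(1)] adjacent_odd[OF kN mm(1)] adjacent_odd[OF kN z(1)]
    have lt: "w < m" "m' < z" using w z by (auto simp: adjacent_def)
    \<comment> \<open>A neighbour between the seeds is strictly longer by minimality and the absence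
      of ties. At the first boundary the neighbour is the winning interval around the left seed,
      which safety makes longer; the other side is symmetric.\<close>
    have "p m' - p m < p m - p w"
    proof (cases "m = j1")
      case True
      then have "w = i1" using adjacent_unique_left w 1 by blast
      have "p m' - p m < p m - p s"
        using left(2) cj 1 True adjacent_formable[OF kN mm(1)] by (auto simp: right_safe_def)
      moreover have "p i1 \<le> p s" using 1 by (simp add: p_le)
      ultimately show ?thesis unfolding \<open>w = i1\<close> by linarith
    next
      case False
      then have "j1 \<le> w" using adjacent_le[OF w(1) mem(1)] mm by auto
      then have "p m' - p m \<le> p m - p w" using least[OF w(1)] mm mmem by auto
      with no_ties[OF lt(1) mmem(3) odd(1,2)] show ?thesis by linarith
    qed
    moreover have "p m' - p m < p z - p m'"
    proof (cases "m' = i2")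
      case True
      then have "z = j2" using adjacent_unique_right z 2 by blast
      have "colour_from m = opposite c"
        using colour_from_odd[OF adjacent_odd[OF kN mm(1)]] True 2 by (metis opposite_opposite)
      then have "p m' - p m < p e' - p m'"
        using right(2) 2 True adjacent_formable[OF kN mm(1)] by (auto simp: left_safe_def)
      moreover have "p e' \<le> p j2" using 2 by (simp add: p_le)
      ultimately show ?thesis unfolding \<open>z = j2\<close> by linarith
    next
      case False
      then have "z \<le> i2" using adjacent_ge[OF z(1) mem(2)] mm by auto
      then have "p m' - p m \<le> p z - p m'" using least[OF z(1)] mm mmem by auto
      with no_ties[OF mmem(3) lt(2) odd(2,3)] show ?thesis by linarith
    qed
    ultimately have "recolourable (col k) (p m, p m')"
      using w z mm by (auto simp: recolourable_iff)
    then obtain n where n: "k \<le> n" "enat n < N" "m \<notin> remaining (Suc n)"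
      using eventually_recoloured kN by metis
    have "remaining (Suc n) \<inter> {e..s'} \<subset> remaining k \<inter> {e..s'}"
      using n(1,3) mmem mm 1 2 remaining_antimono[of k "Suc n"] by auto
    then have "?f (Suc n) < ?f k" by (intro psubset_card_mono) auto
    moreover have "?P (Suc n)" using n k by (auto simp: Suc_ile_eq)
    ultimately show False using kmin by force
  qed
  have "colour_at (col n) x = c" if n: "k \<le> n" "enat n \<le> N" and x: "p e \<le> x" "x \<le> p s'" for n x
  proof -
    have Pn: "?P n" using n k by auto
    obtain i j where ij: "adjacent (remaining n) i j" "i \<le> s" "e \<le> j" "colour_from i = c"
      using cover Pn by blast
    have "remaining n \<inter> {e..s'} = {}" using remaining_antimono[OF n(1)] empty by auto
    then have "s' < j" using ij by (force simp: adjacent_def)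
    then have "p s' < p j" "p i < p e" using ij se by (auto simp: p_less)
    then show ?thesis using adjacent_colour[OF n(2) ij(1), of x] x ij by auto
  qed
  with k that show ?thesis by blast
qed

end

lemma colour_wins_if_seeds:
  assumes valid: "valid_boundaries (boundaries r b)"
    and no_ties: "\<And>i j k. i < j \<Longrightarrow> j < k \<Longrightarrow> odd (j - i) \<Longrightarrow> odd (k - j) \<Longrightarrow> boundaries r b j - boundaries r b i \<noteq> boundaries r b k - boundaries r b j"
    and right: "\<And>m. \<exists>s e. e \<le> m \<and> core (boundaries r b) c s e \<and> right_safe (boundaries r b) c s e"
    and left: "\<And>m. \<exists>s e. m \<le> s \<and> core (boundaries r b) c s e \<and> left_safe (boundaries r b) c s e"
  shows "colour_wins c r b"
  unfolding colour_wins_def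
proof (intro conjI valid allI impI)
  let ?p = "boundaries r b"
  fix N I assume complete: "complete_seq (colouring_of ?p) N I"
  then interpret complete_evolution ?p N I
    by unfold_locales (auto simp: valid complete_seq_def)
  show "finally_everywhere c (colouring_of ?p) N I"
    unfolding finally_everywhere_def
  proof
    fix x
    obtain i where i: "x \<in> {?p i<..?p (i + 1)}"
      using valid unfolding valid_boundaries_def by blast
    obtain s e where 1: "e \<le> i" "core ?p c s e" "right_safe ?p c s e" using right by blast
    obtain s' e' where 2: "i + 1 \<le> s'" "core ?p c s' e'" "left_safe ?p c s' e'" using left by blast
    have "e \<le> s'" using 1(1) 2(1) by auto
    from finally_between[OF 1(2,3) 2(2,3) this no_ties]
    obtain k where k: "enat k \<le> N"
      "\<And>n y. k \<le> n \<Longrightarrow> enat n \<le> N \<Longrightarrow> ?p e \<le> y \<Longrightarrow> y \<le> ?p s' \<Longrightarrow> colour_at (col n) y = c"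
      by blast
    have x: "?p e \<le> x" "x \<le> ?p s'"
      using i 1(1) 2(1) p_le[of e i] p_le[of "i + 1" s'] by auto
    have fin: "colour_at (col n) x = c" if "k \<le> n" "enat n \<le> N" for n
      using k(2)[OF that x] .
    have "{n. enat n < N \<and> colour_at (col (Suc n)) x \<noteq> colour_at (col n) x} \<subseteq> {..<k}"
    proof
      fix n assume n: "n \<in> {n. enat n < N \<and> colour_at (col (Suc n)) x \<noteq> colour_at (col n) x}"
      then have "enat n \<le> N" "enat (Suc n) \<le> N" by (auto simp: Suc_ile_eq)
      with n fin[of n] fin[of "Suc n"] show "n \<in> {..<k}" by (cases "k \<le> n") auto
    qed
    then have "finite {n. enat n < N \<and> colour_at (col (Suc n)) x \<noteq> colour_at (col n) x}"
      by (rule finite_subset) auto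
    with k(1) fin show "finite {n. enat n < N \<and> colour_at (col (Suc n)) x \<noteq> colour_at (col n) x} \<and>
       (\<exists>k. enat k \<le> N \<and> (\<forall>n\<ge>k. enat n \<le> N \<longrightarrow> colour_at (col n) x = c))"
      by blast
  qed
qed

section \<open>Losing intervals as trees of blue lengths\<close>

text \<open>Each blue letter is counted with one red unit, which makes the length additive under
  concatenation; the one red interval too many or too few is left to \<open>sgn_of\<close>.\<close>

definition wt :: "(nat \<Rightarrow> real) \<Rightarrow> nat \<Rightarrow> nat \<Rightarrow> real" where
  "wt x u v = (\<Sum>l=u..<v. 1 + x l)"

lemma wt_self [simp]: "wt x u u = 0"
  by (simp add: wt_def)

lemma wt_add: "u \<le> v \<Longrightarrow> v \<le> w \<Longrightarrow> wt x u w = wt x u v + wt x v w"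
  unfolding wt_def by (simp add: sum.atLeastLessThan_concat)

lemma wt_Suc: "u \<le> v \<Longrightarrow> wt x u (Suc v) = wt x u v + 1 + x v"
  unfolding wt_def by simp

lemma wt_ge: "(\<And>l. u \<le> l \<Longrightarrow> l < v \<Longrightarrow> 0 \<le> x l) \<Longrightarrow> real (v - u) \<le> wt x u v"
proof -
  assume "\<And>l. u \<le> l \<Longrightarrow> l < v \<Longrightarrow> 0 \<le> x l"
  then have "(\<Sum>l=u..<v. 1) \<le> wt x u v" unfolding wt_def by (intro sum_mono) auto
  then show ?thesis by simp
qed

lemma wt_cong: "(\<And>l. u \<le> l \<Longrightarrow> l < v \<Longrightarrow> x l = y l) \<Longrightarrow> wt x u v = wt y u v"
  unfolding wt_def by (intro sum.cong) auto

lemma wt_shift: "wt (\<lambda>n. x (a + n)) u v = wt x (a + u) (a + v)"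
  unfolding wt_def using sum.shift_bounds_nat_ivl[of "\<lambda>l. 1 + x l" u a v] by (simp add: add.commute)

text \<open>
  With \<open>c\<close> the winning colour, intervals are encoded by words in the blue lengths: the word of
  the letters \<open>u, \<dots>, v - 1\<close> stands for the losing interval of length \<open>sgn_of c + wt x u v\<close> made
  of these blue intervals and the red ones alternating with them, and for the winning interval of
  length \<open>wt x u v - sgn_of c\<close>.
\<close>

definition sgn_of :: "colour \<Rightarrow> real" where
  "sgn_of c = (if c = Blue then 1 else - 1)"

text \<open>Converts letters to boundary indices: if letter 0 starts at boundary
  \<open>2 * a\<close>, the losing word from \<open>u\<close> to \<open>v\<close> runs from boundary
  \<open>2 * (a + u) - 1 + offset c\<close> to \<open>2 * (a + v) - offset c\<close>.\<close>

definition offset :: "colour \<Rightarrow> int" where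
  "offset c = (if c = Blue then 0 else 1)"

text \<open>The letters around a gap put joins in a normal form: neither side can be prolonged into
  the gap by a letter of \<open>A\<close>. This leaves fewer trees to count and forces a gap to
  begin with a letter outside \<open>A\<close>, which lowers the expected number of gaps.\<close>

inductive tree :: "colour \<Rightarrow> real set \<Rightarrow> (nat \<Rightarrow> real) \<Rightarrow> nat \<Rightarrow> nat \<Rightarrow> bool" for c A x where
  run: "u \<le> v \<Longrightarrow> x ` {u..<v} \<subseteq> A \<Longrightarrow> tree c A x u v"
| join: "\<lbrakk>tree c A x u v; v < w; x v \<notin> A; x (w - 1) \<notin> A; tree c A x w z;
    wt x v w - sgn_of c < sgn_of c + wt x u v; wt x v w - sgn_of c < sgn_of c + wt x w z\<rbrakk>
    \<Longrightarrow> tree c A x u z"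

text \<open>Trees of bounded join depth, given by recursion so that measurability and the moment
  recursion go by induction on \<open>d\<close>. Runs of fewer than \<open>k\<close> letters are
  dropped since they can never be a side of a join. Nonnegative gap letters are demanded because
  branches are evaluated on arbitrary streams.\<close>

primrec branch :: "colour \<Rightarrow> real set \<Rightarrow> nat \<Rightarrow> nat \<Rightarrow> (nat \<Rightarrow> real) \<Rightarrow> nat \<Rightarrow> nat \<Rightarrow> bool" where
  "branch c A k 0 x u v \<longleftrightarrow> u + k \<le> v \<and> x ` {u..<v} \<subseteq> A"
| "branch c A k (Suc d) x u v \<longleftrightarrow> (u + k \<le> v \<and> x ` {u..<v} \<subseteq> A) \<or>
     (\<exists>s w. u \<le> s \<and> s < w \<and> w \<le> v \<and> branch c A k d x u s \<and> branch c A k d x w v \<and>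
        x s \<notin> A \<and> x (w - 1) \<notin> A \<and> x ` {s..<w} \<subseteq> {0..} \<and>
        wt x s w - sgn_of c < sgn_of c + wt x u s \<and> wt x s w - sgn_of c < sgn_of c + wt x w v)"

lemma branch_Suc: "branch c A k d x u v \<Longrightarrow> branch c A k (Suc d) x u v"
proof (induction d arbitrary: u v)
  case (Suc d)
  show ?case
  proof (cases "branch c A k 0 x u v")
    case False
    with Suc.prems obtain s w where "u \<le> s" "s < w" "w \<le> v"
      "branch c A k d x u s" "branch c A k d x w v" and
      rest: "x s \<notin> A \<and> x (w - 1) \<notin> A \<and> x ` {s..<w} \<subseteq> {0..} \<and>
        wt x s w - sgn_of c < sgn_of c + wt x u s \<and> wt x s w - sgn_of c < sgn_of c + wt x w v"
      by auto
    with Suc.IH have "u \<le> s \<and> s < w \<and> w \<le> v \<and> branch c A k (Suc d) x u s \<and> branch c A k (Suc d) x w v"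
      by blast
    with rest show ?thesis unfolding branch.simps(2)[of c A k "Suc d"] by blast
  qed simp
qed simp

lemma branch_mono: "d \<le> d' \<Longrightarrow> branch c A k d x u v \<Longrightarrow> branch c A k d' x u v"
  by (induction d' rule: dec_induct) (auto intro: branch_Suc simp del: branch.simps)

lemma branch_le: "branch c A k d x u v \<Longrightarrow> u \<le> v"
  by (cases d) auto

lemma tree_le: "tree c A x u v \<Longrightarrow> u \<le> v"
  by (induction rule: tree.induct) auto

lemma boundary_position:
  assumes red: "\<And>i. p (2 * i) - p (2 * i - 1) = 1"
    and blue: "\<And>n::nat. p (2 * (a + int n) + 1) - p (2 * (a + int n)) = x n"
  shows "p (2 * (a + int n)) = p (2 * a) + wt x 0 n"
    and "p (2 * (a + int n) - 1) = p (2 * a) + wt x 0 n - 1"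
proof -
  show "p (2 * (a + int n)) = p (2 * a) + wt x 0 n"
  proof (induction n)
    case (Suc n)
    have "p (2 * (a + int (Suc n))) = p (2 * (a + int n) + 1) + 1"
      using red[of "a + int (Suc n)"] by (simp add: algebra_simps)
    then show ?case using Suc blue[of n] by (simp add: wt_Suc)
  qed simp
  then show "p (2 * (a + int n) - 1) = p (2 * a) + wt x 0 n - 1"
    using red[of "a + int n"] by simp
qed

section \<open>Domination of formable losing intervals by maximal trees\<close>

locale letters =
  fixes c :: colour and A :: "real set" and k :: nat and x :: "nat \<Rightarrow> real"
  assumes nonneg: "0 \<le> x l"
    and out: "\<exists>m\<ge>n. x m \<notin> A"
    and small: "c = Red \<Longrightarrow> x l \<notin> A \<Longrightarrow> x l < 1"
    and trivial_less: "u \<le> v \<Longrightarrow> v < u + k \<Longrightarrow> x ` {u..<v} \<subseteq> A \<Longrightarrow> sgn_of c + wt x u v < 2"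
    and trivial_gap: "u \<le> v \<Longrightarrow> v < u + k \<Longrightarrow> x ` {u..<v} \<subseteq> A \<Longrightarrow> s < w \<Longrightarrow> x s \<notin> A \<Longrightarrow>
      sgn_of c + wt x u v \<le> wt x s w - sgn_of c"
begin

lemma wt_mono: "u' \<le> u \<Longrightarrow> v \<le> v' \<Longrightarrow> wt x u v \<le> wt x u' v'"
  unfolding wt_def using nonneg by (intro sum_mono2) (auto intro: add_nonneg_nonneg)

text \<open>By \<open>trivial_gap\<close> a run of fewer than \<open>k\<close> letters is no longer
  than any gap, so both sides of a join are already branches; the larger of their depths serves for
  both.\<close>

lemma tree_branch:
  assumes "tree c A x u v"
  shows "(\<exists>d. branch c A k d x u v) \<or> (v < u + k \<and> x ` {u..<v} \<subseteq> A)"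
  using assms
proof (induction rule: tree.induct)
  case (run u v)
  then have "branch c A k 0 x u v \<or> v < u + k" by auto
  with run show ?case by blast
next
  case (join u v w z)
  have "\<not> (v < u + k \<and> x ` {u..<v} \<subseteq> A)"
    using trivial_gap[of u v v w] join tree_le by force
  moreover have "\<not> (z < w + k \<and> x ` {w..<z} \<subseteq> A)"
    using trivial_gap[of w z v w] join tree_le by force
  ultimately obtain d d' where "branch c A k d x u v" "branch c A k d' x w z"
    using join by auto
  then have "branch c A k (max d d') x u v" "branch c A k (max d d') x w z"
    using branch_mono[of d "max d d'"] branch_mono[of d' "max d d'"] by auto
  then have "branch c A k (Suc (max d d')) x u z"
    unfolding branch.simps(2)
    using join branch_le nonneg by (intro disjI2 exI[of _ v] exI[of _ w]) auto
  then show ?case by blast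
qed

definition max_tree :: "nat \<Rightarrow> nat \<Rightarrow> bool" where
  "max_tree u v \<longleftrightarrow> tree c A x u v \<and> x v \<notin> A"

lemma max_run: obtains v where "max_tree u v" "u \<le> v" "x ` {u..<v} \<subseteq> A"
proof -
  let ?v = "LEAST m. u \<le> m \<and> x m \<notin> A"
  have v: "u \<le> ?v \<and> x ?v \<notin> A" by (rule LeastI_ex) (use out[of u] in auto)
  have "x l \<in> A" if "u \<le> l" "l < ?v" for l using not_less_Least[OF that(2)] that(1) by auto
  then have "x ` {u..<?v} \<subseteq> A" by auto
  moreover from this have "max_tree u ?v"
    using v tree.run[of u ?v x A c] by (simp add: max_tree_def)
  ultimately show ?thesis using v that by blast
qed

lemma max_tree_join:
  assumes "max_tree u v" "v < w" "x (w - 1) \<notin> A" "max_tree w z"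
    "wt x v w - sgn_of c < sgn_of c + wt x u v" "wt x v w - sgn_of c < sgn_of c + wt x w z"
  shows "max_tree u z"
  using assms tree.join[of c A x u v w z] by (auto simp: max_tree_def)

text \<open>Lengthening a side or shortening the gap preserves a join. So the joins that built the
  inner tree are replayed on the outer one: either it already reaches the right subtree, or the same
  right subtree can be joined to it.\<close>

lemma max_tree_absorb:
  assumes "tree c A x u' e'" "x e' \<notin> A" "u \<le> u'" "max_tree u e" "u' \<le> e"
  shows "\<exists>e''. max_tree u e'' \<and> e \<le> e'' \<and> e' \<le> e''"
  using assms
proof (induction arbitrary: e u rule: tree.induct)
  case (run u' e' e u)
  have "e' \<le> e"
  proof (rule ccontr)
    assume "\<not> ?thesis"
    then have "x e \<in> A" using run by auto
    with run show False by (auto simp: max_tree_def)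
  qed
  then show ?case using run by auto
next
  case (join u' v w z)
  obtain e1 where e1: "max_tree u e1" "e \<le> e1" "v \<le> e1"
    using join.IH(1)[OF join.hyps(3) join.prems(2-4)] by blast
  show ?case
  proof (cases "w \<le> e1")
    case True
    have "u \<le> w" using join tree_le[of c A x u' v] by auto
    from join.IH(2)[OF join.prems(1) this e1(1) True] e1 show ?thesis by (meson order_trans)
  next
    case False
    have "u' \<le> v" using join tree_le by auto
    have "wt x e1 w \<le> wt x v w" "wt x u' v \<le> wt x u e1"
      using e1 join by (auto intro!: wt_mono)
    then have "max_tree u z"
      using join e1 False by (intro max_tree_join[OF e1(1), of w]) (auto simp: max_tree_def)
    moreover have "w \<le> z" using join tree_le by blast
    ultimately show ?thesis using False e1 by (intro exI[of _ z]) auto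
  qed
qed

text \<open>A merge of formable intervals may have its gap start and end anywhere. Here it is
  brought to normal form: the left tree reaches beyond \<open>v\<close> up to a letter outside
  \<open>A\<close>, and the right one is extended to the left over letters of \<open>A\<close>; both
  changes only help the join.\<close>

lemma max_tree_merge:
  assumes J: "max_tree u e" "v \<le> e" and J': "max_tree w e'" "z \<le> e'"
    and uw: "u \<le> v" "v \<le> w" "w \<le> z"
    and gap: "wt x v w - sgn_of c < sgn_of c + wt x u v" "wt x v w - sgn_of c < sgn_of c + wt x w z"
  shows "\<exists>e''. max_tree u e'' \<and> z \<le> e''"
proof (cases "w \<le> e")
  case True
  then show ?thesis using max_tree_absorb[of w e' u e] assms by (auto simp: max_tree_def)
next
  case False
  \<comment> \<open>The start of the block of letters of \<open>A\<close> just before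
    \<open>w\<close>, cut off behind \<open>e\<close>. The letter preceding it is outside
    \<open>A\<close>, by leastness or because it is the letter at \<open>e\<close>.\<close>
  define w' where "w' = (LEAST m. e < m \<and> x ` {m..<w} \<subseteq> A)"
  have w': "e < w' \<and> x ` {w'..<w} \<subseteq> A"
    unfolding w'_def by (rule LeastI[of _ w]) (use False in auto)
  have "w' \<le> w" unfolding w'_def by (rule Least_le) (use False in auto)
  have "x (w' - 1) \<notin> A"
  proof (cases "w' - 1 = e")
    case True
    then show ?thesis using J by (simp add: max_tree_def)
  next
    case False
    then have "e < w' - 1" "w' - 1 < w'" using w' by auto
    then have "\<not> (e < w' - 1 \<and> x ` {w' - 1..<w} \<subseteq> A)"
      using not_less_Least unfolding w'_def by blast
    moreover have "{w' - 1..<w} \<subseteq> insert (w' - 1) {w'..<w}" by auto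
    ultimately show ?thesis using w' \<open>e < w' - 1\<close> by blast
  qed
  obtain m where m: "max_tree w' m" "w' \<le> m" "x ` {w'..<m} \<subseteq> A" by (rule max_run)
  have "w \<le> m"
  proof (rule ccontr)
    assume "\<not> w \<le> m"
    then have "x m \<in> A" using w' m by auto
    then show False using m by (auto simp: max_tree_def)
  qed
  then obtain e'' where e'': "max_tree w' e''" "e' \<le> e''"
    using max_tree_absorb[of w e' w' m] J' m \<open>w' \<le> w\<close> by (auto simp: max_tree_def)
  have "wt x e w' \<le> wt x v w" "wt x u v \<le> wt x u e" "wt x w z \<le> wt x w' e''"
    using J J' e'' \<open>w' \<le> w\<close> uw by (auto intro!: wt_mono)
  then have "max_tree u e''"
    using gap w' by (intro max_tree_join[OF J(1) _ \<open>x (w' - 1) \<notin> A\<close> e''(1)]) auto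
  then show ?thesis using J' e'' by (meson order_trans)
qed

text \<open>The left end is kept exactly, since the barrier depends on it, while the right end may
  be overshot. The alternative of length below 1 is for short blue intervals when red wins: winning
  gaps then have length at least 1, so such an interval never takes part in a merge.\<close>

lemma formable_max_tree:
  assumes red: "\<And>i. p (2 * i) - p (2 * i - 1) = 1"
    and blue: "\<And>n::nat. p (2 * (a + int n) + 1) - p (2 * (a + int n)) = x n"
    and "formable p i j" "colour_from i = opposite c" "2 * a - 1 + offset c \<le> i"
  shows "\<exists>u v. i = 2 * (a + int u) - 1 + offset c \<and> j = 2 * (a + int v) - offset c \<and> u \<le> v \<and>
    (p j - p i < 1 \<or> (\<exists>e. max_tree u e \<and> v \<le> e))"
proof -
  note pos = boundary_position[of p a x, OF red blue]
  have len: "p (2 * (a + int v) - offset c) - p (2 * (a + int u) - 1 + offset c) = sgn_of c + wt x u v"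
    if "u \<le> v" for u v
    using pos wt_add[of 0 u v x] that by (auto simp: offset_def sgn_of_def)
  have gap: "p (2 * (a + int w) - 1 + offset c) - p (2 * (a + int v) - offset c) = wt x v w - sgn_of c"
    if "v \<le> w" for v w
    using pos wt_add[of 0 v w x] that by (auto simp: offset_def sgn_of_def)
  show ?thesis
    using assms(3-5)
  proof (induction rule: formable.induct)
    case (single i)
    have "\<exists>u. i = 2 * (a + int u) - 1 + offset c"
    proof (cases c)
      case Blue
      then have "odd i" using single by (auto simp: colour_from_def split: if_splits)
      then obtain m where "i = 2 * m + 1" by (rule oddE)
      then show ?thesis using Blue single
        by (intro exI[of _ "nat (m + 1 - a)"]) (auto simp: offset_def)
    next
      case Red
      then have "even i" using single by (auto simp: colour_from_def split: if_splits)
      then obtain m where "i = 2 * m" by (rule evenE)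
      then show ?thesis using Red single
        by (intro exI[of _ "nat (m - a)"]) (auto simp: offset_def)
    qed
    then obtain u where u: "i = 2 * (a + int u) - 1 + offset c" by blast
    obtain e where e: "max_tree u e" "u \<le> e" by (metis max_run)
    show ?case
    proof (cases c)
      case Blue
      then show ?thesis using u e by (intro exI[of _ u]) (auto simp: offset_def)
    next
      case Red
      have "p (i + 1) - p i < 1 \<or> Suc u \<le> e"
      proof (cases "x u \<in> A")
        case True
        then have "u \<noteq> e" using e by (auto simp: max_tree_def)
        then show ?thesis using e by auto
      next
        case False
        then show ?thesis using blue[of u] small[OF Red False] u Red by (simp add: offset_def)
      qed
      then show ?thesis using u e Red
        by (intro exI[of _ u] exI[of _ "Suc u"]) (auto simp: offset_def algebra_simps)
    qed
  next
    case (merge i j k l)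
    have "odd (j - i)" using merge formable_odd by blast
    then have "even (k - i)" using merge by auto
    then have ck: "colour_from k = opposite c" using colour_from_even merge by metis
    have "i < j" using merge formable_less by blast
    obtain u v where uv: "i = 2 * (a + int u) - 1 + offset c" "j = 2 * (a + int v) - offset c" "u \<le> v"
      "p j - p i < 1 \<or> (\<exists>e. max_tree u e \<and> v \<le> e)"
      using merge by blast
    obtain w z where wz: "k = 2 * (a + int w) - 1 + offset c" "l = 2 * (a + int z) - offset c" "w \<le> z"
      "p l - p k < 1 \<or> (\<exists>e. max_tree w e \<and> z \<le> e)"
      using merge.IH(2)[OF ck] merge.prems(2) merge.hyps(3) \<open>i < j\<close> by (auto simp del: not_less)
    have vw: "v \<le> w" using uv wz merge by (auto simp: offset_def split: if_splits)
    have L: "p j - p i = sgn_of c + wt x u v" "p l - p k = sgn_of c + wt x w z"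
      "p k - p j = wt x v w - sgn_of c"
      using len gap uv wz vw by auto
    have ge: "0 \<le> wt x u v" "0 \<le> wt x v w" "0 \<le> wt x w z"
      unfolding wt_def using nonneg by (auto intro!: sum_nonneg add_nonneg_nonneg)
    have "\<not> p j - p i < 1" "\<not> p l - p k < 1"
      using L ge merge.hyps(5,6) by (auto simp: sgn_of_def split: if_splits)
    then obtain e e' where "max_tree u e" "v \<le> e" "max_tree w e'" "z \<le> e'" using uv wz by auto
    from max_tree_merge[OF this uv(3) vw wz(3)] merge.hyps(5,6) L
    have "\<exists>e''. max_tree u e'' \<and> z \<le> e''" by auto
    then show ?case using uv wz vw by (intro exI[of _ u] exI[of _ z]) auto
  qed
qed

text \<open>Each of the first \<open>u\<close> letters brings a red unit, so the word that starts at
  \<open>u\<close> lies at least \<open>u\<close> beyond the core. The barrier \<open>L + u\<close>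
  is thus below the distance required by safety.\<close>

lemma right_safe_if:
  assumes red: "\<And>i. p (2 * i) - p (2 * i - 1) = 1"
    and blue: "\<And>n::nat. p (2 * (a + int n) + 1) - p (2 * (a + int n)) = x n"
    and safe: "\<And>d u v. branch c A k d x u v \<Longrightarrow> sgn_of c + wt x u v < L + real u"
    and L: "2 \<le> L" "L \<le> p (2 * a - 1 + offset c) - p s"
  shows "right_safe p c s (2 * a - 1 + offset c)"
  unfolding right_safe_def
proof (intro allI impI, elim conjE)
  fix i j assume ij: "2 * a - 1 + offset c \<le> i" "colour_from i = opposite c" "formable p i j"
  from formable_max_tree[OF red blue ij(3,2,1)] obtain u v where uv:
    "i = 2 * (a + int u) - 1 + offset c" "j = 2 * (a + int v) - offset c" "u \<le> v"
    "p j - p i < 1 \<or> (\<exists>e. max_tree u e \<and> v \<le> e)" by blast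
  note pos = boundary_position[of p a x, OF red blue]
  have len: "p j - p i = sgn_of c + wt x u v"
    using uv pos wt_add[of 0 u v x] by (auto simp: offset_def sgn_of_def)
  have "p i = p (2 * a - 1 + offset c) + wt x 0 u"
    using uv pos[of u] red[of a] by (auto simp: offset_def)
  moreover have "real u \<le> wt x 0 u" using wt_ge[of 0 u x] nonneg by auto
  moreover have "p j - p i < L + real u"
  proof (cases "p j - p i < 1")
    case True
    then show ?thesis using L by auto
  next
    case False
    then obtain e where e: "max_tree u e" "v \<le> e" using uv by auto
    then have "wt x u v \<le> wt x u e" by (intro wt_mono) auto
    moreover have "sgn_of c + wt x u e < L + real u"
      using tree_branch[of u e] e safe[of _ u e] trivial_less[of u e] L tree_le
      by (force simp: max_tree_def)
    ultimately show ?thesis using len by linarith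
  qed
  ultimately show "p j - p i < p i - p s" using L by linarith
qed

end

section \<open>First moment of the trees\<close>

lemma snth_shift: "(stake n w @- v) !! m = (if m < n then w !! m else v !! (m - n))"
  by (cases "m < n") (simp_all add: shift_snth_less shift_snth_ge)

lemma sdrop_stake_shift: "sdrop n (stake n w @- v) = v"
  by (induction n arbitrary: w) auto

text \<open>Locality: a branch reads only its own letters, hence disjoint words give independent
  events.\<close>

lemma branch_cong:
  "(\<And>l. u \<le> l \<Longrightarrow> l < v \<Longrightarrow> x l = y l) \<Longrightarrow> branch c A k d x u v = branch c A k d y u v"
proof (induction d arbitrary: u v)
  case 0
  then have "x ` {u..<v} = y ` {u..<v}" by (intro image_cong) auto
  then show ?case by simp
next
  case (Suc d)
  have 1: "x ` {s..<w} = y ` {s..<w}" "wt x s w = wt y s w" if "u \<le> s" "w \<le> v" for s w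
    using Suc.prems that by (auto intro!: image_cong wt_cong)
  have 2: "branch c A k d x s w = branch c A k d y s w" if "u \<le> s" "w \<le> v" for s w
    using Suc that by auto
  have "(u \<le> s \<and> s < w \<and> w \<le> v \<and> branch c A k d x u s \<and> branch c A k d x w v \<and>
        x s \<notin> A \<and> x (w - 1) \<notin> A \<and> x ` {s..<w} \<subseteq> {0..} \<and>
        wt x s w - sgn_of c < sgn_of c + wt x u s \<and> wt x s w - sgn_of c < sgn_of c + wt x w v) =
     (u \<le> s \<and> s < w \<and> w \<le> v \<and> branch c A k d y u s \<and> branch c A k d y w v \<and>
        y s \<notin> A \<and> y (w - 1) \<notin> A \<and> y ` {s..<w} \<subseteq> {0..} \<and>
        wt y s w - sgn_of c < sgn_of c + wt y u s \<and> wt y s w - sgn_of c < sgn_of c + wt y w v)" for s w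
  proof (cases "u \<le> s \<and> s < w \<and> w \<le> v")
    case True
    then have "u \<le> w - 1" "w - 1 < v" by auto
    with Suc.prems have "x (w - 1) = y (w - 1)" by blast
    then show ?thesis using True 1[of u s] 1[of s w] 1[of w v] 2[of u s] 2[of w v] Suc.prems[of s]
      by simp
  qed auto
  then show ?case using 1[of u v] by simp
qed

lemma image_shift: "(\<lambda>n. x (a + n)) ` {u..<v} = x ` {a + u..<a + v}" for a :: nat
proof -
  have "(\<lambda>n. x (a + n)) ` {u..<v} = x ` ((+) a ` {u..<v})" by (rule image_image[symmetric])
  then show ?thesis by (simp add: add.commute)
qed

lemma branch_shift:
  "branch c A k d (\<lambda>n. x (a + n)) u v \<longleftrightarrow> branch c A k d x (a + u) (a + v)"
proof (induction d arbitrary: u v)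
  case 0
  show ?case by (simp add: image_shift)
next
  case (Suc d)
  have "(\<exists>s w. P s w \<and> a + u \<le> s \<and> s < w) \<longleftrightarrow> (\<exists>s w. P (a + s) (a + w) \<and> u \<le> s \<and> s < w)" for P
  proof
    assume "\<exists>s w. P s w \<and> a + u \<le> s \<and> s < w"
    then obtain s w where "P s w" "a + u \<le> s" "s < w" by blast
    then show "\<exists>s w. P (a + s) (a + w) \<and> u \<le> s \<and> s < w"
      by (intro exI[of _ "s - a"] exI[of _ "w - a"]) auto
  next
    assume "\<exists>s w. P (a + s) (a + w) \<and> u \<le> s \<and> s < w"
    then obtain s w where "P (a + s) (a + w)" "u \<le> s" "s < w" by blast
    then show "\<exists>s w. P s w \<and> a + u \<le> s \<and> s < w"
      by (intro exI[of _ "a + s"] exI[of _ "a + w"]) auto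
  qed
  from this[of "\<lambda>s w. w \<le> a + v \<and> branch c A k d x (a + u) s \<and> branch c A k d x w (a + v) \<and>
        x s \<notin> A \<and> x (w - 1) \<notin> A \<and> x ` {s..<w} \<subseteq> {0..} \<and>
        wt x s w - sgn_of c < sgn_of c + wt x (a + u) s \<and> wt x s w - sgn_of c < sgn_of c + wt x w (a + v)"]
  have "(\<exists>s w. a + u \<le> s \<and> s < w \<and> w \<le> a + v \<and> branch c A k d x (a + u) s \<and> branch c A k d x w (a + v) \<and>
        x s \<notin> A \<and> x (w - 1) \<notin> A \<and> x ` {s..<w} \<subseteq> {0..} \<and>
        wt x s w - sgn_of c < sgn_of c + wt x (a + u) s \<and> wt x s w - sgn_of c < sgn_of c + wt x w (a + v))
      \<longleftrightarrow> (\<exists>s w. u \<le> s \<and> s < w \<and> w \<le> v \<and> branch c A k d x (a + u) (a + s) \<and> branch c A k d x (a + w) (a + v) \<and>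
        x (a + s) \<notin> A \<and> x (a + w - 1) \<notin> A \<and> x ` {a + s..<a + w} \<subseteq> {0..} \<and>
        wt x (a + s) (a + w) - sgn_of c < sgn_of c + wt x (a + u) (a + s) \<and>
        wt x (a + s) (a + w) - sgn_of c < sgn_of c + wt x (a + w) (a + v))"
    by (simp add: conj_ac)
  moreover have "s < w \<Longrightarrow> a + w - 1 = a + (w - 1)" for s w :: nat by auto
  ultimately show ?case
    by (simp add: Suc.IH image_shift wt_shift cong: conj_cong)
qed

lemma branch_sdrop: "branch c A k d (snth (sdrop a w)) u v \<longleftrightarrow> branch c A k d (snth w) (a + u) (a + v)"
proof -
  have "snth (sdrop a w) = (\<lambda>n. w !! (a + n))" by (auto simp: sdrop_snth)
  then show ?thesis by (simp add: branch_shift)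
qed

lemma wt_sdrop: "wt (snth (sdrop a w)) u v = wt (snth w) (a + u) (a + v)"
proof -
  have "snth (sdrop a w) = (\<lambda>n. w !! (a + n))" by (auto simp: sdrop_snth)
  then show ?thesis by (simp add: wt_shift)
qed

text \<open>Ensures that \<open>ennreal\<close> truncates no branch length; for red winning a run of
  at least one letter makes up for the sign -1.\<close>

lemma branch_nonneg:
  assumes "branch c A k d x u v" "1 \<le> k" "A \<subseteq> {0..}"
  shows "0 \<le> sgn_of c + wt x u v"
  using assms(1)
proof (induction d arbitrary: u v)
  have base: "0 \<le> sgn_of c + wt x u v" if "u + k \<le> v" "x ` {u..<v} \<subseteq> A" for u v
  proof -
    have "real (v - u) \<le> wt x u v" by (rule wt_ge) (use that assms in force)
    moreover have "1 \<le> real (v - u)" using that assms by auto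
    ultimately show ?thesis by (auto simp: sgn_of_def)
  qed
  {
    case 0
    then show ?case using base by auto
  next
    case (Suc d)
    show ?case
    proof (cases "u + k \<le> v \<and> x ` {u..<v} \<subseteq> A")
      case False
      with Suc.prems obtain s w where sw: "u \<le> s" "s < w" "w \<le> v"
        "branch c A k d x u s" "branch c A k d x w v" "x ` {s..<w} \<subseteq> {0..}"
        by auto
      have "real (w - s) \<le> wt x s w" by (rule wt_ge) (use sw in force)
      moreover have "1 \<le> real (w - s)" using sw by auto
      moreover have "wt x u v = wt x u s + wt x s w + wt x w v"
        using sw wt_add[of u s w x] wt_add[of u w v x] by auto
      ultimately show ?thesis using Suc.IH[OF sw(4)] Suc.IH[OF sw(5)] by (auto simp: sgn_of_def)
    qed (use base in auto)
  }
qed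

lemma le_suminf: "f i \<le> (\<Sum>i. f i)" for f :: "nat \<Rightarrow> ennreal"
  using sum_le_suminf[of f "{i}"] by simp

lemma suminf_swap: "(\<Sum>i. \<Sum>j. f i j) = (\<Sum>j. \<Sum>i. f i j)" for f :: "nat \<Rightarrow> nat \<Rightarrow> ennreal"
  unfolding nn_integral_count_space_nat[symmetric, of "\<lambda>j. \<Sum>i. f i j"]
  by (subst nn_integral_suminf) (auto simp: nn_integral_count_space_nat)

lemma suminf_if_eq: "(\<Sum>n. if n = m \<and> P then a n else 0) = (if P then a m else 0)" for a :: "nat \<Rightarrow> ennreal"
  by (subst suminf_finite[of "{m}"]) auto

section \<open>Independent letters and the events that build a tree\<close>

locale letter_law = U: prob_space U for U :: "real measure" +
  assumes sets_U [measurable_cong]: "sets U = sets borel"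
begin

abbreviation S :: "real stream measure" where "S \<equiv> stream_space U"

sublocale S: prob_space S by (rule U.prob_space_stream_space)

sublocale SS: pair_sigma_finite S S ..

lemma space_U [simp]: "space U = UNIV"
  using sets_eq_imp_space_eq[OF sets_U] by simp

lemma space_S [simp]: "space S = UNIV"
  by (simp add: space_stream_space)

lemma emeasure_S [simp]: "emeasure S UNIV = 1"
  using S.emeasure_space_1 by simp

lemma measurable_snth_real [measurable]: "(\<lambda>w. w !! n) \<in> borel_measurable S"
  using measurable_snth[of n U] by simp

text \<open>Independence in integral form: the letters from position \<open>n\<close> on may be
  replaced by a fresh stream without changing the law.\<close>

lemma nn_integral_split:
  assumes f [measurable]: "f \<in> borel_measurable S"
  shows "(\<integral>\<^sup>+w. f w \<partial>S) = (\<integral>\<^sup>+w. \<integral>\<^sup>+v. f (stake n w @- v) \<partial>S \<partial>S)"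
  using f
proof (induction n arbitrary: f)
  case (Suc n)
  note [measurable] = Suc.prems
  have "(\<integral>\<^sup>+w. \<integral>\<^sup>+v. f (stake (Suc n) w @- v) \<partial>S \<partial>S) =
      (\<integral>\<^sup>+x. \<integral>\<^sup>+w. \<integral>\<^sup>+v. f (x ## (stake n w @- v)) \<partial>S \<partial>S \<partial>U)"
    by (subst U.nn_integral_stream_space) simp_all
  also have "\<dots> = (\<integral>\<^sup>+x. \<integral>\<^sup>+w. f (x ## w) \<partial>S \<partial>U)"
    by (intro nn_integral_cong Suc.IH[symmetric]) measurable
  also have "\<dots> = (\<integral>\<^sup>+w. f w \<partial>S)"
    by (rule U.nn_integral_stream_space[symmetric]) measurable
  finally show ?case ..
qed simp

lemma nn_integral_sdrop:
  assumes f [measurable]: "f \<in> borel_measurable S"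
  shows "(\<integral>\<^sup>+w. f (sdrop n w) \<partial>S) = (\<integral>\<^sup>+w. f w \<partial>S)"
  by (subst nn_integral_split[of _ n]) (simp_all add: sdrop_stake_shift)

lemma measurable_wt [measurable]: "(\<lambda>w. wt (snth w) u v) \<in> borel_measurable S"
  unfolding wt_def by measurable

end

locale branching = letter_law +
  fixes c :: colour and A :: "real set" and k :: nat
  assumes A [measurable]: "A \<in> sets borel"
    and A_nonneg: "A \<subseteq> {0..}" and k: "1 \<le> k"
begin

lemma measurable_in_A [measurable]: "Measurable.pred S (\<lambda>w. w !! n \<in> A)"
  by (rule pred_sets2[OF A]) simp

lemma measurable_branch [measurable]: "Measurable.pred S (\<lambda>w. branch c A k d (snth w) u v)"
proof (induction d arbitrary: u v)
  case (Suc d)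
  note [measurable] = Suc
  show ?case unfolding branch.simps image_subset_iff atLeast_iff by measurable
qed (simp add: image_subset_iff)

text \<open>The words that can separate two sides of which the shorter has length
  \<open>m\<close>.\<close>

definition gap_word :: "real stream \<Rightarrow> nat \<Rightarrow> real \<Rightarrow> bool" where
  "gap_word w n m \<longleftrightarrow> 0 < n \<and> w !! 0 \<notin> A \<and> w !! (n - 1) \<notin> A \<and> snth w ` {0..<n} \<subseteq> {0..} \<and>
     wt (snth w) 0 n - sgn_of c < m"

lemma measurable_gap_word [measurable]:
  assumes [measurable]: "f \<in> measurable N S" "g \<in> borel_measurable N"
  shows "Measurable.pred N (\<lambda>x. gap_word (f x) n (g x))"
proof -
  have [measurable]: "(\<lambda>x. f x !! i) \<in> borel_measurable N" for i
    by (rule measurable_compose[OF assms(1) measurable_snth_real])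
  have [measurable]: "Measurable.pred N (\<lambda>x. f x !! i \<in> A)" for i
    by (rule pred_sets2[OF A]) simp
  show ?thesis unfolding gap_word_def image_subset_iff atLeast_iff wt_def by measurable
qed

definition mass :: "nat \<Rightarrow> ennreal" where
  "mass d = (\<Sum>n. \<integral>\<^sup>+w. (if branch c A k d (snth w) 0 n then ennreal (sgn_of c + wt (snth w) 0 n) else 0) \<partial>S)"

definition joined :: "nat \<Rightarrow> nat \<Rightarrow> nat \<Rightarrow> nat \<Rightarrow> real stream \<Rightarrow> bool" where
  "joined d i j l w \<longleftrightarrow> branch c A k d (snth w) 0 i \<and> branch c A k d (snth (sdrop (i + j) w)) 0 l \<and>
     gap_word (sdrop i w) j (min (sgn_of c + wt (snth w) 0 i) (sgn_of c + wt (snth (sdrop (i + j) w)) 0 l))"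

text \<open>The gap of a join is shorter than both sides, so the whole is at most three times the
  longer side; this is the 3 of the recursion.\<close>

definition joined_size :: "nat \<Rightarrow> nat \<Rightarrow> nat \<Rightarrow> real stream \<Rightarrow> ennreal" where
  "joined_size i j l w = ennreal (3 * max (sgn_of c + wt (snth w) 0 i) (sgn_of c + wt (snth (sdrop (i + j) w)) 0 l))"

lemma measurable_joined [measurable]: "Measurable.pred S (joined d i j l)"
  unfolding joined_def[abs_def] by measurable

lemma measurable_joined_size [measurable]: "joined_size i j l \<in> borel_measurable S"
  unfolding joined_size_def[abs_def] by measurable

lemma branch_Suc_cases:
  assumes "branch c A k (Suc d) (snth w) 0 n"
  shows "branch c A k 0 (snth w) 0 n \<or>
    (\<exists>i j l. n = i + j + l \<and> joined d i j l w \<and> ennreal (sgn_of c + wt (snth w) 0 n) \<le> joined_size i j l w)"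
proof (cases "branch c A k 0 (snth w) 0 n")
  case False
  with assms obtain s v where *: "s < v" "v \<le> n" "branch c A k d (snth w) 0 s"
    "branch c A k d (snth w) v n" "w !! s \<notin> A" "w !! (v - 1) \<notin> A" "snth w ` {s..<v} \<subseteq> {0..}"
    "wt (snth w) s v - sgn_of c < sgn_of c + wt (snth w) 0 s"
    "wt (snth w) s v - sgn_of c < sgn_of c + wt (snth w) v n"
    by auto
  have "snth (sdrop s w) ` {0..<v - s} = snth w ` {s..<v}"
  proof -
    have "snth (sdrop s w) = snth w \<circ> (+) s" by (auto simp: sdrop_snth)
    moreover have "(+) s ` {0..<v - s} = {s..<v}" using * by simp
    ultimately show ?thesis by (metis image_comp)
  qed
  then have "joined d s (v - s) (n - v) w"
    using * unfolding joined_def gap_word_def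
    by (simp add: branch_sdrop wt_sdrop sdrop_snth)
  moreover have "wt (snth w) 0 n = wt (snth w) 0 s + wt (snth w) s v + wt (snth w) v n"
    using * wt_add[of 0 s v "snth w"] wt_add[of 0 v n "snth w"] by auto
  then have "ennreal (sgn_of c + wt (snth w) 0 n) \<le> joined_size s (v - s) (n - v) w"
    unfolding joined_size_def using * by (intro ennreal_leI) (simp add: wt_sdrop max_def)
  ultimately show ?thesis using *
    by (intro disjI2 exI[of _ s] exI[of _ "v - s"] exI[of _ "n - v"]) auto
qed simp

end

section \<open>The quadratic recursion for the expected tree length\<close>

locale subcritical = branching +
  fixes q h :: real
  assumes q: "0 \<le> q" and h: "0 \<le> h" "12 * q * h \<le> 1"
    and gaps: "\<And>m. 0 \<le> m \<Longrightarrow> (\<Sum>n. \<integral>\<^sup>+w. (if gap_word w n m then 1 else 0) \<partial>S) \<le> ennreal (q * m)"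
    and runs: "mass 0 \<le> ennreal h"
begin

text \<open>For sides of lengths \<open>a\<close> and \<open>b\<close> the expected number of
  admissible gaps is at most \<open>q * min a b\<close>, and the join has length at most
  \<open>3 * max a b\<close>. Minimum times maximum is \<open>a * b\<close>, so the bound factorises
  and each side contributes one \<open>mass d\<close>.\<close>

lemma joined_mass:
  "(\<Sum>i. \<Sum>l. \<Sum>j. \<integral>\<^sup>+w. (if joined d i j l w then joined_size i j l w else 0) \<partial>S) \<le> ennreal (3 * q) * (mass d)\<^sup>2"
proof -
  let ?len = "\<lambda>w n. sgn_of c + wt (snth w) 0 n"
  let ?B = "\<lambda>w n. branch c A k d (snth w) 0 n"
  let ?R = "\<lambda>i j l w1 w3 w2. if ?B w1 i \<and> ?B w3 l \<and> gap_word w2 j (min (?len w1 i) (?len w3 l))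
        then ennreal (3 * max (?len w1 i) (?len w3 l)) else 0"
  \<comment> \<open>On a stream spliced from three independent streams the two sides see only
    \<open>w1\<close> and \<open>w3\<close>, and the gap only the first \<open>j\<close> letters of
    \<open>w2\<close>.\<close>
  have local: "joined d i j l (stake i w1 @- (stake j w2 @- w3)) \<longleftrightarrow>
        ?B w1 i \<and> ?B w3 l \<and> gap_word w2 j (min (?len w1 i) (?len w3 l))"
    "joined_size i j l (stake i w1 @- (stake j w2 @- w3)) = ennreal (3 * max (?len w1 i) (?len w3 l))"
    for i j l w1 w2 w3
  proof -
    have 1: "sdrop (i + j) (stake i w1 @- (stake j w2 @- w3)) = w3"
      by (simp add: sdrop_add[symmetric] sdrop_stake_shift)
    have 2: "wt (snth (stake i w1 @- (stake j w2 @- w3))) 0 i = wt (snth w1) 0 i"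
      by (rule wt_cong) (simp add: snth_shift)
    have 3: "branch c A k d (snth (stake i w1 @- (stake j w2 @- w3))) 0 i = ?B w1 i"
      by (rule branch_cong) (simp add: snth_shift)
    have 4: "wt (snth (stake j w2 @- w3)) 0 j = wt (snth w2) 0 j"
      by (rule wt_cong) (simp add: snth_shift)
    have 5: "gap_word (stake j w2 @- w3) j m = gap_word w2 j m" for m
    proof (cases "0 < j")
      case True
      then have "(stake j w2 @- w3) !! 0 = w2 !! 0" "(stake j w2 @- w3) !! (j - 1) = w2 !! (j - 1)"
        by (simp_all only: snth_shift) auto
      moreover have "snth (stake j w2 @- w3) ` {0..<j} = snth w2 ` {0..<j}"
        by (intro image_cong) (auto simp: snth_shift)
      ultimately show ?thesis unfolding gap_word_def by (simp only: 4)
    qed (simp add: gap_word_def)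
    show "joined d i j l (stake i w1 @- (stake j w2 @- w3)) \<longleftrightarrow>
        ?B w1 i \<and> ?B w3 l \<and> gap_word w2 j (min (?len w1 i) (?len w3 l))"
      unfolding joined_def by (simp only: 1 2 3 5 sdrop_stake_shift)
    show "joined_size i j l (stake i w1 @- (stake j w2 @- w3)) = ennreal (3 * max (?len w1 i) (?len w3 l))"
      unfolding joined_size_def by (simp only: 1 2)
  qed
  have split: "(\<integral>\<^sup>+w. (if joined d i j l w then joined_size i j l w else 0) \<partial>S) =
      (\<integral>\<^sup>+w1. \<integral>\<^sup>+w3. \<integral>\<^sup>+w2. ?R i j l w1 w3 w2 \<partial>S \<partial>S \<partial>S)" (is "?l = ?r") for i j l
  proof -
    have "?l = (\<integral>\<^sup>+w1. \<integral>\<^sup>+v. (if joined d i j l (stake i w1 @- v) then joined_size i j l (stake i w1 @- v) else 0) \<partial>S \<partial>S)"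
      by (rule nn_integral_split) measurable
    also have "\<dots> = (\<integral>\<^sup>+w1. \<integral>\<^sup>+w2. \<integral>\<^sup>+w3. ?R i j l w1 w3 w2 \<partial>S \<partial>S \<partial>S)"
    proof (rule nn_integral_cong)
      fix w1
      let ?f = "\<lambda>v. if joined d i j l (stake i w1 @- v) then joined_size i j l (stake i w1 @- v) else 0"
      have "(\<integral>\<^sup>+v. ?f v \<partial>S) = (\<integral>\<^sup>+w2. \<integral>\<^sup>+w3. ?f (stake j w2 @- w3) \<partial>S \<partial>S)"
        by (rule nn_integral_split) measurable
      then show "(\<integral>\<^sup>+v. ?f v \<partial>S) = (\<integral>\<^sup>+w2. \<integral>\<^sup>+w3. ?R i j l w1 w3 w2 \<partial>S \<partial>S)"
        by (simp only: local)
    qed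
    also have "\<dots> = ?r"
      by (intro nn_integral_cong SS.Fubini') measurable
    finally show ?thesis .
  qed
  have "(\<Sum>j. \<integral>\<^sup>+w2. ?R i j l w1 w3 w2 \<partial>S) \<le>
      ennreal (3 * q) * ((if ?B w1 i then ennreal (?len w1 i) else 0) * (if ?B w3 l then ennreal (?len w3 l) else 0))"
    for i l w1 w3
  proof (cases "?B w1 i \<and> ?B w3 l")
    case True
    define a b where "a = ?len w1 i" and "b = ?len w3 l"
    have ab: "0 \<le> a" "0 \<le> b" unfolding a_def b_def using branch_nonneg True k A_nonneg by auto
    have "(\<Sum>j. \<integral>\<^sup>+w2. ?R i j l w1 w3 w2 \<partial>S) =
        (\<Sum>j. ennreal (3 * max a b) * (\<integral>\<^sup>+w2. (if gap_word w2 j (min a b) then 1 else 0) \<partial>S))"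
      using True unfolding a_def[symmetric] b_def[symmetric]
      by (subst nn_integral_cmult[symmetric]) (auto intro!: suminf_cong nn_integral_cong)
    also have "\<dots> = ennreal (3 * max a b) * (\<Sum>j. \<integral>\<^sup>+w2. (if gap_word w2 j (min a b) then 1 else 0) \<partial>S)"
      by simp
    also have "\<dots> \<le> ennreal (3 * max a b) * ennreal (q * min a b)"
      using ab by (intro mult_left_mono gaps) auto
    also have "\<dots> = ennreal (3 * q * (a * b))"
      using ab q by (auto simp: ennreal_mult[symmetric] min_def max_def)
    also have "\<dots> = ennreal (3 * q) * (ennreal a * ennreal b)"
      using ab q by (auto simp: ennreal_mult)
    finally show ?thesis using True by (simp add: a_def b_def)
  next
    case False
    then have "(\<Sum>j. \<integral>\<^sup>+w2. ?R i j l w1 w3 w2 \<partial>S) = 0" by auto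
    then show ?thesis by simp
  qed
  note inner = this
  have "(\<Sum>i. \<Sum>l. \<Sum>j. \<integral>\<^sup>+w. (if joined d i j l w then joined_size i j l w else 0) \<partial>S) =
      (\<Sum>i. \<integral>\<^sup>+w1. (\<Sum>l. \<integral>\<^sup>+w3. (\<Sum>j. \<integral>\<^sup>+w2. ?R i j l w1 w3 w2 \<partial>S) \<partial>S) \<partial>S)"
    unfolding split by (simp add: nn_integral_suminf)
  also have "\<dots> \<le> (\<Sum>i. \<integral>\<^sup>+w1. (\<Sum>l. \<integral>\<^sup>+w3. ennreal (3 * q) * ((if ?B w1 i then ennreal (?len w1 i) else 0) *
      (if ?B w3 l then ennreal (?len w3 l) else 0)) \<partial>S) \<partial>S)"
    by (intro suminf_le nn_integral_mono inner summableI)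
  also have "\<dots> = (\<Sum>i. \<integral>\<^sup>+w1. ennreal (3 * q) * ((if ?B w1 i then ennreal (?len w1 i) else 0) * mass d) \<partial>S)"
    unfolding mass_def by (simp add: nn_integral_cmult)
  also have "\<dots> = (\<Sum>i. ennreal (3 * q) * ((\<integral>\<^sup>+w1. (if ?B w1 i then ennreal (?len w1 i) else 0) \<partial>S) * mass d))"
    by (simp add: nn_integral_cmult nn_integral_multc)
  also have "\<dots> = ennreal (3 * q) * (mass d * mass d)"
    by (simp add: mass_def)
  finally show ?thesis by (simp add: power2_eq_square)
qed

text \<open>A union bound over the positions of the top join. Summing over the total number
  \<open>n\<close> of letters removes the constraint \<open>n = i + j + l\<close>.\<close>

lemma mass_Suc: "mass (Suc d) \<le> mass 0 + ennreal (3 * q) * (mass d)\<^sup>2"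
proof -
  let ?\<Phi> = "\<lambda>d n w. if branch c A k d (snth w) 0 n then ennreal (sgn_of c + wt (snth w) 0 n) else 0"
  let ?\<Psi> = "\<lambda>i l j n w. if n = i + j + l \<and> joined d i j l w then joined_size i j l w else 0"
  have "?\<Phi> (Suc d) n w \<le> ?\<Phi> 0 n w + (\<Sum>i. \<Sum>l. \<Sum>j. ?\<Psi> i l j n w)" for n w
  proof (cases "branch c A k (Suc d) (snth w) 0 n \<and> \<not> branch c A k 0 (snth w) 0 n")
    case True
    then obtain i j l where *: "n = i + j + l" "joined d i j l w"
      "ennreal (sgn_of c + wt (snth w) 0 n) \<le> joined_size i j l w"
      using branch_Suc_cases by blast
    have "?\<Phi> (Suc d) n w \<le> ?\<Psi> i l j n w" using * True by (simp del: branch.simps)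
    also have "\<dots> \<le> (\<Sum>j. ?\<Psi> i l j n w)" by (rule le_suminf)
    also have "\<dots> \<le> (\<Sum>l. \<Sum>j. ?\<Psi> i l j n w)" by (rule le_suminf)
    also have "\<dots> \<le> (\<Sum>i. \<Sum>l. \<Sum>j. ?\<Psi> i l j n w)" by (rule le_suminf)
    finally show ?thesis by (simp add: add_increasing)
  qed (auto simp del: branch.simps)
  then have "mass (Suc d) \<le> (\<Sum>n. \<integral>\<^sup>+w. ?\<Phi> 0 n w + (\<Sum>i. \<Sum>l. \<Sum>j. ?\<Psi> i l j n w) \<partial>S)"
    unfolding mass_def by (intro suminf_le nn_integral_mono summableI)
  also have "\<dots> = (\<Sum>n. (\<integral>\<^sup>+w. ?\<Phi> 0 n w \<partial>S) + (\<integral>\<^sup>+w. (\<Sum>i. \<Sum>l. \<Sum>j. ?\<Psi> i l j n w) \<partial>S))"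
    by (subst nn_integral_add) (auto simp del: branch.simps)
  also have "\<dots> = mass 0 + (\<Sum>n. \<integral>\<^sup>+w. (\<Sum>i. \<Sum>l. \<Sum>j. ?\<Psi> i l j n w) \<partial>S)"
    unfolding mass_def by (simp add: suminf_add[symmetric] del: branch.simps)
  also have "(\<Sum>n. \<integral>\<^sup>+w. (\<Sum>i. \<Sum>l. \<Sum>j. ?\<Psi> i l j n w) \<partial>S) =
      (\<integral>\<^sup>+w. (\<Sum>n. \<Sum>i. \<Sum>l. \<Sum>j. ?\<Psi> i l j n w) \<partial>S)"
    by (simp add: nn_integral_suminf)
  also have "(\<lambda>w. \<Sum>n. \<Sum>i. \<Sum>l. \<Sum>j. ?\<Psi> i l j n w) =
      (\<lambda>w. \<Sum>i. \<Sum>l. \<Sum>j. if joined d i j l w then joined_size i j l w else 0)"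
  proof
    fix w
    have "(\<Sum>n. \<Sum>i. \<Sum>l. \<Sum>j. ?\<Psi> i l j n w) = (\<Sum>i. \<Sum>n. \<Sum>l. \<Sum>j. ?\<Psi> i l j n w)"
      by (rule suminf_swap)
    also have "\<dots> = (\<Sum>i. \<Sum>l. \<Sum>n. \<Sum>j. ?\<Psi> i l j n w)"
      by (intro suminf_cong suminf_swap)
    also have "\<dots> = (\<Sum>i. \<Sum>l. \<Sum>j. \<Sum>n. ?\<Psi> i l j n w)"
      by (intro suminf_cong suminf_swap)
    finally show "(\<Sum>n. \<Sum>i. \<Sum>l. \<Sum>j. ?\<Psi> i l j n w) =
      (\<Sum>i. \<Sum>l. \<Sum>j. if joined d i j l w then joined_size i j l w else 0)"
      by (simp add: suminf_if_eq)
  qed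
  also have "(\<integral>\<^sup>+w. (\<Sum>i. \<Sum>l. \<Sum>j. if joined d i j l w then joined_size i j l w else 0) \<partial>S) =
      (\<Sum>i. \<Sum>l. \<Sum>j. \<integral>\<^sup>+w. (if joined d i j l w then joined_size i j l w else 0) \<partial>S)"
    by (simp add: nn_integral_suminf)
  also note joined_mass
  finally show ?thesis by simp
qed

text \<open>The bound \<open>2 * h\<close> reproduces itself: \<open>3 * q * (2 * h)^2\<close>
  equals \<open>12 * q * h\<close> times \<open>h\<close>, which is at most \<open>h\<close>. This
  is the origin of the 12.\<close>

lemma mass_bound: "mass d \<le> ennreal (2 * h)"
proof (induction d)
  case 0
  show ?case using runs h by (auto intro: order_trans ennreal_leI)
next
  case (Suc d)
  have "mass (Suc d) \<le> ennreal h + ennreal (3 * q) * (ennreal (2 * h))\<^sup>2"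
    by (rule order_trans[OF mass_Suc]) (intro add_mono mult_left_mono power_mono runs Suc; simp)
  also have "\<dots> = ennreal (h + h * (12 * q * h))"
    using q h by (simp add: ennreal_power ennreal_mult[symmetric] ennreal_plus[symmetric] power2_eq_square
        mult.assoc mult.left_commute del: ennreal_plus)
  also have "\<dots> \<le> ennreal (2 * h)"
    using h mult_left_mono[OF h(2) h(1)] by (intro ennreal_leI) simp
  finally show ?case .
qed

text \<open>The bound does not depend on the depth, so it survives the monotone limit over
  \<open>d\<close>.\<close>

lemma finite_mass:
  "(\<Sum>n. \<integral>\<^sup>+w. (if \<exists>d. branch c A k d (snth w) 0 n then ennreal (sgn_of c + wt (snth w) 0 n) else 0) \<partial>S)
     \<le> ennreal (2 * h)"
proof -
  let ?\<Phi> = "\<lambda>d n w. if branch c A k d (snth w) 0 n then ennreal (sgn_of c + wt (snth w) 0 n) else 0"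
  have inc: "?\<Phi> d n w \<le> ?\<Phi> d' n w" if "d \<le> d'" for d d' n w
    using branch_mono[OF that] by auto
  have "(\<Sum>n. \<integral>\<^sup>+w. (if \<exists>d. branch c A k d (snth w) 0 n then ennreal (sgn_of c + wt (snth w) 0 n) else 0) \<partial>S) =
     (\<Sum>n. \<integral>\<^sup>+w. (SUP d. ?\<Phi> d n w) \<partial>S)"
  proof (intro suminf_cong nn_integral_cong)
    fix n w
    show "(if \<exists>d. branch c A k d (snth w) 0 n then ennreal (sgn_of c + wt (snth w) 0 n) else 0) = (SUP d. ?\<Phi> d n w)"
    proof (rule antisym)
      show "(SUP d. ?\<Phi> d n w) \<le> (if \<exists>d. branch c A k d (snth w) 0 n then ennreal (sgn_of c + wt (snth w) 0 n) else 0)"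
        by (intro SUP_least) auto
      show "(if \<exists>d. branch c A k d (snth w) 0 n then ennreal (sgn_of c + wt (snth w) 0 n) else 0) \<le> (SUP d. ?\<Phi> d n w)"
      proof (cases "\<exists>d. branch c A k d (snth w) 0 n")
        case True
        then obtain d where "branch c A k d (snth w) 0 n" by blast
        then have "(if \<exists>d. branch c A k d (snth w) 0 n then ennreal (sgn_of c + wt (snth w) 0 n) else 0) = ?\<Phi> d n w"
          by auto
        then show ?thesis using SUP_upper[of d UNIV "\<lambda>d. ?\<Phi> d n w"] by simp
      qed simp
    qed
  qed
  also have "\<dots> = (\<Sum>n. SUP d. \<integral>\<^sup>+w. ?\<Phi> d n w \<partial>S)"
    using inc by (intro suminf_cong nn_integral_monotone_convergence_SUP) (auto simp: incseq_def le_fun_def simp del: branch.simps)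
  also have "\<dots> = (SUP d. \<Sum>n. \<integral>\<^sup>+w. ?\<Phi> d n w \<partial>S)"
    using inc by (intro ennreal_suminf_SUP_eq) (auto simp: incseq_def intro!: nn_integral_mono simp del: branch.simps)
  also have "\<dots> \<le> ennreal (2 * h)"
    using mass_bound by (intro SUP_least) (auto simp: mass_def)
  finally show ?thesis .
qed

end

section \<open>Existence of seeds\<close>

lemma suminf_ennreal_tail:
  fixes f :: "nat \<Rightarrow> ennreal"
  assumes "(\<Sum>i. f i) < \<top>" "0 < \<epsilon>"
  obtains N where "\<And>n. N \<le> n \<Longrightarrow> (\<Sum>i. f (i + n)) \<le> ennreal \<epsilon>"
proof -
  have fin: "f i < \<top>" for i using le_suminf[of f i] assms by auto
  define g where "g i = enn2real (f i)" for i
  have f: "f i = ennreal (g i)" for i unfolding g_def using fin[of i] by simp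
  have g: "0 \<le> g i" for i by (simp add: g_def)
  have "summable g"
    using assms(1) g by (intro summable_suminf_not_top) (auto simp: f)
  from suminf_exist_split[OF assms(2) this]
  obtain N where N: "\<And>n. N \<le> n \<Longrightarrow> norm (\<Sum>i. g (i + n)) < \<epsilon>" by blast
  have "(\<Sum>i. f (i + n)) \<le> ennreal \<epsilon>" if "N \<le> n" for n
  proof -
    have "summable (\<lambda>i. g (i + n))" using \<open>summable g\<close> by simp
    then have "(\<Sum>i. f (i + n)) = ennreal (\<Sum>i. g (i + n))"
      unfolding f using g by (intro suminf_ennreal2) auto
    then show ?thesis using N[OF that] by (auto intro: ennreal_leI)
  qed
  then show ?thesis using that by blast
qed

lemma suminf_count_le:
  assumes "0 \<le> y"
  shows "(\<Sum>u. if real (Suc u) \<le> y then 1 else 0 :: ennreal) \<le> ennreal y"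
proof -
  have *: "real (Suc u) \<le> y \<longleftrightarrow> u < nat \<lfloor>y\<rfloor>" for u
    using assms by (simp add: Suc_le_eq[symmetric] le_nat_iff le_floor_iff)
  have "(\<Sum>u. if real (Suc u) \<le> y then 1 else 0 :: ennreal) = (\<Sum>u<nat \<lfloor>y\<rfloor>. 1)"
    unfolding * by (subst suminf_finite[of "{..<nat \<lfloor>y\<rfloor>}"]) auto
  also have "\<dots> = ennreal (real (nat \<lfloor>y\<rfloor>))" by (simp add: ennreal_of_nat_eq_real_of_nat)
  also have "\<dots> \<le> ennreal y" using assms by (intro ennreal_leI) simp
  finally show ?thesis .
qed

context letter_law
begin

lemma pred_sets_S: "Measurable.pred S P \<Longrightarrow> {w. P w} \<in> sets S"
  by (simp add: pred_def)

lemma emeasure_runs: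
  assumes [measurable]: "A \<in> sets borel"
  shows "emeasure S {w. \<forall>l<n. w !! l \<in> A} = (emeasure U A) ^ n"
proof (induction n)
  case (Suc n)
  have [measurable]: "Measurable.pred S (\<lambda>w. w !! l \<in> A)" for l by (rule pred_sets2[OF assms]) simp
  have "{w. \<forall>l<Suc n. w !! l \<in> A} \<in> sets S" by (rule pred_sets_S) measurable
  then have "emeasure S {w. \<forall>l<Suc n. w !! l \<in> A} =
      (\<integral>\<^sup>+x. emeasure S {w. \<forall>l<Suc n. (x ## w) !! l \<in> A} \<partial>U)"
    using U.emeasure_stream_space by simp
  also have "\<dots> = (\<integral>\<^sup>+x. emeasure S {w. \<forall>l<n. w !! l \<in> A} * indicator A x \<partial>U)"
  proof (rule nn_integral_cong)
    fix x
    have "{w. \<forall>l<Suc n. (x ## w) !! l \<in> A} = (if x \<in> A then {w. \<forall>l<n. w !! l \<in> A} else {})"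
      by (auto simp: less_Suc_eq_0_disj)
    then show "emeasure S {w. \<forall>l<Suc n. (x ## w) !! l \<in> A} = emeasure S {w. \<forall>l<n. w !! l \<in> A} * indicator A x"
      by simp
  qed
  also have "\<dots> = emeasure S {w. \<forall>l<n. w !! l \<in> A} * emeasure U A"
    by (rule nn_integral_cmult_indicator) simp
  finally show ?case using Suc by (simp add: mult.commute)
qed simp

end

section \<open>Barriers and the probability that they hold\<close>

context subcritical
begin

definition good :: "nat \<Rightarrow> real stream \<Rightarrow> bool" where
  "good L w \<longleftrightarrow> (\<forall>d u v. branch c A k d (snth w) u v \<longrightarrow> sgn_of c + wt (snth w) u v < real L + real u)"

lemma measurable_good [measurable]: "Measurable.pred S (good L)"
  unfolding good_def[abs_def] by measurable

definition tail :: "nat \<Rightarrow> ennreal" where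
  "tail m = (\<Sum>n. \<integral>\<^sup>+w. (if (\<exists>d. branch c A k d (snth w) 0 n) \<and> real m \<le> sgn_of c + wt (snth w) 0 n
     then 1 else 0) \<partial>S)"

text \<open>At most \<open>y\<close> positive integers are at most \<open>y\<close>, so the tails
  add up to no more than the first moment.\<close>

lemma tail_summable: "(\<Sum>m. tail (Suc m)) < \<top>"
proof -
  let ?f = "\<lambda>n w m. if (\<exists>d. branch c A k d (snth w) 0 n) \<and> real m \<le> sgn_of c + wt (snth w) 0 n
     then 1 else 0 :: ennreal"
  have "(\<Sum>m. tail (Suc m)) = (\<Sum>n. \<Sum>m. \<integral>\<^sup>+w. ?f n w (Suc m) \<partial>S)"
    unfolding tail_def by (rule suminf_swap)
  also have "\<dots> = (\<Sum>n. \<integral>\<^sup>+w. (\<Sum>m. ?f n w (Suc m)) \<partial>S)"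
    by (subst nn_integral_suminf) auto
  also have "\<dots> \<le> (\<Sum>n. \<integral>\<^sup>+w. (if \<exists>d. branch c A k d (snth w) 0 n then ennreal (sgn_of c + wt (snth w) 0 n) else 0) \<partial>S)"
  proof (intro suminf_le nn_integral_mono summableI)
    fix n w
    show "(\<Sum>m. ?f n w (Suc m)) \<le> (if \<exists>d. branch c A k d (snth w) 0 n then ennreal (sgn_of c + wt (snth w) 0 n) else 0)"
    proof (cases "\<exists>d. branch c A k d (snth w) 0 n")
      case True
      then have "0 \<le> sgn_of c + wt (snth w) 0 n" using branch_nonneg k A_nonneg by blast
      from suminf_count_le[OF this] True show ?thesis by simp
    qed simp
  qed
  also have "\<dots> \<le> ennreal (2 * h)" by (rule finite_mass)
  finally show ?thesis by (rule le_less_trans) simp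
qed

text \<open>A union bound over the place \<open>u\<close> where the barrier is crossed; by
  stationarity that place contributes \<open>tail (u + L)\<close>. The result is a remainder of a
  convergent series.\<close>

lemma not_good_le: "emeasure S {w. \<not> good L w} \<le> (\<Sum>u. tail (u + L))"
proof -
  let ?f = "\<lambda>n w m. if (\<exists>d. branch c A k d (snth w) 0 n) \<and> real m \<le> sgn_of c + wt (snth w) 0 n
     then 1 else 0 :: ennreal"
  have "emeasure S {w. \<not> good L w} = (\<integral>\<^sup>+w. indicator {w. \<not> good L w} w \<partial>S)"
    by (intro nn_integral_indicator[symmetric] pred_sets_S) measurable
  also have "\<dots> \<le> (\<integral>\<^sup>+w. (\<Sum>u. \<Sum>n. ?f n (sdrop u w) (u + L)) \<partial>S)"
  proof (rule nn_integral_mono)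
    fix w
    show "indicator {w. \<not> good L w} w \<le> (\<Sum>u. \<Sum>n. ?f n (sdrop u w) (u + L))"
    proof (cases "good L w")
      case False
      then obtain d u v where *: "branch c A k d (snth w) u v" "real L + real u \<le> sgn_of c + wt (snth w) u v"
        unfolding good_def by (auto simp: not_less)
      have "u \<le> v" using * branch_le by blast
      then have "?f (v - u) (sdrop u w) (u + L) = 1"
        using * by (auto simp: branch_sdrop wt_sdrop)
      moreover have "?f (v - u) (sdrop u w) (u + L) \<le> (\<Sum>u. \<Sum>n. ?f n (sdrop u w) (u + L))"
        by (rule order_trans[OF le_suminf le_suminf])
      ultimately show ?thesis by (simp add: indicator_def False)
    qed simp
  qed
  also have "\<dots> = (\<Sum>u. \<Sum>n. \<integral>\<^sup>+w. ?f n (sdrop u w) (u + L) \<partial>S)"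
    by (simp add: nn_integral_suminf)
  also have "\<dots> = (\<Sum>u. tail (u + L))"
    unfolding tail_def by (intro suminf_cong nn_integral_sdrop) measurable
  finally show ?thesis .
qed

lemma eventually_good:
  assumes "0 < \<epsilon>"
  obtains L where "2 \<le> L" "emeasure S {w. \<not> good L w} \<le> ennreal \<epsilon>"
proof -
  obtain N where N: "\<And>n. N \<le> n \<Longrightarrow> (\<Sum>i. tail (Suc (i + n))) \<le> ennreal \<epsilon>"
    using suminf_ennreal_tail[OF tail_summable assms] by auto
  have "emeasure S {w. \<not> good (N + 2) w} \<le> (\<Sum>u. tail (u + (N + 2)))" by (rule not_good_le)
  also have "\<dots> \<le> ennreal \<epsilon>" using N[of "N + 1"] by simp
  finally show ?thesis using that[of "N + 2"] by simp
qed

text \<open>Candidates are disjoint blocks of \<open>L\<close> letters, so that the letters of a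
  core are independent of everything to their right, in particular of the barrier there.\<close>

primrec seedless :: "nat \<Rightarrow> nat \<Rightarrow> real stream \<Rightarrow> bool" where
  "seedless L 0 w \<longleftrightarrow> True"
| "seedless L (Suc n) w \<longleftrightarrow> \<not> ((\<forall>l<L. w !! l \<notin> A) \<and> good L (sdrop L w)) \<and> seedless L n (sdrop L w)"

lemma measurable_seedless [measurable]: "Measurable.pred S (seedless L n)"
proof (induction n)
  case (Suc n)
  note [measurable] = Suc
  show ?case unfolding seedless.simps[abs_def] by measurable
qed simp

primrec n_good :: "nat \<Rightarrow> nat \<Rightarrow> real stream \<Rightarrow> nat" where
  "n_good L 0 w = 0"
| "n_good L (Suc n) w = (if good L (sdrop L w) then 1 else 0) + n_good L n (sdrop L w)"

lemma measurable_n_good [measurable]: "n_good L n \<in> measurable S (count_space UNIV)"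
proof (induction n)
  case (Suc n)
  note [measurable] = Suc
  show ?case unfolding n_good.simps[abs_def] by measurable
qed simp

lemma n_good_le: "n_good L n w \<le> n"
proof (induction n arbitrary: w)
  case (Suc n)
  from Suc[of "sdrop L w"] show ?case by simp
qed simp

lemma expected_bad:
  assumes "emeasure S {w. \<not> good L w} \<le> ennreal \<epsilon>"
  shows "(\<integral>\<^sup>+w. of_nat (n - n_good L n w) \<partial>S) \<le> of_nat n * ennreal \<epsilon>"
proof (induction n)
  case (Suc n)
  have "(\<integral>\<^sup>+w. of_nat (Suc n - n_good L (Suc n) w) \<partial>S) =
      (\<integral>\<^sup>+w. (indicator {w. \<not> good L w} (sdrop L w) + of_nat (n - n_good L n (sdrop L w))) \<partial>S)"
    using n_good_le[of L n] by (intro nn_integral_cong) (auto simp: indicator_def Suc_diff_le)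
  also have "\<dots> = (\<integral>\<^sup>+w. (indicator {w. \<not> good L w} w + of_nat (n - n_good L n w)) \<partial>S)"
    by (rule nn_integral_sdrop) measurable
  also have "\<dots> = emeasure S {w. \<not> good L w} + (\<integral>\<^sup>+w. of_nat (n - n_good L n w) \<partial>S)"
    using pred_sets_S[of "\<lambda>w. \<not> good L w"] by (subst nn_integral_add) auto
  also have "\<dots> \<le> ennreal \<epsilon> + of_nat n * ennreal \<epsilon>"
    by (intro add_mono assms Suc)
  finally show ?case by (simp add: distrib_right)
qed simp

text \<open>
  Revealing the letters from right to left, every good position gives an independent chance of at
  least \<open>\<theta>\<close> of a core directly to its left, so the weighted probability below does not increase.
\<close>

lemma weighted_seedless:
  assumes \<theta>: "0 < \<theta>" "\<theta> < 1" "ennreal \<theta> \<le> emeasure S {w. \<forall>l<L. w !! l \<notin> A}"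
  shows "(\<integral>\<^sup>+w. (if seedless L n w then ennreal ((1 / (1 - \<theta>)) ^ n_good L n w) else 0) \<partial>S) \<le> 1"
proof (induction n)
  case (Suc n)
  let ?K = "\<lambda>w. \<forall>l<L. w !! l \<notin> A"
  let ?f = "\<lambda>w. if seedless L n w then ennreal ((1 / (1 - \<theta>)) ^ n_good L n w) else 0"
  let ?g = "\<lambda>w v. if ?K w \<and> good L v then 0 else ennreal (if good L v then 1 / (1 - \<theta>) else 1)"
  have [measurable]: "Measurable.pred S ?K" by measurable
  have "(\<integral>\<^sup>+w. (if seedless L (Suc n) w then ennreal ((1 / (1 - \<theta>)) ^ n_good L (Suc n) w) else 0) \<partial>S) =
      (\<integral>\<^sup>+w. ?g w (sdrop L w) * ?f (sdrop L w) \<partial>S)"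
    using \<theta> by (intro nn_integral_cong) (auto simp: ennreal_mult[symmetric])
  also have "\<dots> = (\<integral>\<^sup>+w. \<integral>\<^sup>+v. ?g (stake L w @- v) (sdrop L (stake L w @- v)) * ?f (sdrop L (stake L w @- v)) \<partial>S \<partial>S)"
    by (rule nn_integral_split) measurable
  also have "\<dots> = (\<integral>\<^sup>+w. \<integral>\<^sup>+v. ?g w v * ?f v \<partial>S \<partial>S)"
  proof -
    have "?K (stake L w @- v) \<longleftrightarrow> ?K w" for w v by (auto simp: snth_shift)
    then show ?thesis by (simp only: sdrop_stake_shift)
  qed
  \<comment> \<open>Goodness is decided by the stream \<open>v\<close> to the right of the block.
    With \<open>v\<close> fixed and good, the block is harmless with probability at most
    \<open>1 - \<theta>\<close>, which cancels the weight \<open>1 / (1 - \<theta>)\<close>.\<close>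
  also have "\<dots> = (\<integral>\<^sup>+v. \<integral>\<^sup>+w. ?g w v * ?f v \<partial>S \<partial>S)"
    by (rule SS.Fubini') measurable
  also have "\<dots> = (\<integral>\<^sup>+v. (\<integral>\<^sup>+w. ?g w v \<partial>S) * ?f v \<partial>S)"
    by (intro nn_integral_cong nn_integral_multc) measurable
  also have "\<dots> \<le> (\<integral>\<^sup>+v. 1 * ?f v \<partial>S)"
  proof (intro nn_integral_mono mult_right_mono)
    fix v
    show "(\<integral>\<^sup>+w. ?g w v \<partial>S) \<le> 1"
    proof (cases "good L v")
      case True
      have "emeasure S {w. ?K w} = ennreal (S.prob {w. ?K w})" by (rule S.emeasure_eq_measure)
      then have p: "\<theta> \<le> S.prob {w. ?K w}" using \<theta> by (simp add: measure_nonneg)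
      have "(\<integral>\<^sup>+w. ?g w v \<partial>S) = (\<integral>\<^sup>+w. ennreal (1 / (1 - \<theta>)) * indicator {w. \<not> ?K w} w \<partial>S)"
        using True by (intro nn_integral_cong) (auto simp: indicator_def)
      also have "\<dots> = ennreal (1 / (1 - \<theta>)) * emeasure S {w. \<not> ?K w}"
        by (intro nn_integral_cmult_indicator pred_sets_S) measurable
      also have "emeasure S {w. \<not> ?K w} = ennreal (1 - S.prob {w. ?K w})"
      proof -
        have "{w. ?K w} \<in> sets S" by (rule pred_sets_S) measurable
        moreover have "{w. \<not> ?K w} = space S - {w. ?K w}" by auto
        ultimately show ?thesis using S.prob_compl[of "{w. ?K w}"] by (simp only: S.emeasure_eq_measure)
      qed
      also have "ennreal (1 / (1 - \<theta>)) * ennreal (1 - S.prob {w. ?K w}) \<le>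
          ennreal (1 / (1 - \<theta>)) * ennreal (1 - \<theta>)"
        using p by (intro mult_left_mono ennreal_leI) auto
      also have "\<dots> = 1" using \<theta> by (simp add: ennreal_mult[symmetric])
      finally show ?thesis .
    qed simp
  qed simp
  finally show ?case using Suc by simp
qed simp

text \<open>Of \<open>2 * m\<close> places at least \<open>m\<close> are good or at least
  \<open>m\<close> are bad. The first case without a seed has probability at most
  \<open>(1 - \<theta>) ^ m\<close> by the weighted bound; the second has probability at most
  \<open>\<epsilon> / 2\<close> by Markov's inequality, the expected number of bad places being at
  most \<open>2 * m * \<epsilon> / 4\<close>.\<close>

lemma seedless_unlikely:
  assumes pos: "0 < emeasure U {x. x \<notin> A}" and \<epsilon>: "0 < \<epsilon>"
  obtains L n where "2 \<le> L" "emeasure S {w. seedless L n w} \<le> ennreal \<epsilon>"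
proof -
  obtain L where L: "2 \<le> L" "emeasure S {w. \<not> good L w} \<le> ennreal (\<epsilon> / 4)"
    using eventually_good[of "\<epsilon> / 4"] \<epsilon> by auto
  have core_pos: "0 < emeasure S {w. \<forall>l<L. w !! l \<notin> A}"
  proof -
    have "0 < x ^ L" if "0 < x" for x :: ennreal
      by (induction L) (use that in \<open>auto simp: ennreal_zero_less_mult_iff\<close>)
    then show ?thesis using emeasure_runs[of "- A" L] A pos by (simp add: Collect_neg_eq)
  qed
  define \<theta> where "\<theta> = min (1 / 2) (S.prob {w. \<forall>l<L. w !! l \<notin> A})"
  have \<theta>: "0 < \<theta>" "\<theta> < 1" "ennreal \<theta> \<le> emeasure S {w. \<forall>l<L. w !! l \<notin> A}"
    unfolding \<theta>_def using core_pos by (auto simp: S.emeasure_eq_measure)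
  obtain m where m: "(1 - \<theta>) ^ m < \<epsilon> / 2" "0 < m"
  proof -
    obtain m where "(1 - \<theta>) ^ m < \<epsilon> / 2" using real_arch_pow_inv[of "\<epsilon> / 2" "1 - \<theta>"] \<epsilon> \<theta> by auto
    moreover have "(1 - \<theta>) ^ Suc m \<le> (1 - \<theta>) ^ m" using \<theta> by (intro power_decreasing) auto
    ultimately show ?thesis using that[of "Suc m"] by auto
  qed
  let ?n = "2 * m"
  let ?E1 = "{w. seedless L ?n w \<and> m \<le> n_good L ?n w}" and ?E2 = "{w. m \<le> ?n - n_good L ?n w}"
  have meas: "?E1 \<in> sets S" "?E2 \<in> sets S"
    by (intro pred_sets_S; measurable)+
  have "emeasure S ?E1 = (\<integral>\<^sup>+w. indicator ?E1 w \<partial>S)" using meas by simp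
  also have "\<dots> \<le> (\<integral>\<^sup>+w. ennreal ((1 - \<theta>) ^ m) * (if seedless L ?n w then ennreal ((1 / (1 - \<theta>)) ^ n_good L ?n w) else 0) \<partial>S)"
  proof (intro nn_integral_mono)
    fix w
    show "indicator ?E1 w \<le> ennreal ((1 - \<theta>) ^ m) * (if seedless L ?n w then ennreal ((1 / (1 - \<theta>)) ^ n_good L ?n w) else 0)"
    proof (cases "w \<in> ?E1")
      case True
      have "1 = (1 - \<theta>) ^ m * (1 / (1 - \<theta>)) ^ m" using \<theta> by (simp add: power_mult_distrib[symmetric])
      also have "\<dots> \<le> (1 - \<theta>) ^ m * (1 / (1 - \<theta>)) ^ n_good L ?n w"
        using True \<theta> by (intro mult_left_mono power_increasing) auto
      finally show ?thesis using True \<theta> by (simp add: ennreal_mult[symmetric] ennreal_leI flip: ennreal_1)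
    qed simp
  qed
  also have "\<dots> = ennreal ((1 - \<theta>) ^ m) * (\<integral>\<^sup>+w. (if seedless L ?n w then ennreal ((1 / (1 - \<theta>)) ^ n_good L ?n w) else 0) \<partial>S)"
    by (rule nn_integral_cmult) measurable
  also have "\<dots> \<le> ennreal ((1 - \<theta>) ^ m) * 1"
    by (intro mult_left_mono weighted_seedless \<theta>) simp
  also have "\<dots> \<le> ennreal (\<epsilon> / 2)" using m by (simp add: ennreal_leI)
  finally have E1: "emeasure S ?E1 \<le> ennreal (\<epsilon> / 2)" .
  have "of_nat m * emeasure S ?E2 = (\<integral>\<^sup>+w. of_nat m * indicator ?E2 w \<partial>S)"
    using meas by (simp add: nn_integral_cmult_indicator)
  also have "\<dots> \<le> (\<integral>\<^sup>+w. of_nat (?n - n_good L ?n w) \<partial>S)"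
    by (intro nn_integral_mono) (auto simp: indicator_def simp del: of_nat_diff)
  also have "\<dots> \<le> of_nat ?n * ennreal (\<epsilon> / 4)" by (rule expected_bad[OF L(2)])
  also have "\<dots> = of_nat m * ennreal (\<epsilon> / 2)"
    using \<epsilon> by (simp add: ennreal_of_nat_eq_real_of_nat ennreal_mult[symmetric])
  finally have E2: "emeasure S ?E2 \<le> ennreal (\<epsilon> / 2)"
    using m(2) by (simp add: ennreal_mult_le_mult_iff ennreal_of_nat_eq_real_of_nat)
  have "emeasure S {w. seedless L ?n w} \<le> emeasure S (?E1 \<union> ?E2)"
    using meas by (intro emeasure_mono) auto
  also have "\<dots> \<le> emeasure S ?E1 + emeasure S ?E2" by (rule emeasure_subadditive) (use meas in auto)
  also have "\<dots> \<le> ennreal (\<epsilon> / 2) + ennreal (\<epsilon> / 2)" by (intro add_mono E1 E2)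
  also have "\<dots> = ennreal \<epsilon>" using \<epsilon> by (simp add: ennreal_plus[symmetric] del: ennreal_plus)
  finally show ?thesis using that[OF L(1)] by blast
qed

section \<open>Two-sided sequences of letters\<close>

definition letters_from :: "(int \<Rightarrow> real) \<Rightarrow> int \<Rightarrow> real stream" where
  "letters_from b a = to_stream (\<lambda>n. b (a + int n))"

lemma snth_letters_from [simp]: "letters_from b a !! n = b (a + int n)"
  by (simp add: letters_from_def to_stream_def)

lemma sdrop_letters_from: "sdrop n (letters_from b a) = letters_from b (a + int n)"
  using smap_alt[of id "sdrop n (letters_from b a)" "letters_from b (a + int n)"]
  by (simp add: sdrop_snth add_ac stream.map_id)

lemma measurable_letters_from [measurable]:
  "(\<lambda>b. letters_from b a) \<in> measurable (\<Pi>\<^sub>M i\<in>UNIV. U) S"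
  by (rule measurable_stream_space2) simp

lemma distr_letters_from: "distr (\<Pi>\<^sub>M i\<in>UNIV. U) S (\<lambda>b. letters_from b a) = S"
proof -
  have "distr (\<Pi>\<^sub>M i\<in>UNIV. U) (\<Pi>\<^sub>M n\<in>UNIV. U) (\<lambda>b. \<lambda>n\<in>UNIV. b (a + int n)) = (\<Pi>\<^sub>M n\<in>(UNIV::nat set). U)"
    using distr_PiM_reindex[of UNIV "\<lambda>_. U" "\<lambda>n. a + int n" UNIV] U.prob_space_axioms by (simp add: inj_on_def)
  then have "S = distr (distr (\<Pi>\<^sub>M i\<in>UNIV. U) (\<Pi>\<^sub>M n\<in>UNIV. U) (\<lambda>b n. b (a + int n))) S to_stream"
    using stream_space_eq_distr[of U] by (simp add: restrict_UNIV)
  also have "\<dots> = distr (\<Pi>\<^sub>M i\<in>UNIV. U) S (to_stream \<circ> (\<lambda>b n. b (a + int n)))"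
    by (rule distr_distr) (auto intro!: measurable_PiM_single' simp: space_PiM)
  also have "to_stream \<circ> (\<lambda>b n. b (a + int n)) = (\<lambda>b. letters_from b a)"
    by (auto simp: letters_from_def)
  finally show ?thesis ..
qed

lemma AE_seeds:
  assumes pos: "0 < emeasure U {x. x \<notin> A}"
  shows "AE b in (\<Pi>\<^sub>M i\<in>UNIV. U). \<forall>m. \<exists>L a. 2 \<le> L \<and> a \<le> m \<and> (\<forall>l<L. b (a - int L + int l) \<notin> A) \<and>
    good L (letters_from b a)"
proof (unfold AE_all_countable, intro allI)
  fix m :: int
  let ?P = "\<Pi>\<^sub>M i\<in>(UNIV::int set). U"
  \<comment> \<open>Starting \<open>n\<close> blocks to the left of \<open>m\<close> makes every
    tested block end at or before \<open>m\<close>. By stationarity the starting point does not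
    affect the probability.\<close>
  let ?N = "\<lambda>L n. {b. seedless L n (letters_from b (m - int (n * L)))}"
  let ?Z = "\<Inter>L\<in>{2..}. \<Inter>n. ?N L n"
  have space: "space ?P = UNIV" by (auto simp: space_PiM)
  have meas: "?N L n \<in> sets ?P" for L n
  proof -
    have "Measurable.pred ?P (\<lambda>b. seedless L n (letters_from b (m - int (n * L))))" by measurable
    then show ?thesis by (simp add: pred_def space)
  qed
  have "emeasure ?P (?N L n) = emeasure S {w. seedless L n w}" for L n
  proof -
    have "emeasure S {w. seedless L n w} = emeasure (distr ?P S (\<lambda>b. letters_from b (m - int (n * L)))) {w. seedless L n w}"
      by (simp only: distr_letters_from)
    also have "\<dots> = emeasure ?P ((\<lambda>b. letters_from b (m - int (n * L))) -` {w. seedless L n w} \<inter> space ?P)"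
      using measurable_seedless[of L n] by (intro emeasure_distr) (auto simp: pred_def)
    finally show ?thesis by (simp add: space vimage_def)
  qed
  note emeasure_N = this
  have Z: "?Z \<in> sets ?P"
    using sets.top[of ?P] meas by (intro sets.countable_INT'') (auto simp: space)
  moreover have "emeasure ?P ?Z = 0"
  proof (rule ccontr)
    assume "emeasure ?P ?Z \<noteq> 0"
    interpret P: prob_space ?P by (intro prob_space_PiM U.prob_space_axioms)
    define \<epsilon> where "\<epsilon> = P.prob ?Z / 2"
    have \<epsilon>: "0 < \<epsilon>" using \<open>emeasure ?P ?Z \<noteq> 0\<close> by (simp add: \<epsilon>_def P.emeasure_eq_measure less_le)
    obtain L n where "2 \<le> L" "emeasure S {w. seedless L n w} \<le> ennreal \<epsilon>"
      using seedless_unlikely[OF pos \<epsilon>] .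
    moreover have "emeasure ?P ?Z \<le> emeasure ?P (?N L n)"
      using \<open>2 \<le> L\<close> by (intro emeasure_mono meas) auto
    ultimately have "emeasure ?P ?Z \<le> ennreal \<epsilon>" unfolding emeasure_N by simp
    then show False using \<epsilon> by (simp add: P.emeasure_eq_measure \<epsilon>_def)
  qed
  ultimately have "?Z \<in> null_sets ?P" by auto
  then show "AE b in ?P. \<exists>L a. 2 \<le> L \<and> a \<le> m \<and> (\<forall>l<L. b (a - int L + int l) \<notin> A) \<and> good L (letters_from b a)"
  proof (rule AE_I')
    show "{b \<in> space ?P. \<not> (\<exists>L a. 2 \<le> L \<and> a \<le> m \<and> (\<forall>l<L. b (a - int L + int l) \<notin> A) \<and> good L (letters_from b a))} \<subseteq> ?Z"
    proof safe
      fix b and L n :: nat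
      assume no: "\<nexists>L a. 2 \<le> L \<and> a \<le> m \<and> (\<forall>l<L. b (a - int L + int l) \<notin> A) \<and> good L (letters_from b a)"
        and L: "2 \<le> L"
      have "seedless L j (letters_from b (m - int (j * L)))" for j
      proof (induction j)
        case (Suc j)
        let ?a = "m - int (j * L)"
        have "\<not> ((\<forall>l<L. b (?a - int L + int l) \<notin> A) \<and> good L (letters_from b ?a))"
          using no L by (auto dest!: spec[of _ ?a])
        moreover have "m - int (Suc j * L) = ?a - int L" by (simp add: algebra_simps)
        ultimately show ?case using Suc
          by (simp only: seedless.simps sdrop_letters_from snth_letters_from diff_add_cancel) simp
      qed simp
      then show "seedless L n (letters_from b (m - int (n * L)))" .
    qed
  qed
qed

end

section \<open>From seeds to winning\<close>

text \<open>The reflection uses \<open>1 - i\<close> because it must reverse parity: a colour is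
  read off the left end of an interval, and the left end becomes the right one. The red interval
  from \<open>2 * i - 1\<close> to \<open>2 * i\<close> goes to the red interval with index
  \<open>1 - i\<close>, the blue one with index \<open>i\<close> to that with index
  \<open>- i\<close>.\<close>

lemma formable_reflect: "formable p i j \<Longrightarrow> formable (\<lambda>i. - p (1 - i)) (1 - j) (1 - i)"
proof (induction rule: formable.induct)
  case (single i)
  then show ?case using formable.single[of "\<lambda>i. - p (1 - i)" "- i"] by simp
next
  case (merge i j k l)
  show ?case
    by (rule formable.merge[OF merge.IH(2,1)]) (use merge.hyps in auto)
qed

lemma colour_from_reflect: "colour_from (1 - i) = opposite (colour_from i)"
  by (auto simp: colour_from_def)

lemma core_reflect:
  assumes "core (\<lambda>i. - p (1 - i)) c s e"
  shows "core p c (1 - e) (1 - s)"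
  unfolding core_def
proof (intro conjI allI impI)
  show "1 - e < 1 - s" "colour_from (1 - e) = c" "colour_from (1 - s) = opposite c"
    using assms by (auto simp: core_def colour_from_reflect)
  fix l assume l: "1 - e < l \<and> l + 1 < 1 - s \<and> colour_from l = opposite c"
  have "colour_from (- l) = opposite c"
    using l colour_from_even[of "- l" l] by simp
  then show "p (l + 1) - p l < p l - p (l - 1)" "p (l + 1) - p l < p (l + 2) - p (l + 1)"
    using assms l unfolding core_def by (auto dest!: spec[of _ "- l"] simp: algebra_simps)
qed

lemma right_safe_reflect:
  assumes "right_safe (\<lambda>i. - p (1 - i)) c s e"
  shows "left_safe p c (1 - e) (1 - s)"
  unfolding left_safe_def
proof (intro allI impI, elim conjE)
  fix i k assume *: "k \<le> 1 - e" "colour_from i = opposite c" "formable p i k"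
  have "colour_from (1 - k) = opposite (opposite (colour_from i))"
    using colour_from_odd[OF formable_odd[OF *(3)]] by (simp add: colour_from_reflect)
  then show "p k - p i < p (1 - s) - p k"
    using assms[unfolded right_safe_def, rule_format, of "1 - k" "1 - i"] * formable_reflect[OF *(3)]
    by simp
qed

lemma boundaries_diff:
  assumes "i \<le> j"
  shows "boundaries r b j - boundaries r b i = (\<Sum>l\<in>{i..<j}. gap r b l)"
  using assms
proof (induction j rule: int_ge_induct)
  case (step j)
  then have "{i..<j + 1} = insert j {i..<j}" by auto
  then show ?case using step boundaries_step[of r b j] by simp
qed simp

lemma boundaries_diff_upd:
  assumes "i \<le> j"
  shows "boundaries r (b(m := x)) j - boundaries r (b(m := x)) i =
    boundaries r b j - boundaries r b i + (if 2 * m \<in> {i..<j} then x - b m else 0)"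
proof -
  have *: "gap r (b(m := x)) l = gap r b l + (if l = 2 * m then x - b m else 0)" for l
    by (auto simp: gap_def)
  show ?thesis
    unfolding boundaries_diff[OF assms] * by (simp add: sum.distrib sum.delta)
qed

lemma valid_boundariesI:
  assumes "\<And>i. r i = 1" "\<And>i. 0 < b i"
  shows "valid_boundaries (boundaries r b)"
proof -
  let ?p = "boundaries r b"
  have pos: "0 < gap r b j" for j using assms by (simp add: gap_def)
  have less: "?p i < ?p j" if "i < j" for i j
  proof -
    have "0 < (\<Sum>l\<in>{i..<j}. gap r b l)" using that pos by (intro sum_pos) auto
    then show ?thesis using boundaries_diff[of i j r b] that by simp
  qed
  have two: "?p i + 1 \<le> ?p (i + 2)" for i
  proof -
    have "?p (i + 2) - ?p i = gap r b i + gap r b (i + 1)"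
      using boundaries_step[of r b i] boundaries_step[of r b "i + 1"] by (simp add: add.assoc)
    moreover have "1 \<le> gap r b i + gap r b (i + 1)"
      using assms(1) less_imp_le[OF assms(2)] by (cases "even i") (auto simp: gap_def)
    ultimately show ?thesis by simp
  qed
  have up: "real n \<le> ?p (2 * int n)" for n
  proof (induction n)
    case (Suc n)
    then show ?case using two[of "2 * int n"] by (simp add: algebra_simps)
  qed (simp add: boundaries_0)
  have down: "?p (- 2 * int n) \<le> - real n" for n
  proof (induction n)
    case (Suc n)
    then show ?case using two[of "- 2 * int (Suc n)"] by (simp add: algebra_simps)
  qed (simp add: boundaries_0)
  have "\<exists>i. x \<in> {?p i<..?p (i + 1)}" for x
  proof -
    obtain n where n: "\<bar>x\<bar> < real n" using reals_Archimedean2 by blast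
    let ?S = "{i. x \<le> ?p i} \<inter> {- 2 * int n..2 * int n}"
    have "2 * int n \<in> ?S" using up[of n] n by auto
    then have m: "Min ?S \<in> ?S" by (intro Min_in) auto
    have "Min ?S \<noteq> - 2 * int n" using m down[of n] n by auto
    then have "Min ?S - 1 \<in> {- 2 * int n..2 * int n}" using m by auto
    moreover have "Min ?S - 1 \<notin> ?S"
    proof
      assume "Min ?S - 1 \<in> ?S"
      then have "Min ?S \<le> Min ?S - 1" by (intro Min_le) auto
      then show False by simp
    qed
    ultimately have "?p (Min ?S - 1) < x" by auto
    with m show ?thesis by (intro exI[of _ "Min ?S - 1"]) auto
  qed
  then show ?thesis using less unfolding valid_boundaries_def by blast
qed

context subcritical
begin

text \<open>Outside \<open>A\<close> the blue letters are longer than the red units when blue wins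
  and shorter when red wins; either way every losing interval inside the stretch is shorter than
  both of its neighbours.\<close>

lemma right_seed:
  assumes red: "\<And>i. p (2 * i) - p (2 * i - 1) = 1"
    and blue: "\<And>i. p (2 * i + 1) - p (2 * i) = b i"
    and pos: "\<And>i. 0 < b i" and core: "\<And>l. l < L \<Longrightarrow> b (a - int L + int l) \<notin> A"
    and outer: "\<And>i. b i \<notin> A \<Longrightarrow> if c = Blue then 1 < b i else b i < 1"
    and L: "2 \<le> L" and good: "good L (letters_from b a)"
    and letters: "letters c A k (\<lambda>n. b (a + int n))"
  shows "core p c (2 * (a - int L) - offset c) (2 * a - 1 + offset c)"
    and "right_safe p c (2 * (a - int L) - offset c) (2 * a - 1 + offset c)"
proof -
  let ?s = "2 * (a - int L) - offset c" and ?e = "2 * a - 1 + offset c"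
  have cb: "if c = Blue then 1 < b i else b i < 1" if "a - int L \<le> i" "i < a" for i
  proof -
    have "b (a - int L + int (nat (i - (a - int L)))) \<notin> A" using that by (intro core) auto
    then show ?thesis using outer that by simp
  qed
  have even_step: "p (2 * (i + 1)) = p (2 * i) + 1 + b i" for i
    using red[of "i + 1"] blue[of i] by (simp add: algebra_simps)
  show "core p c ?s ?e"
    unfolding core_def
  proof (intro conjI allI impI)
    show "?s < ?e" "colour_from ?s = c" "colour_from ?e = opposite c"
      using L by (cases c; auto simp: offset_def colour_from_def)+
    fix l assume l: "?s < l \<and> l + 1 < ?e \<and> colour_from l = opposite c"
    have "p (l + 1) - p l < p l - p (l - 1) \<and> p (l + 1) - p l < p (l + 2) - p (l + 1)"
    proof (cases c)
      case Blue
      then have "odd l" using l by (auto simp: colour_from_def split: if_splits)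
      then obtain i where i: "l = 2 * i + 1" by (rule oddE)
      have "1 < b i" "1 < b (i + 1)"
        using cb[of i] cb[of "i + 1"] l i Blue by (auto simp: offset_def)
      then show ?thesis using red[of "i + 1"] blue[of i] blue[of "i + 1"] i
        by (simp add: algebra_simps)
    next
      case Red
      then have "even l" using l by (auto simp: colour_from_def split: if_splits)
      then obtain i where i: "l = 2 * i" by (rule evenE)
      have "b i < 1"
        using cb[of i] l i Red by (auto simp: offset_def)
      then show ?thesis using red[of i] red[of "i + 1"] blue[of i] i
        by (simp add: algebra_simps)
    qed
    then show "p (l + 1) - p l < p l - p (l - 1)" "p (l + 1) - p l < p (l + 2) - p (l + 1)" by auto
  qed
  have len: "p (2 * (a - int L)) + (if c = Blue then 2 * real n else real n) \<le> p (2 * (a - int L + int n))"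
    if "n \<le> L" for n
    using that
  proof (induction n)
    case (Suc n)
    have "if c = Blue then 1 < b (a - int L + int n) else 0 < b (a - int L + int n)"
      using cb[of "a - int L + int n"] pos Suc.prems by auto
    then show ?case using Suc even_step[of "a - int L + int n"]
      by (auto simp: algebra_simps split: if_splits)
  qed simp
  \<comment> \<open>The core begins and ends with the winning colour. For blue it has
    \<open>L\<close> letters but only \<open>L - 1\<close> red units, hence length at least
    \<open>2 * L - 1\<close>; for red it has \<open>L + 1\<close> units.\<close>
  have "real L \<le> p ?e - p ?s"
    using len[of L] red[of a] red[of "a - int L"] L by (cases c) (auto simp: offset_def)
  then show "right_safe p c ?s ?e"
  proof (intro letters.right_safe_if[OF letters red blue, of "real L" ?s])
    have "snth (letters_from b a) = (\<lambda>n. b (a + int n))" by auto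
    then show "sgn_of c + wt (\<lambda>n. b (a + int n)) u v < real L + real u"
      if "branch c A k d (\<lambda>n. b (a + int n)) u v" for d u v
      using good that unfolding good_def by simp
  qed (use L in auto)
qed

end

section \<open>Almost sure properties of the letters and the conclusion from \<open>q\<close> and
  \<open>h\<close>\<close>

locale winning = subcritical +
  assumes atomless: "\<And>y. AE x in U. x \<noteq> y"
    and outer_pos: "0 < emeasure U {x. x \<notin> A}"
    and k_eq: "k = (if c = Blue then 1 else 2)"
    and letter: "AE x in U. 0 < x \<and> (c = Red \<longrightarrow> x < 2) \<and> (x \<notin> A \<longrightarrow> (if c = Blue then 1 < x else x < 1))"
begin

abbreviation P :: "(int \<Rightarrow> real) measure" where "P \<equiv> \<Pi>\<^sub>M i\<in>UNIV. U"

lemma prob_P: "prob_space P"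
  by (intro prob_space_PiM U.prob_space_axioms)

lemma AE_letters:
  "AE b in P. \<forall>i. 0 < b i \<and> (c = Red \<longrightarrow> b i < 2) \<and> (b i \<notin> A \<longrightarrow> (if c = Blue then 1 < b i else b i < 1))"
  unfolding AE_all_countable
  by (intro allI AE_PiM_component letter U.prob_space_axioms UNIV_I)

lemma AE_reflect:
  assumes "AE b in P. Q b"
  shows "AE b in P. Q (\<lambda>i. b (- i))"
proof -
  have "distr P P (\<lambda>b. \<lambda>n\<in>UNIV. b (- n)) = P"
    using distr_PiM_reindex[of UNIV "\<lambda>_. U" "uminus :: int \<Rightarrow> int" UNIV] U.prob_space_axioms by simp
  then have eq: "distr P P (\<lambda>b n. b (- n)) = P" by (simp add: restrict_UNIV)
  have "(\<lambda>b n. b (- n)) \<in> measurable P P"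
    by (rule measurable_PiM_single') (auto simp: space_PiM)
  moreover have "AE b in distr P P (\<lambda>b n. b (- n)). Q b" unfolding eq by (rule assms)
  ultimately show ?thesis by (rule AE_distrD)
qed

text \<open>Resampling the letter \<open>m\<close> preserves the law and leaves \<open>f b\<close>
  unchanged, and a fresh letter of an atomless law almost surely misses a given value.\<close>

lemma AE_neq_independent:
  assumes f [measurable]: "f \<in> borel_measurable P" and indep: "\<And>b x. f (b(m := x)) = f b"
  shows "AE b in P. b m \<noteq> f b"
proof -
  interpret P: prob_space P by (rule prob_P)
  interpret UP: pair_sigma_finite U P ..
  have m [measurable]: "(\<lambda>b. b m) \<in> borel_measurable P"
    using measurable_component_singleton[of m UNIV "\<lambda>_. U"] by simp
  have D: "distr (U \<Otimes>\<^sub>M P) P (\<lambda>y. (snd y)(m := fst y)) = P"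
    using distr_pair_PiM_eq_PiM[of UNIV "\<lambda>_. U" m] U.prob_space_axioms by (simp add: split_beta')
  have "(\<lambda>y. (snd y)(m := fst y)) \<in> measurable (U \<Otimes>\<^sub>M P) P"
    by (rule measurable_fun_upd[of UNIV UNIV m]) auto
  moreover have "{b \<in> space P. b m \<noteq> f b} \<in> sets P" by (rule borel_measurable_neq[OF m f])
  moreover have "AE y in U \<Otimes>\<^sub>M P. fst y \<noteq> f (snd y)"
  proof (rule UP.AE_pair_measure)
    show "{y \<in> space (U \<Otimes>\<^sub>M P). fst y \<noteq> f (snd y)} \<in> sets (U \<Otimes>\<^sub>M P)" by measurable
    have "AE b in P. AE x in U. x \<noteq> f b" using atomless by simp
    then show "AE x in U. AE b in P. fst (x, b) \<noteq> f (snd (x, b))"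
      using UP.AE_commute[of "\<lambda>x b. x \<noteq> f b"] by simp
  qed
  ultimately have "AE b in distr (U \<Otimes>\<^sub>M P) P (\<lambda>y. (snd y)(m := fst y)). b m \<noteq> f b"
    by (subst AE_distr_iff) (simp_all add: indep)
  then show ?thesis unfolding D .
qed

lemma AE_no_ties:
  "AE b in P. \<forall>i j k. i < j \<longrightarrow> j < k \<longrightarrow>
     boundaries (\<lambda>_. 1) b j - boundaries (\<lambda>_. 1) b i \<noteq> boundaries (\<lambda>_. 1) b k - boundaries (\<lambda>_. 1) b j"
proof (unfold AE_all_countable, intro allI)
  fix i j k :: int
  let ?p = "boundaries (\<lambda>_. 1)"
  show "AE b in P. i < j \<longrightarrow> j < k \<longrightarrow> ?p b j - ?p b i \<noteq> ?p b k - ?p b j"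
  proof (cases "i < j \<and> j < k")
    case True
    \<comment> \<open>The blue letter next to boundary \<open>j\<close>, on its right for even
      \<open>j\<close> and on its left for odd \<open>j\<close>. It lies in exactly one of the two
      intervals, so their difference is affine in it with slope \<open>?\<sigma>\<close>, and a tie
      would determine this letter by the others.\<close>
    let ?m = "if even j then j div 2 else (j - 1) div 2"
    let ?\<sigma> = "if even j then - 1 else 1 :: real"
    let ?D = "\<lambda>b. (?p b j - ?p b i) - (?p b k - ?p b j)"
    let ?f = "\<lambda>b. b ?m - ?\<sigma> * ?D b"
    have [measurable]: "(\<lambda>b. b m) \<in> borel_measurable P" for m
      using measurable_component_singleton[of m UNIV "\<lambda>_. U"] by simp
    have [measurable]: "(\<lambda>b. gap (\<lambda>_. 1) b l) \<in> borel_measurable P" for l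
      by (cases "even l") (simp_all add: gap_def)
    have [measurable]: "(\<lambda>b. ?p b l) \<in> borel_measurable P" for l
      by (cases "0 \<le> l") (simp_all add: boundaries_def)
    have "AE b in P. b ?m \<noteq> ?f b"
    proof (rule AE_neq_independent)
      show "?f \<in> borel_measurable P" by measurable
      fix b :: "int \<Rightarrow> real" and x
      have m: "2 * ?m = (if even j then j else j - 1)" by (auto elim: evenE oddE)
      have "?D (b(?m := x)) = ?D b + ?\<sigma> * (x - b ?m)"
        using True boundaries_diff_upd[of i j "\<lambda>_. 1" b ?m x] boundaries_diff_upd[of j k "\<lambda>_. 1" b ?m x]
        unfolding m by (auto split: if_splits)
      then show "?f (b(?m := x)) = ?f b" by (auto simp: algebra_simps)
    qed
    then show ?thesis by eventually_elim auto
  qed auto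
qed

lemma letters_axioms_if:
  assumes b: "\<And>i. 0 < b i \<and> (c = Red \<longrightarrow> b i < 2) \<and> (b i \<notin> A \<longrightarrow> (if c = Blue then 1 < b i else b i < 1))"
    and inf: "\<And>m. \<exists>i\<ge>m. b i \<notin> A"
  shows "letters c A k (\<lambda>n. b (a + int n))"
proof
  fix l n s w u v
  show "0 \<le> b (a + int l)" using b by (auto intro: less_imp_le)
  obtain i where "i \<ge> a + int n" "b i \<notin> A" using inf by blast
  then show "\<exists>m\<ge>n. b (a + int m) \<notin> A" by (intro exI[of _ "nat (i - a)"]) auto
  show "c = Red \<Longrightarrow> b (a + int l) \<notin> A \<Longrightarrow> b (a + int l) < 1" using b[of "a + int l"] by auto
  assume uv: "u \<le> v" "v < u + k" "(\<lambda>n. b (a + int n)) ` {u..<v} \<subseteq> A"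
  \<comment> \<open>Fewer than \<open>k\<close> letters means no letter, or, if red wins, a single
    one, which is below 2; every gap is longer than 2 in that case.\<close>
  have v: "v = u \<or> c = Red \<and> v = Suc u" using uv k_eq by (cases c) auto
  have bu: "c = Red \<longrightarrow> b (a + int u) < 2" using b by blast
  show 1: "sgn_of c + wt (\<lambda>n. b (a + int n)) u v < 2"
    using v bu by (auto simp: sgn_of_def wt_Suc)
  assume sw: "s < w" "b (a + int s) \<notin> A"
  have "0 \<le> wt (\<lambda>n. b (a + int n)) (Suc s) w"
    unfolding wt_def using b by (intro sum_nonneg add_nonneg_nonneg) (auto intro: less_imp_le)
  moreover have "wt (\<lambda>n. b (a + int n)) s w = wt (\<lambda>n. b (a + int n)) s (Suc s) + wt (\<lambda>n. b (a + int n)) (Suc s) w"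
    using sw by (intro wt_add) auto
  ultimately have "1 + b (a + int s) \<le> wt (\<lambda>n. b (a + int n)) s w" by (simp add: wt_Suc)
  moreover have "0 < b (a + int s)" "c = Blue \<longrightarrow> 1 < b (a + int s)" using b[of "a + int s"] sw by auto
  ultimately show "sgn_of c + wt (\<lambda>n. b (a + int n)) u v \<le> wt (\<lambda>n. b (a + int n)) s w - sgn_of c"
    using 1 v by (cases c) (auto simp: sgn_of_def)
qed

lemma colour_wins_almost_surely: "wins_almost_surely c (return borel 1) U"
proof -
  let ?Q = "\<lambda>b. (\<forall>m. \<exists>L a. 2 \<le> L \<and> a \<le> m \<and> (\<forall>l<L. b (a - int L + int l) \<notin> A) \<and> good L (letters_from b a))"
  let ?R = "\<Pi>\<^sub>M i\<in>(UNIV::int set). return borel (1::real)"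
  have ret: "prob_space (return borel (1::real))" by (rule prob_space_return) simp
  interpret R: prob_space ?R by (intro prob_space_PiM ret)
  interpret P: prob_space P by (rule prob_P)
  interpret RP: pair_prob_space ?R P ..
  have "AE r in ?R. \<forall>i. r i = 1"
    unfolding AE_all_countable
    by (intro allI AE_PiM_component[of UNIV "\<lambda>_. return borel 1" _ "\<lambda>x. x = 1"] ret)
      (simp_all add: AE_return)
  then have "AE r in distr (?R \<Otimes>\<^sub>M P) ?R fst. \<forall>i. r i = 1"
    unfolding P.distr_pair_fst .
  then have r: "AE \<omega> in ?R \<Otimes>\<^sub>M P. \<forall>i. fst \<omega> i = 1"
    by (rule AE_distrD[rotated]) simp
  have seeds: "AE b in P. ?Q b" by (rule AE_seeds[OF outer_pos])
  have "AE b in P. ?Q b \<and> ?Q (\<lambda>i. b (- i)) \<and>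
      (\<forall>i. 0 < b i \<and> (c = Red \<longrightarrow> b i < 2) \<and> (b i \<notin> A \<longrightarrow> (if c = Blue then 1 < b i else b i < 1))) \<and>
      (\<forall>i j k. i < j \<longrightarrow> j < k \<longrightarrow>
     boundaries (\<lambda>_. 1) b j - boundaries (\<lambda>_. 1) b i \<noteq> boundaries (\<lambda>_. 1) b k - boundaries (\<lambda>_. 1) b j)"
    (is "AE b in P. ?G b")
    using seeds AE_reflect[OF seeds] AE_letters AE_no_ties by eventually_elim blast
  moreover have "distr (?R \<Otimes>\<^sub>M P) P snd = P"
  proof -
    interpret PR: pair_prob_space P ?R ..
    have "distr (?R \<Otimes>\<^sub>M P) P snd = distr (distr (P \<Otimes>\<^sub>M ?R) (?R \<Otimes>\<^sub>M P) (\<lambda>(x, y). (y, x))) P snd"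
      by (subst RP.distr_pair_swap) simp
    also have "\<dots> = distr (P \<Otimes>\<^sub>M ?R) P fst"
      by (subst distr_distr) (auto simp: comp_def split_beta)
    finally show ?thesis by (simp add: R.distr_pair_fst)
  qed
  ultimately have "AE b in distr (?R \<Otimes>\<^sub>M P) P snd. ?G b" by (simp only:)
  then have "AE \<omega> in ?R \<Otimes>\<^sub>M P. ?G (snd \<omega>)"
    by (rule AE_distrD[rotated]) simp
  with r show ?thesis
    unfolding wins_almost_surely_def length_space_def
  proof eventually_elim
    case (elim \<omega>)
    obtain r b where \<omega>: "\<omega> = (r, b)" by (cases \<omega>)
    have r: "r = (\<lambda>_. 1)" using elim \<omega> by auto
    have G: "?G b" using elim(2) unfolding \<omega> snd_conv .
    let ?p = "boundaries r b" and ?b' = "\<lambda>i. b (- i)"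
    \<comment> \<open>The mirrored line has the letters \<open>b (- i)\<close>, which have the same
      law; its right-safe seeds are the left-safe ones of the original.\<close>
    let ?p' = "\<lambda>i. - ?p (1 - i)"
    have red: "?p (2 * i) - ?p (2 * i - 1) = 1" and blue: "?p (2 * i + 1) - ?p (2 * i) = b i" for i
      by (simp_all add: boundaries_red boundaries_blue r)
    have red': "?p' (2 * i) - ?p' (2 * i - 1) = 1" for i
      using red[of "1 - i"] by (simp add: algebra_simps)
    have blue': "?p' (2 * i + 1) - ?p' (2 * i) = ?b' i" for i
      using blue[of "- i"] by (simp add: algebra_simps)
    have inf: "\<exists>i\<ge>m. b i \<notin> A" and inf': "\<exists>i\<ge>m. ?b' i \<notin> A" for m
    proof -
      have left: "\<exists>i\<le>m. b i \<notin> A" if Q: "?Q b" for b m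
      proof -
        obtain L a where La: "2 \<le> L" "a \<le> m" "\<forall>l<L. b (a - int L + int l) \<notin> A"
          using Q by metis
        from La(3)[rule_format, of 0] La show ?thesis by (intro exI[of _ "a - int L"]) auto
      qed
      obtain i where "i \<le> - m" "?b' i \<notin> A" using left[of ?b' "- m"] G by blast
      then show "\<exists>i\<ge>m. b i \<notin> A" by (intro exI[of _ "- i"]) auto
      obtain i where "i \<le> - m" "b i \<notin> A" using left[of b "- m"] G by blast
      then show "\<exists>i\<ge>m. ?b' i \<notin> A" by (intro exI[of _ "- i"]) auto
    qed
    have seed: "\<exists>s e. e \<le> m \<and> core p c s e \<and> right_safe p c s e"
      if p: "\<And>i. p (2 * i) - p (2 * i - 1) = 1" "\<And>i. p (2 * i + 1) - p (2 * i) = b i"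
        and Q: "?Q b" and b: "\<And>i. 0 < b i \<and> (c = Red \<longrightarrow> b i < 2) \<and> (b i \<notin> A \<longrightarrow> (if c = Blue then 1 < b i else b i < 1))"
        and inf: "\<And>m. \<exists>i\<ge>m. b i \<notin> A"
      for p b m
    proof -
      \<comment> \<open>The absolute value makes \<open>2 * a\<close> at most \<open>m\<close> for
        either sign of \<open>m\<close>.\<close>
      obtain L a where La: "2 \<le> L" "a \<le> - \<bar>m\<bar>" "\<forall>l<L. b (a - int L + int l) \<notin> A" "good L (letters_from b a)"
        using Q by metis
      have "2 * a - 1 + offset c \<le> m" using La by (auto simp: offset_def)
      with right_seed[OF p _ _ _ La(1,4) letters_axioms_if[OF b inf]] b La show ?thesis by blast
    qed
    have "colour_wins c r b"
    proof (rule colour_wins_if_seeds)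
      show "valid_boundaries ?p" by (rule valid_boundariesI) (use r G in auto)
      show "?p j - ?p i \<noteq> ?p k - ?p j" if "i < j" "j < k" for i j k
        using G that unfolding r by blast
      show "\<exists>s e. e \<le> m \<and> core ?p c s e \<and> right_safe ?p c s e" for m
        by (rule seed[OF red blue]) (use G inf in blast)+
      show "\<exists>s e. m \<le> s \<and> core ?p c s e \<and> left_safe ?p c s e" for m
      proof -
        have "\<exists>s e. e \<le> 1 - m \<and> core ?p' c s e \<and> right_safe ?p' c s e"
          by (rule seed[OF red' blue']) (use G inf' in blast)+
        then obtain s e where "e \<le> 1 - m" "core ?p' c s e" "right_safe ?p' c s e" by blast
        then have "m \<le> 1 - e" "core ?p c (1 - e) (1 - s)" "left_safe ?p c (1 - e) (1 - s)"
          using core_reflect right_safe_reflect by auto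
        then show ?thesis by blast
      qed
    qed
    then show ?case by (simp add: \<omega>)
  qed
qed

end

section \<open>The uniform law\<close>

lemma nn_integral_linear:
  fixes \<alpha> \<beta> a b :: real
  assumes "a \<le> b" "\<And>x. a \<le> x \<Longrightarrow> x \<le> b \<Longrightarrow> 0 \<le> \<alpha> + \<beta> * x"
  shows "(\<integral>\<^sup>+x. ennreal (\<alpha> + \<beta> * x) * indicator {a..b} x \<partial>lborel) = ennreal (\<alpha> * (b - a) + \<beta> * (b\<^sup>2 - a\<^sup>2) / 2)"
proof -
  have "(\<integral>\<^sup>+x. ennreal (\<alpha> + \<beta> * x) * indicator {a..b} x \<partial>lborel) =
      ennreal ((\<alpha> * b + \<beta> * b\<^sup>2 / 2) - (\<alpha> * a + \<beta> * a\<^sup>2 / 2))"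
    by (rule nn_integral_FTC_Icc) (use assms in \<open>auto intro!: derivative_eq_intros\<close>)
  then show ?thesis by (simp add: algebra_simps diff_divide_distrib)
qed

locale uniform_law =
  fixes D :: real
  assumes D: "1 \<le> D"
begin

abbreviation U :: "real measure" where "U \<equiv> uniform_measure lborel {0..D}"

sublocale letter_law U
proof -
  interpret prob_space U by (rule prob_space_uniform_measure) (use D in auto)
  show "letter_law U" by unfold_locales auto
qed

lemma nn_integral_U:
  assumes [measurable]: "f \<in> borel_measurable borel"
  shows "(\<integral>\<^sup>+x. f x \<partial>U) = ennreal (1 / D) * (\<integral>\<^sup>+x. f x * indicator {0..D} x \<partial>lborel)"
proof -
  have "(\<integral>\<^sup>+x. f x \<partial>U) = (\<integral>\<^sup>+x. f x * indicator {0..D} x \<partial>lborel) / emeasure lborel {0..D}"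
    by (rule nn_integral_uniform_measure) auto
  then show ?thesis using D
    by (simp add: divide_ennreal_def inverse_ennreal mult.commute inverse_eq_divide)
qed

lemma emeasure_U:
  assumes "0 \<le> a" "a \<le> b" "b \<le> D"
  shows "emeasure U {a..b} = ennreal ((b - a) / D)"
proof -
  have "{0..D} \<inter> {a..b} = {a..b}" using assms by auto
  then show ?thesis using assms D by (simp add: emeasure_uniform_measure divide_ennreal)
qed

lemma AE_U: "AE x in U. 0 < x \<and> x < D \<and> x \<noteq> y"
proof (rule AE_uniform_measureI)
  show "AE x in lborel. x \<in> {0..D} \<longrightarrow> 0 < x \<and> x < D \<and> x \<noteq> y"
    using AE_lborel_singleton[of 0] AE_lborel_singleton[of D] AE_lborel_singleton[of y]
    by eventually_elim auto
qed simp

section \<open>Numerical estimates for red\<close>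

lemma red_winning:
  assumes D': "D \<le> 11216 / 10000"
  shows "winning U Red {1..D} 2 1 (1 / 12)"
proof -
  interpret R: branching U Red "{1..D}" 2 by unfold_locales auto
  \<comment> \<open>The probability that a blue letter exceeds 1.\<close>
  define \<rho> where "\<rho> = (D - 1) / D"
  \<comment> \<open>A geometric majorant: a run of \<open>n\<close> letters has length at most
    \<open>n * (1 + D) - 1\<close>. This is at most 3.2432 < 13/4 for \<open>n = 2\<close>, and one
    more letter at most doubles it.\<close>
  let ?f = "\<lambda>n. if 2 \<le> n then 13 / 4 * 2 ^ (n - 2) * \<rho> ^ n else 0 :: real"
  have \<rho>: "0 \<le> \<rho>" "\<rho> \<le> 109 / 1000" using D D' by (auto simp: \<rho>_def field_simps)
  have growth: "real n * (1 + D) - 1 \<le> 13 / 4 * 2 ^ (n - 2)" if "2 \<le> n" for n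
    using that
  proof (induction n rule: dec_induct)
    case base
    then show ?case using D' by simp
  next
    case (step n)
    then have "2 \<le> real n" by simp
    then have "1 \<le> (real n - 1) * (1 + D)" using D mult_mono[of 1 "real n - 1" 1 "1 + D"] by simp
    moreover have "2 ^ (Suc n - 2) = 2 * (2::real) ^ (n - 2)" using step by (simp flip: power_Suc add: Suc_diff_le)
    ultimately show ?case using step.IH by (simp add: algebra_simps)
  qed
  have "R.mass 0 \<le> (\<Sum>n. ennreal (?f n))"
    unfolding R.mass_def
  proof (intro suminf_le summableI)
    fix n
    let ?I = "\<integral>\<^sup>+w. (if branch Red {1..D} 2 0 (snth w) 0 n then ennreal (sgn_of Red + wt (snth w) 0 n) else 0) \<partial>S"
    show "?I \<le> ennreal (?f n)"
    proof (cases "2 \<le> n")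
      case True
      have "?I \<le> (\<integral>\<^sup>+w. ennreal (13 / 4 * 2 ^ (n - 2)) * indicator {w. \<forall>l<n. w !! l \<in> {1..D}} w \<partial>S)"
      proof (rule nn_integral_mono)
        fix w
        show "(if branch Red {1..D} 2 0 (snth w) 0 n then ennreal (sgn_of Red + wt (snth w) 0 n) else 0) \<le>
            ennreal (13 / 4 * 2 ^ (n - 2)) * indicator {w. \<forall>l<n. w !! l \<in> {1..D}} w"
        proof (cases "branch Red {1..D} 2 0 (snth w) 0 n")
          case b: True
          then have w: "\<forall>l<n. w !! l \<in> {1..D}" by (auto simp: image_subset_iff)
          then have "wt (snth w) 0 n \<le> (\<Sum>l=0..<n. 1 + D)" unfolding wt_def by (intro sum_mono) auto
          then have "sgn_of Red + wt (snth w) 0 n \<le> 13 / 4 * 2 ^ (n - 2)"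
            using growth[OF True] by (simp add: sgn_of_def)
          then show ?thesis using b w by (simp add: ennreal_leI)
        qed (simp only: if_False zero_le)
      qed
      also have "\<dots> = ennreal (13 / 4 * 2 ^ (n - 2)) * emeasure S {w. \<forall>l<n. w !! l \<in> {1..D}}"
        by (intro nn_integral_cmult_indicator pred_sets_S) measurable
      also have "emeasure S {w. \<forall>l<n. w !! l \<in> {1..D}} = ennreal \<rho> ^ n"
        using D emeasure_U[of 1 D] by (subst emeasure_runs) (auto simp: \<rho>_def)
      also have "ennreal (13 / 4 * 2 ^ (n - 2)) * ennreal \<rho> ^ n = ennreal (?f n)"
        using True \<rho> by (simp add: ennreal_power ennreal_mult[symmetric])
      finally show ?thesis .
    qed simp
  qed
  also have "(\<Sum>n. ennreal (?f n)) = ennreal (13 / 4 * \<rho>\<^sup>2 / (1 - 2 * \<rho>))"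
  proof (rule suminf_ennreal_eq)
    show "0 \<le> ?f n" for n using \<rho> by auto
    have "(\<lambda>n. 13 / 4 * \<rho>\<^sup>2 * (2 * \<rho>) ^ n) sums (13 / 4 * \<rho>\<^sup>2 * (1 / (1 - 2 * \<rho>)))"
      using \<rho> by (intro sums_mult geometric_sums) auto
    moreover have "(\<lambda>n. ?f (n + 2)) = (\<lambda>n. 13 / 4 * \<rho>\<^sup>2 * (2 * \<rho>) ^ n)"
      by (auto simp: power_mult_distrib power2_eq_square)
    ultimately show "?f sums (13 / 4 * \<rho>\<^sup>2 / (1 - 2 * \<rho>))"
      using sums_iff_shift[of ?f 2] by (simp add: numeral_2_eq_2)
  qed
  \<comment> \<open>At \<open>\<rho> = 109 / 1000\<close> the left side is below 0.05, well within
    the 1/12 that \<open>q = 1\<close> allows.\<close>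
  also have "\<dots> \<le> ennreal (1 / 12)"
  proof (rule ennreal_leI)
    have "\<rho>\<^sup>2 \<le> (109 / 1000)\<^sup>2" using \<rho> by (intro power_mono) auto
    then have "13 / 4 * \<rho>\<^sup>2 \<le> 1 / 12 * (1 - 2 * \<rho>)" using \<rho> by (simp add: power2_eq_square)
    then show "13 / 4 * \<rho>\<^sup>2 / (1 - 2 * \<rho>) \<le> 1 / 12" using \<rho> by (subst pos_divide_le_eq) auto
  qed
  finally have runs: "R.mass 0 \<le> ennreal (1 / 12)" .
  \<comment> \<open>A winning red gap with \<open>n\<close> letters contains \<open>n + 1\<close>
    red units; fewer than \<open>m\<close> values of \<open>n\<close> can fit, whatever the letters
    are, whence \<open>q = 1\<close>.\<close>
  have gaps: "(\<Sum>n. \<integral>\<^sup>+w. (if R.gap_word w n m then 1 else 0) \<partial>S) \<le> ennreal (1 * m)" if "0 \<le> m" for m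
  proof -
    have "(\<integral>\<^sup>+w. (if R.gap_word w n m then 1 else 0) \<partial>S) \<le> (\<integral>\<^sup>+w. (if real (Suc n) \<le> m then 1 else 0) \<partial>S)" for n
    proof (rule nn_integral_mono)
      fix w
      have "real n \<le> wt (snth w) 0 n" if "snth w ` {0..<n} \<subseteq> {0..}"
        using wt_ge[of 0 n "snth w"] that by force
      then show "(if R.gap_word w n m then 1 else 0) \<le> (if real (Suc n) \<le> m then 1 else 0 :: ennreal)"
        by (auto simp: R.gap_word_def sgn_of_def)
    qed
    then have "(\<Sum>n. \<integral>\<^sup>+w. (if R.gap_word w n m then 1 else 0) \<partial>S) \<le> (\<Sum>n. if real (Suc n) \<le> m then 1 else 0)"
      by (intro suminf_le summableI) simp
    with suminf_count_le[OF that] show ?thesis by simp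
  qed
  have "0 < ennreal ((1 / 2 - 0) / D)" using D by (simp only: ennreal_less_zero_iff) simp
  also have "\<dots> = emeasure U {0..1 / 2}" using D by (intro emeasure_U[symmetric]) auto
  also have "\<dots> \<le> emeasure U {x. x \<notin> {1..D}}"
    by (intro emeasure_mono) auto
  finally have "0 < emeasure U {x. x \<notin> {1..D}}" .
  moreover have "AE x in U. 0 < x \<and> (Red = Red \<longrightarrow> x < 2) \<and> (x \<notin> {1..D} \<longrightarrow> (if Red = Blue then 1 < x else x < 1))"
    using AE_U[of 0] by eventually_elim (use D' in auto)
  moreover have "AE x in U. x \<noteq> y" for y
    using AE_U[of y] by eventually_elim auto
  ultimately show ?thesis
    by unfold_locales (use runs gaps in auto)
qed

section \<open>Expected length of runs when blue wins\<close>

lemma runs_integral: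
  assumes "0 \<le> t"
  shows "(\<integral>\<^sup>+w. (if \<forall>l<n. w !! l \<in> {0..1} then ennreal (t + wt (snth w) 0 n) else 0) \<partial>S) =
    ennreal ((1 / D) ^ n * (t + 3 / 2 * real n))"
  using assms
\<comment> \<open>The shift \<open>t\<close> collects the length of the letters already
  read.\<close>
proof (induction n arbitrary: t)
  case (Suc n)
  let ?g = "\<lambda>n t w. if \<forall>l<n. w !! l \<in> {0..1} then ennreal (t + wt (snth w) 0 n) else 0"
  have [measurable]: "Measurable.pred S (\<lambda>w. w !! l \<in> {0..1})" for l
    by (rule pred_sets2[of "{0..1}" borel]) auto
  have [measurable]: "?g n t \<in> borel_measurable S" for n t by measurable
  have wt: "wt (snth (x ## w)) 0 (Suc n) = 1 + x + wt (snth w) 0 n" for x w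
    unfolding wt_def by (subst sum.atLeast0_lessThan_Suc_shift) simp
  have "?g (Suc n) t (x ## w) = (if x \<in> {0..1} then ?g n (t + 1 + x) w else 0)" for x w
  proof -
    have "(\<forall>l<Suc n. (x ## w) !! l \<in> {0..1}) \<longleftrightarrow> x \<in> {0..1} \<and> (\<forall>l<n. w !! l \<in> {0..1})"
      by (simp add: All_less_Suc2)
    then show ?thesis unfolding wt by (simp only: add.assoc simp_thms split: if_split) blast
  qed
  then have "(\<integral>\<^sup>+w. ?g (Suc n) t w \<partial>S) =
      (\<integral>\<^sup>+x. \<integral>\<^sup>+w. (if x \<in> {0..1} then ?g n (t + 1 + x) w else 0) \<partial>S \<partial>U)"
    by (subst U.nn_integral_stream_space) (simp_all only:, measurable)
  also have "\<dots> = (\<integral>\<^sup>+x. ennreal ((1 / D) ^ n) * (ennreal (t + 1 + 3 / 2 * real n + 1 * x) * indicator {0..1} x) \<partial>U)"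
  proof (rule nn_integral_cong)
    fix x
    show "(\<integral>\<^sup>+w. (if x \<in> {0..1} then ?g n (t + 1 + x) w else 0) \<partial>S) =
        ennreal ((1 / D) ^ n) * (ennreal (t + 1 + 3 / 2 * real n + 1 * x) * indicator {0..1} x)"
    proof (cases "x \<in> {0..1}")
      case True
      then have "0 \<le> t + 1 + x" using Suc.prems by simp
      then have "ennreal ((1 / D) ^ n * (t + 1 + x + 3 / 2 * real n)) =
          ennreal ((1 / D) ^ n) * ennreal (t + 1 + 3 / 2 * real n + 1 * x)"
        using D by (subst ennreal_mult[symmetric]) (auto simp: algebra_simps)
      with Suc.IH[OF \<open>0 \<le> t + 1 + x\<close>] True show ?thesis
        by (simp only: if_True indicator_simps mult_1_right)
    next
      case False
      then show ?thesis by (simp only: if_False indicator_simps mult_zero_right nn_integral_const) simp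
    qed
  qed
  also have "\<dots> = ennreal ((1 / D) ^ n) * (ennreal (1 / D) *
      (\<integral>\<^sup>+x. ennreal (t + 1 + 3 / 2 * real n + 1 * x) * indicator {0..1} x * indicator {0..D} x \<partial>lborel))"
    by (simp add: nn_integral_cmult nn_integral_U)
  also have "(\<integral>\<^sup>+x. ennreal (t + 1 + 3 / 2 * real n + 1 * x) * indicator {0..1} x * indicator {0..D} x \<partial>lborel) =
      (\<integral>\<^sup>+x. ennreal (t + 1 + 3 / 2 * real n + 1 * x) * indicator {0..1} x \<partial>lborel)"
    using D by (intro nn_integral_cong) (auto simp: indicator_def)
  also have "\<dots> = ennreal (t + 3 / 2 * real (Suc n))"
  proof -
    have "(t + 1 + 3 / 2 * real n) * (1 - 0) + 1 * (1\<^sup>2 - 0\<^sup>2) / 2 = t + 3 / 2 * real (Suc n)"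
      by (simp add: field_simps)
    with nn_integral_linear[of 0 1 "t + 1 + 3 / 2 * real n" 1] Suc.prems show ?thesis
      by (simp only:)
  qed
  also have "ennreal ((1 / D) ^ n) * (ennreal (1 / D) * ennreal (t + 3 / 2 * real (Suc n))) =
      ennreal ((1 / D) ^ Suc n * (t + 3 / 2 * real (Suc n)))"
  proof -
    have "ennreal a * (ennreal b * ennreal y) = ennreal (b * a * y)" if "0 \<le> a" "0 \<le> b" "0 \<le> y" for a b y
      using that by (simp add: ennreal_mult mult_ac)
    from this[of "(1 / D) ^ n" "1 / D" "t + 3 / 2 * real (Suc n)"] show ?thesis
      using Suc.prems D by (simp only: power_Suc) simp
  qed
  finally show ?case .
qed simp

sublocale B: branching U Blue "{0..1}" 1
  by unfold_locales auto

text \<open>A letter is at most 1 with probability \<open>1 / D\<close> and then has mean 1/2, so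
  with its red unit it contributes 3/2. The bound is the sum over \<open>n \<ge> 1\<close> of
  \<open>(1 / D) ^ n * (1 + 3 / 2 * n)\<close>, a geometric series plus a derivative of one.\<close>

lemma blue_mass:
  assumes "1 < D"
  shows "B.mass 0 \<le> ennreal (1 / (D - 1) + 3 / 2 * D / (D - 1)\<^sup>2)"
proof -
  let ?f = "\<lambda>n. if 1 \<le> n then (1 / D) ^ n * (1 + 3 / 2 * real n) else 0"
  have "B.mass 0 \<le> (\<Sum>n. ennreal (?f n))"
    unfolding B.mass_def
  proof (intro suminf_le summableI)
    fix n
    show "(\<integral>\<^sup>+w. (if branch Blue {0..1} 1 0 (snth w) 0 n then ennreal (sgn_of Blue + wt (snth w) 0 n) else 0) \<partial>S)
        \<le> ennreal (?f n)"
    proof (cases "1 \<le> n")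
      case True
      have "(\<integral>\<^sup>+w. (if branch Blue {0..1} 1 0 (snth w) 0 n then ennreal (sgn_of Blue + wt (snth w) 0 n) else 0) \<partial>S) =
          (\<integral>\<^sup>+w. (if \<forall>l<n. w !! l \<in> {0..1} then ennreal (1 + wt (snth w) 0 n) else 0) \<partial>S)"
        using True by (intro nn_integral_cong if_cong) (auto simp: sgn_of_def image_subset_iff)
      with True show ?thesis using runs_integral[of 1 n] by simp
    qed simp
  qed
  also have "(\<Sum>n. ennreal (?f n)) = ennreal (1 / (D - 1) + 3 / 2 * D / (D - 1)\<^sup>2)"
  proof (rule suminf_ennreal_eq)
    show "0 \<le> ?f n" for n using D by auto
    have r: "norm (1 / D) < 1" using assms by simp
    have "(\<lambda>n. 1 / D * (1 / D) ^ n + 3 / 2 * (1 / D) * (of_nat (Suc n) * (1 / D) ^ n)) sums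
        (1 / D * (1 / (1 - 1 / D)) + 3 / 2 * (1 / D) * (1 / (1 - 1 / D)\<^sup>2))"
      by (intro sums_add sums_mult geometric_sums[OF r] geometric_deriv_sums[OF r])
    moreover have "1 / D * (1 / (1 - 1 / D)) = 1 / (D - 1)" using assms by (simp add: field_simps)
    moreover have "3 / 2 * (1 / D) * (1 / (1 - 1 / D)\<^sup>2) = 3 / 2 * D / (D - 1)\<^sup>2"
      using assms by (simp add: power2_eq_square field_simps)
    moreover have "(\<lambda>n. ?f (n + 1)) = (\<lambda>n. 1 / D * (1 / D) ^ n + 3 / 2 * (1 / D) * (of_nat (Suc n) * (1 / D) ^ n))"
      using D by (intro ext) (simp add: field_simps)
    ultimately have "(\<lambda>n. ?f (n + 1)) sums (1 / (D - 1) + 3 / 2 * D / (D - 1)\<^sup>2)"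
      by (simp only:)
    then show "?f sums (1 / (D - 1) + 3 / 2 * D / (D - 1)\<^sup>2)"
      using sums_iff_shift[of ?f 1] by simp
  qed
  finally show ?thesis .
qed

section \<open>A renewal inequality for the gaps when blue wins\<close>

definition ending :: "nat \<Rightarrow> real \<Rightarrow> real stream \<Rightarrow> bool" where
  "ending n m w \<longleftrightarrow> w !! n \<notin> {0..1} \<and> snth w ` {0..<Suc n} \<subseteq> {0..} \<and> wt (snth w) 0 (Suc n) - 1 < m"

lemma measurable_ending [measurable]:
  assumes [measurable]: "f \<in> measurable N S" "g \<in> borel_measurable N"
  shows "Measurable.pred N (\<lambda>x. ending n (g x) (f x))"
proof -
  have [measurable]: "(\<lambda>x. f x !! i) \<in> borel_measurable N" for i
    by (rule measurable_compose[OF assms(1) measurable_snth_real])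
  have [measurable]: "Measurable.pred N (\<lambda>x. f x !! i \<in> {0..1})" for i
    by (rule pred_sets2[of "{0..1}" borel]) auto
  show ?thesis unfolding ending_def image_subset_iff atLeast_iff wt_def by measurable
qed

lemma ending_0: "ending 0 m (x ## w) \<longleftrightarrow> 1 < x \<and> x < m"
  by (auto simp: ending_def wt_def)

lemma ending_Suc: "ending (Suc n) m (x ## w) \<longleftrightarrow> 0 \<le> x \<and> ending n (m - 1 - x) w"
proof -
  have "wt (snth (x ## w)) 0 (Suc (Suc n)) = 1 + x + wt (snth w) 0 (Suc n)"
    unfolding wt_def by (subst sum.atLeast0_lessThan_Suc_shift) simp
  moreover have "snth (x ## w) ` {0..<Suc (Suc n)} = insert x (snth w ` {0..<Suc n})"
    by (simp only: atLeast0_lessThan_Suc_eq_insert_0[of "Suc n"] image_insert image_image snth.simps stream.sel)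
  ultimately show ?thesis unfolding ending_def by auto
qed

lemma gap_word_ending: "B.gap_word w (Suc n) m \<longleftrightarrow> w !! 0 \<notin> {0..1} \<and> ending n m w"
  by (auto simp: B.gap_word_def ending_def sgn_of_def)

text \<open>A truncated renewal function for steps \<open>1 + x\<close>, counting only the places
  right after a letter outside [0, 1]. Truncation at \<open>K\<close> lets the bound be proved by
  induction from the empty sum.\<close>

definition renewal :: "nat \<Rightarrow> real \<Rightarrow> ennreal" where
  "renewal K m = (\<Sum>n<K. \<integral>\<^sup>+w. (if ending n m w then 1 else 0) \<partial>S)"

lemma measurable_renewal [measurable]:
  assumes [measurable]: "g \<in> borel_measurable N"
  shows "(\<lambda>x. renewal K (g x)) \<in> borel_measurable N"
  unfolding renewal_def by measurable

text \<open>Conditioning on the first letter: either the word ends there, or the letter uses up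
  \<open>1 + x\<close> of the permitted length and the count restarts. The predicate
  \<open>Q\<close> allows two uses: no restriction for the renewal recursion, a long first letter
  for gaps.\<close>

lemma renewal_first_letter:
  assumes [measurable]: "Measurable.pred borel Q"
  shows "(\<Sum>n<Suc K. \<integral>\<^sup>+w. (if Q (w !! 0) \<and> ending n m w then 1 else 0) \<partial>S) =
    (\<integral>\<^sup>+x. (if Q x then (if 1 < x \<and> x < m then 1 else 0) + (if 0 \<le> x then renewal K (m - 1 - x) else 0) else 0) \<partial>U)"
proof -
  have [measurable]: "Measurable.pred S (\<lambda>w. Q (w !! 0))"
    by (rule measurable_compose[OF measurable_snth_real assms])
  have "(\<integral>\<^sup>+w. (if Q (w !! 0) \<and> ending 0 m w then 1 else 0) \<partial>S) =
      (\<integral>\<^sup>+x. (if Q x \<and> 1 < x \<and> x < m then 1 else 0) \<partial>U)"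
    by (subst U.nn_integral_stream_space) (simp_all add: ending_0 cong: if_cong)
  moreover have "(\<integral>\<^sup>+w. (if Q (w !! 0) \<and> ending (Suc n) m w then 1 else 0) \<partial>S) =
      (\<integral>\<^sup>+x. (if Q x \<and> 0 \<le> x then \<integral>\<^sup>+w. (if ending n (m - 1 - x) w then 1 else 0) \<partial>S else 0) \<partial>U)" for n
    by (subst U.nn_integral_stream_space) (auto simp: ending_Suc intro!: nn_integral_cong)
  ultimately have "(\<Sum>n<Suc K. \<integral>\<^sup>+w. (if Q (w !! 0) \<and> ending n m w then 1 else 0) \<partial>S) =
      (\<integral>\<^sup>+x. (if Q x \<and> 1 < x \<and> x < m then 1 else 0) \<partial>U) +
      (\<Sum>n<K. \<integral>\<^sup>+x. (if Q x \<and> 0 \<le> x then \<integral>\<^sup>+w. (if ending n (m - 1 - x) w then 1 else 0) \<partial>S else 0) \<partial>U)"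
    unfolding sum.lessThan_Suc_shift by (simp only:)
  also have "\<dots> = (\<integral>\<^sup>+x. (if Q x \<and> 1 < x \<and> x < m then 1 else 0) +
      (\<Sum>n<K. if Q x \<and> 0 \<le> x then \<integral>\<^sup>+w. (if ending n (m - 1 - x) w then 1 else 0) \<partial>S else 0) \<partial>U)"
    by (simp add: nn_integral_add nn_integral_sum)
  finally show ?thesis
    by (simp add: renewal_def if_distrib sum.If_cases cong: if_cong) (auto intro!: nn_integral_cong)
qed

text \<open>
  Any constant between 0.203 and 0.213 could replace 21/100: with 0.202 this renewal inequality fails
  at \<open>m = D = 7.048\<close>, and with 0.214 the condition \<open>12 * q * h \<le> 1\<close> does.
\<close>

lemma long_letter_bound:
  assumes D': "7048 / 1000 \<le> D"
  shows "(\<integral>\<^sup>+x. (if 1 < x then (if x < m then 1 else 0) + ennreal (21 / 100 * (m - 1 - x)) else 0) \<partial>U)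
    \<le> ennreal (21 / 100 * (D - 1) / D * m)"
proof -
  let ?f = "\<lambda>x. (if 1 < x then (if x < m then 1 else 0) + ennreal (21 / 100 * (m - 1 - x)) else 0) * indicator {0..D} x"
  have eq: "(\<integral>\<^sup>+x. (if 1 < x then (if x < m then 1 else 0) + ennreal (21 / 100 * (m - 1 - x)) else 0) \<partial>U) =
      ennreal (1 / D) * (\<integral>\<^sup>+x. ?f x \<partial>lborel)"
    by (rule nn_integral_U) measurable
  consider "m \<le> 1" | "1 < m" "m < 2" | "2 \<le> m" by linarith
  then have "(\<integral>\<^sup>+x. ?f x \<partial>lborel) \<le> ennreal (21 / 100 * (D - 1) * m)"
  proof cases
    case 1
    then have "?f x = 0" for x by (auto simp: ennreal_neg)
    then have "(\<integral>\<^sup>+x. ?f x \<partial>lborel) = 0" by (simp only: nn_integral_const) simp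
    then show ?thesis by simp
  next
    case 2
    then have "?f x \<le> ennreal (1 + 0 * x) * indicator {1..m} x" for x
      by (auto simp: ennreal_neg indicator_def)
    then have "(\<integral>\<^sup>+x. ?f x \<partial>lborel) \<le> (\<integral>\<^sup>+x. ennreal (1 + 0 * x) * indicator {1..m} x \<partial>lborel)"
      by (intro nn_integral_mono)
    also have "\<dots> = ennreal (m - 1)" using 2 by (subst nn_integral_linear) auto
    also have "m - 1 \<le> 21 / 100 * (D - 1) * m"
    proof -
      have "1 * m \<le> 21 / 100 * (D - 1) * m" using 2 D' by (intro mult_right_mono) auto
      then show ?thesis by linarith
    qed
    finally show ?thesis by (simp add: ennreal_leI)
  next
    case 3
    define M where "M = min m D"
    define M' where "M' = min (m - 1) D"
    have M: "1 \<le> M" "1 \<le> M'" "M' \<le> m - 1" using 3 D' by (auto simp: M_def M'_def)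
    have "?f x \<le> ennreal (1 + 0 * x) * indicator {1..M} x +
        ennreal (21 / 100 * (m - 1) + - (21 / 100) * x) * indicator {1..M'} x" for x
    proof -
      have "21 / 100 * (m - 1 - x) = 21 / 100 * (m - 1) + - (21 / 100) * x" by (simp add: field_simps)
      then show ?thesis
        by (cases "x \<le> m - 1") (auto simp: indicator_def M_def M'_def ennreal_neg)
    qed
    then have "(\<integral>\<^sup>+x. ?f x \<partial>lborel) \<le> (\<integral>\<^sup>+x. ennreal (1 + 0 * x) * indicator {1..M} x +
        ennreal (21 / 100 * (m - 1) + - (21 / 100) * x) * indicator {1..M'} x \<partial>lborel)"
      by (intro nn_integral_mono)
    also have "\<dots> = ennreal (M - 1) + ennreal (21 / 100 * (m - 1) * (M' - 1) - 21 / 100 * (M'\<^sup>2 - 1) / 2)"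
    proof -
      have i1: "(\<integral>\<^sup>+x. ennreal (1 + 0 * x) * indicator {1..M} x \<partial>lborel) = ennreal (M - 1)"
        using M by (subst nn_integral_linear) auto
      have i2: "(\<integral>\<^sup>+x. ennreal (21 / 100 * (m - 1) + - (21 / 100) * x) * indicator {1..M'} x \<partial>lborel) =
          ennreal (21 / 100 * (m - 1) * (M' - 1) + - (21 / 100) * (M'\<^sup>2 - 1\<^sup>2) / 2)"
        by (rule nn_integral_linear) (use M in auto)
      have i3: "21 / 100 * (m - 1) * (M' - 1) + - (21 / 100) * (M'\<^sup>2 - 1\<^sup>2) / 2 =
          21 / 100 * (m - 1) * (M' - 1) - 21 / 100 * (M'\<^sup>2 - 1) / 2"
        by simp
      have "(\<integral>\<^sup>+x. ennreal (1 + 0 * x) * indicator {1..M} x +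
          ennreal (21 / 100 * (m - 1) + - (21 / 100) * x) * indicator {1..M'} x \<partial>lborel) =
          (\<integral>\<^sup>+x. ennreal (1 + 0 * x) * indicator {1..M} x \<partial>lborel) +
          (\<integral>\<^sup>+x. ennreal (21 / 100 * (m - 1) + - (21 / 100) * x) * indicator {1..M'} x \<partial>lborel)"
        by (rule nn_integral_add) measurable
      then show ?thesis by (simp only: i1 i2 i3)
    qed
    also have "\<dots> = ennreal (M - 1 + (21 / 100 * (m - 1) * (M' - 1) - 21 / 100 * (M'\<^sup>2 - 1) / 2))"
    proof (rule ennreal_plus[symmetric])
      have "0 \<le> 21 / 100 * ((M' - 1) * ((m - 1) - (M' + 1) / 2))"
        using M 3 by (intro mult_nonneg_nonneg) auto
      then show "0 \<le> 21 / 100 * (m - 1) * (M' - 1) - 21 / 100 * (M'\<^sup>2 - 1) / 2"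
        by (simp add: power2_eq_square field_simps)
    qed (use M in auto)
    also have "M - 1 + (21 / 100 * (m - 1) * (M' - 1) - 21 / 100 * (M'\<^sup>2 - 1) / 2) \<le> 21 / 100 * (D - 1) * m"
    proof -
      consider "m \<le> D" | "D < m" "m \<le> D + 1" | "D + 1 < m" by linarith
      then show ?thesis
      proof cases
        case a: 1
        \<comment> \<open>Here the left side of the goal is
          \<open>m - 1 + 21 / 200 * (m - 2)^2\<close>. Replacing one factor \<open>m - 2\<close> by
          \<open>D - 2\<close> makes it linear in \<open>m\<close>.\<close>
        have "(m - 2) * (m - 2) \<le> (m - 2) * (D - 2)" using a 3 by (intro mult_left_mono) auto
        moreover have "0 \<le> 21 / 100 * (D - 1) * m - (m - 1) - 21 / 200 * ((m - 2) * (D - 2))"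
        proof -
          have "0 \<le> (m - 2) * (D * (21 / 200)) + 42 / 100 * (D - 1) - 1 - (m - 2)"
          proof (cases "1 \<le> D * (21 / 200)")
            case True
            then have "(m - 2) * 1 \<le> (m - 2) * (D * (21 / 200))" using 3 by (intro mult_left_mono) auto
            moreover define X where "X = (m - 2) * (D * (21 / 200))"
            ultimately have "m - 2 \<le> X" by simp
            then show ?thesis using D' unfolding X_def[symmetric] by (simp add: field_simps)
          next
            case False
            then have "(m - 2) * (1 - D * (21 / 200)) \<le> (D - 2) * (1 - D * (21 / 200))"
              using a by (intro mult_right_mono) auto
            \<comment> \<open>At \<open>m = D\<close> the remaining slack is
              \<open>0.105 * D^2 - 0.79 * D + 0.58\<close>. For the \<open>D\<close> in question it
              exceeds this product, one factor of which vanishes at the threshold 7.048.\<close>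
            moreover have "0 \<le> (D - 7048 / 1000) * (D * (21 / 200) - 50 / 1000)"
              using D' by (intro mult_nonneg_nonneg) auto
            ultimately show ?thesis using D' by (simp add: field_simps)
          qed
          then show ?thesis by (simp add: field_simps)
        qed
        moreover have MM: "M = m" "M' = m - 1" using a by (auto simp: M_def M'_def)
        ultimately show ?thesis unfolding MM by (simp add: power2_eq_square field_simps)
      next
        case b: 2
        \<comment> \<open>Beyond \<open>D\<close> only the renewal term still gains range: compared
          with \<open>m = D\<close> the slack changes by \<open>0.21 * s - 0.105 * s^2\<close>,
          which is nonnegative.\<close>
        define s where "s = m - D"
        have s: "m = D + s" "0 \<le> s" "s \<le> 1" using b by (auto simp: s_def)
        have "s * s \<le> s * 1" using s by (intro mult_left_mono) auto
        moreover have "0 \<le> (D - 7048 / 1000) * (D * (21 / 200) - 50 / 1000)"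
          using D' by (intro mult_nonneg_nonneg) auto
        moreover have MM: "M = D" "M' = D + s - 1" using b s by (auto simp: M_def M'_def)
        ultimately show ?thesis using s(2) D' unfolding MM s(1) by (simp add: power2_eq_square field_simps)
      next
        case c: 3
        then have "M = D" "M' = D" by (auto simp: M_def M'_def)
        moreover have "0 \<le> (D - 1) * (21 / 100 * (1 + (D + 1) / 2) - 1)"
          using D' by (intro mult_nonneg_nonneg) auto
        ultimately show ?thesis by (simp add: power2_eq_square field_simps)
      qed
    qed
    finally show ?thesis by (simp add: ennreal_leI)
  qed
  then have "ennreal (1 / D) * (\<integral>\<^sup>+x. ?f x \<partial>lborel) \<le> ennreal (1 / D) * ennreal (21 / 100 * (D - 1) * m)"
    by (rule mult_left_mono) simp
  also have "\<dots> = ennreal (21 / 100 * (D - 1) / D * m)"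
    using D by (simp add: ennreal_mult'[symmetric] mult.commute)
  finally show ?thesis unfolding eq .
qed

text \<open>A first letter in [0, 1] has probability \<open>1 / D\<close>, does not end the word and
  leaves less than \<open>m\<close>, so it accounts for at most the fraction \<open>1 / D\<close> of
  the bound. Long first letters may use the remaining fraction \<open>(D - 1) / D\<close>, which is
  what \<open>long_letter_bound\<close> gives them.\<close>

lemma renewal_bound:
  assumes D': "7048 / 1000 \<le> D"
  shows "renewal K m \<le> ennreal (21 / 100 * m)"
proof (induction K arbitrary: m)
  case (Suc K)
  let ?g = "\<lambda>x. if 1 < x then (if x < m then 1 else 0) + ennreal (21 / 100 * (m - 1 - x)) else 0"
  have "renewal (Suc K) m = (\<integral>\<^sup>+x. (if True then (if 1 < x \<and> x < m then 1 else 0) +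
      (if 0 \<le> x then renewal K (m - 1 - x) else 0) else 0) \<partial>U)"
    using renewal_first_letter[where Q = "\<lambda>_. True" and K = K and m = m] by (simp add: renewal_def)
  also have "\<dots> \<le> (\<integral>\<^sup>+x. ?g x + ennreal (21 / 100 * m) * indicator {0..1} x \<partial>U)"
  proof (rule nn_integral_mono)
    fix x
    have "renewal K (m - 1 - x) \<le> ennreal (21 / 100 * (m - 1 - x))" by (rule Suc)
    moreover have "ennreal (21 / 100 * (m - 1 - x)) \<le> ennreal (21 / 100 * m)" if "0 \<le> x"
      using that by (intro ennreal_leI) simp
    ultimately show "(if True then (if 1 < x \<and> x < m then 1 else 0) +
      (if 0 \<le> x then renewal K (m - 1 - x) else 0) else 0) \<le> ?g x + ennreal (21 / 100 * m) * indicator {0..1} x"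
      by (cases "1 < x"; cases "0 \<le> x") (auto intro: order_trans add_mono)
  qed
  also have "\<dots> = (\<integral>\<^sup>+x. ?g x \<partial>U) + ennreal (21 / 100 * m) * emeasure U {0..1}"
    by (subst nn_integral_add) (simp_all add: nn_integral_cmult_indicator)
  also have "emeasure U {0..1} = ennreal (1 / D)" using D emeasure_U[of 0 1] by (simp only: diff_zero)
  also have "(\<integral>\<^sup>+x. ?g x \<partial>U) + ennreal (21 / 100 * m) * ennreal (1 / D) \<le>
      ennreal (21 / 100 * (D - 1) / D * m) + ennreal (21 / 100 * m) * ennreal (1 / D)"
    by (intro add_right_mono long_letter_bound D')
  also have "\<dots> = ennreal (21 / 100 * m)"
  proof (cases "0 \<le> m")
    case True
    then have "ennreal (21 / 100 * (D - 1) / D * m) + ennreal (21 / 100 * m) * ennreal (1 / D) =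
        ennreal (21 / 100 * (D - 1) / D * m + 21 / 100 * m * (1 / D))"
      using D by (simp add: ennreal_mult[symmetric] ennreal_plus[symmetric] del: ennreal_plus)
    also have "21 / 100 * (D - 1) / D * m + 21 / 100 * m * (1 / D) = 21 / 100 * m"
      using D by (simp add: field_simps)
    finally show ?thesis .
  next
    case False
    then have "21 / 100 * (D - 1) / D * m \<le> 0" using D by (intro mult_nonneg_nonpos) auto
    then show ?thesis using False by (simp add: ennreal_neg)
  qed
  finally show ?case .
qed (simp add: renewal_def)

text \<open>A gap must start with a long letter, so only the long-letter share of the renewal step
  counts; hence the factor \<open>(D - 1) / D\<close> in \<open>q\<close>.\<close>

lemma blue_gaps:
  assumes D': "7048 / 1000 \<le> D"
  shows "(\<Sum>n. \<integral>\<^sup>+w. (if B.gap_word w n m then 1 else 0) \<partial>S) \<le> ennreal (21 / 100 * (D - 1) / D * m)"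
proof (rule suminf_le_const)
  fix K
  let ?G = "\<lambda>n. \<integral>\<^sup>+w. (if B.gap_word w n m then 1 else 0) \<partial>S"
  have "(\<Sum>n<K. ?G n) \<le> (\<Sum>n<Suc (Suc K). ?G n)" by (intro sum_mono2) auto
  also have "\<dots> = ?G 0 + (\<Sum>n<Suc K. ?G (Suc n))" by (rule sum.lessThan_Suc_shift)
  also have "?G 0 = 0" by (simp add: B.gap_word_def)
  also have "0 + (\<Sum>n<Suc K. ?G (Suc n)) =
      (\<integral>\<^sup>+x. (if x \<notin> {0..1} then (if 1 < x \<and> x < m then 1 else 0) +
        (if 0 \<le> x then renewal K (m - 1 - x) else 0) else 0) \<partial>U)"
    unfolding gap_word_ending by (subst renewal_first_letter) simp_all
  also have "\<dots> \<le> (\<integral>\<^sup>+x. (if 1 < x then (if x < m then 1 else 0) + ennreal (21 / 100 * (m - 1 - x)) else 0) \<partial>U)"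
  proof (rule nn_integral_mono)
    fix x
    show "(if x \<notin> {0..1} then (if 1 < x \<and> x < m then 1 else 0) +
        (if 0 \<le> x then renewal K (m - 1 - x) else 0) else 0) \<le>
      (if 1 < x then (if x < m then 1 else 0) + ennreal (21 / 100 * (m - 1 - x)) else 0)"
      using renewal_bound[OF D', of K "m - 1 - x"] by (auto intro: add_left_mono)
  qed
  also note long_letter_bound[OF D']
  finally show "(\<Sum>n<K. ?G n) \<le> ennreal (21 / 100 * (D - 1) / D * m)" .
qed simp

lemma blue_winning:
  assumes D': "7048 / 1000 \<le> D"
  shows "winning U Blue {0..1} 1 (21 / 100 * (D - 1) / D) (1 / (D - 1) + 3 / 2 * D / (D - 1)\<^sup>2)"
proof -
  have "0 < ennreal ((3 - 2) / D)" using D' by (simp only: ennreal_less_zero_iff) simp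
  also have "\<dots> = emeasure U {2..3}" using D' by (intro emeasure_U[symmetric]) auto
  also have "\<dots> \<le> emeasure U {x. x \<notin> {0..1}}"
    by (intro emeasure_mono) auto
  finally have "0 < emeasure U {x. x \<notin> {0..1}}" .
  moreover have "AE x in U. 0 < x \<and> (Blue = Red \<longrightarrow> x < 2) \<and> (x \<notin> {0..1} \<longrightarrow> (if Blue = Blue then 1 < x else x < 1))"
    using AE_U[of 0] by eventually_elim auto
  moreover have "AE x in U. x \<noteq> y" for y
    using AE_U[of y] by eventually_elim auto
  moreover have "12 * (21 / 100 * (D - 1) / D) * (1 / (D - 1) + 3 / 2 * D / (D - 1)\<^sup>2) \<le> 1"
  proof -
    \<comment> \<open>In this form \<open>12 * q * h\<close> is visibly decreasing in
      \<open>D\<close>; at \<open>D = 7.048\<close> it is about 0.983.\<close>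
    have "12 * (21 / 100 * e / D) * (1 / e + 3 / 2 * D / e\<^sup>2) = 252 / 100 * (1 / D + 3 / 2 / e)"
      if "0 < e" for e :: real
      using D' that by (simp add: power2_eq_square field_simps)
    from this[of "D - 1"] have eq: "12 * (21 / 100 * (D - 1) / D) * (1 / (D - 1) + 3 / 2 * D / (D - 1)\<^sup>2) =
        252 / 100 * (1 / D + 3 / 2 / (D - 1))"
      using D' by (simp only: diff_gt_0_iff_gt)
    have "1 / D \<le> 1 / (7048 / 1000)" "3 / 2 / (D - 1) \<le> 3 / 2 / (6048 / 1000)"
      using D' by (intro divide_left_mono; simp)+
    then show ?thesis unfolding eq by simp
  qed
  ultimately show ?thesis
    by unfold_locales (use D' blue_gaps blue_mass in auto)
qed

end

theorem theorem2p6: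
  fixes \<gamma> :: real
  assumes "\<gamma> \<ge> 0"
  shows "(\<gamma> \<le> 0.1216 \<longrightarrow>
            wins_almost_surely Red (return borel 1) (uniform_measure lborel {0..1 + \<gamma>})) \<and>
         (\<gamma> \<ge> 6.048 \<longrightarrow>
            wins_almost_surely Blue (return borel 1) (uniform_measure lborel {0..1 + \<gamma>}))"
proof (intro conjI impI)
  interpret uniform_law "1 + \<gamma>" by unfold_locales (use assms in auto)
  show "wins_almost_surely Red (return borel 1) U" if "\<gamma> \<le> 0.1216"
    by (rule winning.colour_wins_almost_surely[OF red_winning]) (use that in simp)
  show "wins_almost_surely Blue (return borel 1) U" if "\<gamma> \<ge> 6.048"
    by (rule winning.colour_wins_almost_surely[OF blue_winning]) (use that in simp)
qed

end
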